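(* Let $I=[0,1]$, let $O$ be an open subset of $I\times\mathbf R\times\mathbf R$ (in the relative topology), and let $E=\mathbf R\times C^\infty(O)$. Let $\Sigma$ be the set of all $(\eta,\varphi,y)$ with $\eta\in\mathbf R$, $\varphi\in C^\infty(O)$, $y\in C^1(I)$ such that $y(0)=\eta$ and, for all $s\in I$, $(s,y(s),y'(s))\in O$ and $\varphi(s,y(s),y'(s))=0$. Let $\Sigma_0$ be the set of regular elements of $\Sigma$. Then for every $w\in\Sigma_0$ there is an open set $W$ in $E\times C^1(I)$ with $w\in W$ such that $(E,C^\infty(I),\Sigma\cap W)\in C^\infty_\pi$; i.e. $\Sigma\cap W$ is (the graph of) a function $(\eta,\varphi)\mapsto y$ with open domain in $E$ and values in $C^\infty(I)$ which is smooth, of class $C^\infty_\pi$, as a map into $C^\infty(I)$.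
   Context: All spaces are real. Regularity: $w=(\eta,\varphi,y)\in\Sigma$ is regular if, writing $p_\iota(s)=\partial_\iota\varphi(s,y(s),y'(s))$ for $\iota=2,3$ (partial derivatives with respect to the second and third real variables) and $F_0=\{u\in C^1(I):u(0)=0\}$, one has $p_3(s)\neq0$ for all $s\in I$ and for every $v\in F_0$ there is a unique $u\in F_0$ with $p_3u'+p_2u=v'$. Function spaces (real-valued functions): $C^i(I)$, $i\in\{0,1,2,\dots\}\cup\{\infty\}$, is the space of functions of class $C^i$ on $I$ (up to the boundary) with the topology of uniform convergence of all derivatives of order $<i+1$. $C^\infty(O)$ is the space of continuous $\varphi:O\to\mathbf R$ which are $C^\infty$ on the interior of $O$ in $\mathbf R^3$ and all of whose partial derivatives extend continuously to $O$ (the extensions are denoted by the same symbols), with the topology of uniform convergence of all partial derivatives on compact subsets of $O$. Products carry the product topology. Class $C^\infty_\pi$ (Keller): for locally convex $E,F$ and a function $f$ with $\operatorname{dom}f\subseteq E$ and values in $F$, put $d_uf(x)=\lim_{t\to0}t^{-1}(f(x+tu)-f(x))$ and $d(u_1,\dots,u_l)f=d_{u_l}\cdots d_{u_1}f$. $(E,F,f)\in C^\infty_\pi$ means: $\operatorname{dom}f$ is open in $E$ and for every integer $l\ge0$ and $x\in\operatorname{dom}f$, the map $d^lf(x):(u_1,\dots,u_l)\mapsto d(u_1,\dots,u_l)f(x)$ is everywhere defined, $l$-linear and continuous $E^l\to F$, and for every zero neighbourhood $W$ in $F$ there is a zero neighbourhood $U$ in $E$ such that for every $\varepsilon>0$ there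 is a zero neighbourhood $V$ in $E$ with $(d^lf(x+v)-d^lf(x))[U^l]\subseteq\varepsilon W$ for all $v\in V$. *)

theory Defs
  imports "HOL-Analysis.Analysis" "HOL-Library.Function_Algebras" "HOL-Library.Extended_Nat"
begin

instantiation "fun" :: (type, real_vector) real_vector
begin

definition scaleR_fun :: "real \<Rightarrow> ('a \<Rightarrow> 'b) \<Rightarrow> 'a \<Rightarrow> 'b"
  where "scaleR_fun c f = (\<lambda>x. c *\<^sub>R f x)"

instance
  by standard (auto simp: scaleR_fun_def fun_eq_iff scaleR_add_right scaleR_add_left)

end

lemma scaleR_fun_apply [simp]: "(c *\<^sub>R f) x = c *\<^sub>R f x"
  by (simp add: scaleR_fun_def)


section \<open>Locally convex spaces\<close>

text \<open>A topological vector space is given by its topology alone: the underlying vector space is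
  the topspace, required to be a linear subspace of the ambient type.\<close>

definition locally_convex :: "'a::real_vector topology \<Rightarrow> bool" where
  "locally_convex E \<longleftrightarrow>
     subspace (topspace E) \<and>
     continuous_map (prod_topology E E) E (\<lambda>(x, y). x + y) \<and>
     continuous_map (prod_topology euclideanreal E) E (\<lambda>(c, x). c *\<^sub>R x) \<and>
     (\<forall>U. openin E U \<and> 0 \<in> U \<longrightarrow> (\<exists>V. openin E V \<and> 0 \<in> V \<and> convex V \<and> V \<subseteq> U))"

definition zero_nbhd :: "'a::real_vector topology \<Rightarrow> 'a set \<Rightarrow> bool" where
  "zero_nbhd E U \<longleftrightarrow> U \<subseteq> topspace E \<and> (\<exists>G. openin E G \<and> 0 \<in> G \<and> G \<subseteq> U)"


section \<open>The class \<open>C\<^sup>\<infinity>\<^sub>\<pi>\<close>\<close>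

text \<open>Partial functions are represented by their graphs, so that a set of pairs such as the
  solution set below can itself be a member of the class.\<close>

definition app :: "('a \<times> 'b) set \<Rightarrow> 'a \<Rightarrow> 'b" where
  "app f x = (THE y. (x, y) \<in> f)"

text \<open>The graph of \<open>d\<^sub>u f\<close>; its domain consists of those points of the domain of \<open>f\<close> at which
  the limit exists in \<open>F\<close>.\<close>

definition dir_deriv ::
  "'b::real_vector topology \<Rightarrow> 'a::real_vector \<Rightarrow> ('a \<times> 'b) set \<Rightarrow> ('a \<times> 'b) set" where
  "dir_deriv F u f =
     {(x, z). x \<in> Domain f \<and>
        (\<forall>\<^sub>F t in at (0::real). x + t *\<^sub>R u \<in> Domain f) \<and>
        limitin F (\<lambda>t. (1 / t) *\<^sub>R (app f (x + t *\<^sub>R u) - app f x)) z (at 0)}"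

text \<open>Tuples \<open>(u\<^sub>1, \<dots>, u\<^sub>l)\<close> are functions on \<open>{..<l}\<close>, hence shifted by one. Since \<^const>\<open>fold\<close> treats
  the head of the list first, the graph below is that of \<open>d(u\<^sub>1, \<dots>, u\<^sub>l)f = d\<^bsub>u\<^sub>l\<^esub> \<dots> d\<^bsub>u\<^sub>1\<^esub> f\<close>.\<close>

definition iter_dir_deriv ::
  "'b::real_vector topology \<Rightarrow> nat \<Rightarrow> (nat \<Rightarrow> 'a::real_vector) \<Rightarrow> ('a \<times> 'b) set \<Rightarrow> ('a \<times> 'b) set" where
  "iter_dir_deriv F l u f = fold (dir_deriv F) (map u [0..<l]) f"

definition higher_deriv ::
  "'b::real_vector topology \<Rightarrow> ('a::real_vector \<times> 'b) set \<Rightarrow> nat \<Rightarrow> 'a \<Rightarrow> (nat \<Rightarrow> 'a) \<Rightarrow> 'b" where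
  "higher_deriv F f l x u = app (iter_dir_deriv F l u f) x"

definition multilinear_on ::
  "'a::real_vector set \<Rightarrow> nat \<Rightarrow> ((nat \<Rightarrow> 'a) \<Rightarrow> 'b::real_vector) \<Rightarrow> bool" where
  "multilinear_on X l m \<longleftrightarrow>
     (\<forall>u \<in> {..<l} \<rightarrow>\<^sub>E X. \<forall>i<l. \<forall>a\<in>X. \<forall>b\<in>X. \<forall>c.
        m (u(i := a + b)) = m (u(i := a)) + m (u(i := b)) \<and>
        m (u(i := c *\<^sub>R a)) = c *\<^sub>R m (u(i := a)))"

definition C_infty_pi ::
  "('a::real_vector topology \<times> 'b::real_vector topology \<times> ('a \<times> 'b) set) set" where
  "C_infty_pi =
     {(E, F, f). locally_convex E \<and> locally_convex F \<and>
        single_valued f \<and> openin E (Domain f) \<and> Range f \<subseteq> topspace F \<and>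
        (\<forall>l. \<forall>x \<in> Domain f.
           (\<forall>u \<in> {..<l} \<rightarrow>\<^sub>E topspace E. \<exists>!z. (x, z) \<in> iter_dir_deriv F l u f) \<and>
           multilinear_on (topspace E) l (higher_deriv F f l x) \<and>
           continuous_map (product_topology (\<lambda>_. E) {..<l}) F (higher_deriv F f l x) \<and>
           (\<forall>W. zero_nbhd F W \<longrightarrow>
              (\<exists>U. zero_nbhd E U \<and>
                 (\<forall>\<epsilon>>0. \<exists>V. zero_nbhd E V \<and>
                    (\<forall>v\<in>V. x + v \<in> Domain f \<and>
                       (\<forall>u \<in> {..<l} \<rightarrow>\<^sub>E U.
                          higher_deriv F f l (x + v) u - higher_deriv F f l x u
                            \<in> (\<lambda>z. \<epsilon> *\<^sub>R z) ` W))))))}"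


section \<open>Topologies of uniform convergence\<close>

text \<open>The topology on \<open>X\<close> of uniform convergence of all \<open>D j f\<close>, \<open>j \<in> J\<close>, on all members of \<open>\<K>\<close>.\<close>

definition unif_nbhd ::
  "'f set \<Rightarrow> ('j \<Rightarrow> 'f \<Rightarrow> 's \<Rightarrow> real) \<Rightarrow> ('j \<times> 's set) set \<Rightarrow> real \<Rightarrow> 'f \<Rightarrow> 'f set" where
  "unif_nbhd X D A \<epsilon> f = {g \<in> X. \<forall>(j, K) \<in> A. \<forall>s\<in>K. \<bar>D j g s - D j f s\<bar> < \<epsilon>}"

definition unif_topology ::
  "'f set \<Rightarrow> 'j set \<Rightarrow> 's set set \<Rightarrow> ('j \<Rightarrow> 'f \<Rightarrow> 's \<Rightarrow> real) \<Rightarrow> 'f topology" where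
  "unif_topology X J \<K> D =
     topology (\<lambda>U. U \<subseteq> X \<and>
       (\<forall>f\<in>U. \<exists>A \<epsilon>. finite A \<and> A \<subseteq> J \<times> \<K> \<and> \<epsilon> > 0 \<and> unif_nbhd X D A \<epsilon> f \<subseteq> U))"

lemma unif_nbhd_antimono:
  assumes "A \<subseteq> B" and "b \<le> a"
  shows "unif_nbhd X D B b f \<subseteq> unif_nbhd X D A a f"
proof
  fix g assume g: "g \<in> unif_nbhd X D B b f"
  have "\<bar>D j g s - D j f s\<bar> < a" if "(j, K) \<in> A" "s \<in> K" for j K s
  proof -
    have "(j, K) \<in> B" using that(1) assms(1) by (rule rev_subsetD)
    with g that(2) have "\<bar>D j g s - D j f s\<bar> < b" unfolding unif_nbhd_def by auto
    then show ?thesis using assms(2) by linarith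
  qed
  then show "g \<in> unif_nbhd X D A a f" using g unfolding unif_nbhd_def by auto
qed

lemma openin_unif_topology:
  "openin (unif_topology X J \<K> D) U \<longleftrightarrow>
     U \<subseteq> X \<and> (\<forall>f\<in>U. \<exists>A \<epsilon>. finite A \<and> A \<subseteq> J \<times> \<K> \<and> \<epsilon> > 0 \<and> unif_nbhd X D A \<epsilon> f \<subseteq> U)"
proof -
  define Q where "Q f U \<longleftrightarrow>
    (\<exists>A \<epsilon>. finite A \<and> A \<subseteq> J \<times> \<K> \<and> \<epsilon> > 0 \<and> unif_nbhd X D A \<epsilon> f \<subseteq> U)" for f U
  have mono: "Q f V" if Q: "Q f U" and sub: "U \<subseteq> V" for f U V
  proof -
    obtain A a where A: "finite A" "A \<subseteq> J \<times> \<K>" "a > 0" "unif_nbhd X D A a f \<subseteq> U"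
      using Q unfolding Q_def by (elim exE conjE)
    have "unif_nbhd X D A a f \<subseteq> V" using A(4) sub by (rule subset_trans)
    with A(1,2,3) show ?thesis unfolding Q_def by (intro exI conjI)
  qed
  have inter: "Q f (S \<inter> T)" if S: "Q f S" and T: "Q f T" for f S T
  proof -
    obtain A a where A: "finite A" "A \<subseteq> J \<times> \<K>" "a > 0" "unif_nbhd X D A a f \<subseteq> S"
      using S unfolding Q_def by (elim exE conjE)
    obtain B b where B: "finite B" "B \<subseteq> J \<times> \<K>" "b > 0" "unif_nbhd X D B b f \<subseteq> T"
      using T unfolding Q_def by (elim exE conjE)
    have "unif_nbhd X D (A \<union> B) (min a b) f \<subseteq> S"
      using unif_nbhd_antimono A(4) by (rule subset_trans) simp_all
    moreover have "unif_nbhd X D (A \<union> B) (min a b) f \<subseteq> T"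
      using unif_nbhd_antimono B(4) by (rule subset_trans) simp_all
    ultimately have "unif_nbhd X D (A \<union> B) (min a b) f \<subseteq> S \<inter> T" by (rule Int_greatest)
    moreover have "finite (A \<union> B)" "A \<union> B \<subseteq> J \<times> \<K>" "min a b > 0"
      using A(1,2,3) B(1,2,3) by simp_all
    ultimately show ?thesis unfolding Q_def by (intro exI conjI)
  qed
  have "istopology (\<lambda>U. U \<subseteq> X \<and> (\<forall>f\<in>U. Q f U))"
    unfolding istopology_def
  proof (rule conjI; (intro allI impI))
    fix S T
    assume S: "S \<subseteq> X \<and> (\<forall>f\<in>S. Q f S)" and T: "T \<subseteq> X \<and> (\<forall>f\<in>T. Q f T)"
    show "S \<inter> T \<subseteq> X \<and> (\<forall>f\<in>S \<inter> T. Q f (S \<inter> T))"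
    proof (intro conjI ballI)
      show "S \<inter> T \<subseteq> X" using S by (simp add: le_infI1)
      fix f assume "f \<in> S \<inter> T"
      then show "Q f (S \<inter> T)" using S T by (intro inter) simp_all
    qed
  next
    fix \<S>
    assume S: "\<forall>S\<in>\<S>. S \<subseteq> X \<and> (\<forall>f\<in>S. Q f S)"
    show "\<Union>\<S> \<subseteq> X \<and> (\<forall>f\<in>\<Union>\<S>. Q f (\<Union>\<S>))"
    proof (intro conjI Union_least ballI)
      show "S \<subseteq> X" if "S \<in> \<S>" for S
        using bspec[OF S that] by (rule conjunct1)
      fix f assume "f \<in> \<Union>\<S>"
      then obtain T where T: "f \<in> T" "T \<in> \<S>" by (rule UnionE)
      have "Q f T" using bspec[OF conjunct2[OF bspec[OF S T(2)]] T(1)] .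
      then show "Q f (\<Union>\<S>)" using Union_upper[OF T(2)] by (rule mono)
    qed
  qed
  then have "openin (unif_topology X J \<K> D) = (\<lambda>U. U \<subseteq> X \<and> (\<forall>f\<in>U. Q f U))"
    unfolding unif_topology_def Q_def by (rule topology_inverse')
  then show ?thesis by (simp add: Q_def)
qed

lemma topspace_unif_topology [simp]: "topspace (unif_topology X J \<K> D) = X"
proof
  show "topspace (unif_topology X J \<K> D) \<subseteq> X"
    using openin_topspace[of "unif_topology X J \<K> D"] unfolding openin_unif_topology by (rule conjunct1)
  have "finite {} \<and> {} \<subseteq> J \<times> \<K> \<and> (1::real) > 0 \<and> unif_nbhd X D {} 1 f \<subseteq> X" for f
    by (simp add: unif_nbhd_def)
  then have "openin (unif_topology X J \<K> D) X"
    unfolding openin_unif_topology by (intro conjI[OF subset_refl] ballI exI)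
  then show "X \<subseteq> topspace (unif_topology X J \<K> D)" by (rule openin_subset)
qed


section \<open>Function spaces\<close>

text \<open>Functions on \<open>I\<close> or on \<open>\<Omega>\<close> are total functions that vanish outside; this makes
  the representation unique and compatible with the pointwise linear structure.\<close>

abbreviation I01 :: "real set" where "I01 \<equiv> {0..1}"

text \<open>At the end points of \<open>I\<close> this is the one-sided derivative.\<close>

definition deriv_I :: "(real \<Rightarrow> real) \<Rightarrow> real \<Rightarrow> real" where
  "deriv_I f s = (if s \<in> I01 then vector_derivative f (at s within I01) else 0)"

definition C_I_set :: "enat \<Rightarrow> (real \<Rightarrow> real) set" where
  "C_I_set i =
     {f. (\<forall>s. s \<notin> I01 \<longrightarrow> f s = 0) \<and>
         (\<forall>k. enat k < i \<longrightarrow> (deriv_I ^^ k) f differentiable_on I01) \<and>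
         (\<forall>k. enat k < i + 1 \<longrightarrow> continuous_on I01 ((deriv_I ^^ k) f))}"

definition C_I :: "enat \<Rightarrow> (real \<Rightarrow> real) topology" where
  "C_I i = unif_topology (C_I_set i) {k. enat k < i + 1} {I01} (\<lambda>k. deriv_I ^^ k)"

definition partial_deriv :: "'a::euclidean_space \<Rightarrow> ('a \<Rightarrow> real) \<Rightarrow> 'a \<Rightarrow> real" where
  "partial_deriv b \<phi> z = vector_derivative (\<lambda>t. \<phi> (z + t *\<^sub>R b)) (at 0)"

definition iter_partial :: "'a::euclidean_space list \<Rightarrow> ('a \<Rightarrow> real) \<Rightarrow> 'a \<Rightarrow> real" where
  "iter_partial bs \<phi> = fold partial_deriv bs \<phi>"

definition smooth_on_open :: "'a::euclidean_space set \<Rightarrow> ('a \<Rightarrow> real) \<Rightarrow> bool" where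
  "smooth_on_open G \<phi> \<longleftrightarrow>
     (\<forall>bs \<in> lists Basis. continuous_on G (iter_partial bs \<phi>) \<and>
        (\<forall>b\<in>Basis. \<forall>z\<in>G. (\<lambda>t. iter_partial bs \<phi> (z + t *\<^sub>R b)) differentiable (at 0)))"

text \<open>The continuous extension to \<open>\<Omega>\<close> of an iterated partial derivative on the interior.
  It is uniquely determined because the sets \<open>\<Omega>\<close> considered lie in the closure of their interior.\<close>

definition partial_ext ::
  "'a::euclidean_space set \<Rightarrow> 'a list \<Rightarrow> ('a \<Rightarrow> real) \<Rightarrow> 'a \<Rightarrow> real" where
  "partial_ext \<Omega> bs \<phi> z =
     (if z \<in> \<Omega> then Lim (at z within interior \<Omega>) (iter_partial bs \<phi>) else 0)"

definition C_infty_set :: "'a::euclidean_space set \<Rightarrow> ('a \<Rightarrow> real) set" where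
  "C_infty_set \<Omega> =
     {\<phi>. (\<forall>z. z \<notin> \<Omega> \<longrightarrow> \<phi> z = 0) \<and> continuous_on \<Omega> \<phi> \<and> smooth_on_open (interior \<Omega>) \<phi> \<and>
         (\<forall>bs \<in> lists Basis. \<exists>h. continuous_on \<Omega> h \<and>
            (\<forall>z \<in> interior \<Omega>. h z = iter_partial bs \<phi> z))}"

definition C_infty :: "'a::euclidean_space set \<Rightarrow> ('a \<Rightarrow> real) topology" where
  "C_infty \<Omega> =
     unif_topology (C_infty_set \<Omega>) (lists Basis) {K. compact K \<and> K \<subseteq> \<Omega>} (partial_ext \<Omega>)"


section \<open>The solution set\<close>

type_synonym r3 = "real \<times> real \<times> real"

definition param_space :: "r3 set \<Rightarrow> (real \<times> (r3 \<Rightarrow> real)) topology" where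
  "param_space \<Omega> = prod_topology euclideanreal (C_infty \<Omega>)"

definition solutions :: "r3 set \<Rightarrow> ((real \<times> (r3 \<Rightarrow> real)) \<times> (real \<Rightarrow> real)) set" where
  "solutions \<Omega> =
     {((\<eta>, \<phi>), y). \<phi> \<in> C_infty_set \<Omega> \<and> y \<in> C_I_set 1 \<and> y 0 = \<eta> \<and>
        (\<forall>s\<in>I01. (s, y s, deriv_I y s) \<in> \<Omega> \<and> \<phi> (s, y s, deriv_I y s) = 0)}"

definition regular :: "r3 set \<Rightarrow> (real \<times> (r3 \<Rightarrow> real)) \<times> (real \<Rightarrow> real) \<Rightarrow> bool" where
  "regular \<Omega> = (\<lambda>((\<eta>, \<phi>), y).
     let p2 = (\<lambda>s. partial_ext \<Omega> [(0, 1, 0)] \<phi> (s, y s, deriv_I y s));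
         p3 = (\<lambda>s. partial_ext \<Omega> [(0, 0, 1)] \<phi> (s, y s, deriv_I y s));
         F0 = {u \<in> C_I_set 1. u 0 = 0}
     in (\<forall>s\<in>I01. p3 s \<noteq> 0) \<and>
        (\<forall>v\<in>F0. \<exists>!u. u \<in> F0 \<and> (\<forall>s\<in>I01. p3 s * deriv_I u s + p2 s * u s = deriv_I v s)))"

definition regular_solutions ::
  "r3 set \<Rightarrow> ((real \<times> (r3 \<Rightarrow> real)) \<times> (real \<Rightarrow> real)) set" where
  "regular_solutions \<Omega> = {w \<in> solutions \<Omega>. regular \<Omega> w}"

end

theory Submission
  imports Defs
begin

text \<open>Regularity enters only through \<open>p\<^sub>3 \<noteq> 0\<close>. On a tube around the curve \<open>(s, y(s), y'(s))\<close> on which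
  \<open>\<partial>\<^sub>3\<phi>\<close> keeps its sign, Picard iteration gives a solution for each nearby parameter, and Gronwall's
  inequality shows that it is unique and depends on the parameter in a Lipschitz way.

  For smoothness into \<open>C\<^sup>\<infinity>(I)\<close>, consider the class of functions built from \<open>y'\<close>, the numbers \<open>\<eta>\<^sub>i\<close>,
  the partial derivatives of the \<open>\<phi>\<^sub>i\<close> along the solution, \<open>1 / p\<^sub>3\<close>, sums, products, exponentials and
  primitives, where \<open>(\<eta>\<^sub>i, \<phi>\<^sub>i)\<close> ranges over the parameter and a list of directions. This class is closed
  under \<open>d/ds\<close>, because \<open>y'' = - (p\<^sub>1 + p\<^sub>2 y') / p\<^sub>3\<close>, and under directional derivatives in the parameter,
  because the linearised equation is solved by variation of constants. As it is closed under \<open>d/ds\<close>,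
  estimates in all \<open>C\<^sup>k\<close> norms reduce to estimates in the supremum norm, and these follow by structural
  induction: every member is bounded and Lipschitz in parameter and directions, on bounded sets for
  finitely many of the seminorms. All conditions in the definition of \<open>C\<^sup>\<infinity>\<^sub>\<pi>\<close> are consequences.\<close>

section \<open>Locally convex spaces of uniform convergence\<close>

text \<open>The obstacle is a loss of derivatives: controlling \<open>k\<close> derivatives of the
  solution, or even one derivative of it in the parameter, takes further derivatives of \<phi>, and
  the spaces come with families of seminorms instead of a norm. The neighbourhood of the parameter
  is therefore fixed once, by a seminorm of order 2 on a compact tube, and only the estimates on it
  ask for more seminorms as the order grows. The class also demands a zero neighbourhood U that is
  chosen before \<epsilon>. A Lipschitz bound on bounded sets has this order of quantifiers built
  in: U is the unit ball of one seminorm, and \<epsilon> decides only how small the increment of the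
  parameter must be. A second obstacle is the boundary. At s = 0 and s = 1 the partial derivatives
  of \<phi> are mere limits from the interior, whereas the solution runs from one face of the strip
  to the other; so a chain rule relative to \<Omega> has to come before any differentiation along
  the solution.\<close>

locale unif_space =
  fixes X :: "'f::real_vector set" and J :: "'j set" and \<K> :: "'s set set"
    and D :: "'j \<Rightarrow> 'f \<Rightarrow> 's \<Rightarrow> real"
  assumes subspace_X: "subspace X"
    and D_add: "\<And>j K s f g. j \<in> J \<Longrightarrow> K \<in> \<K> \<Longrightarrow> s \<in> K \<Longrightarrow> f \<in> X \<Longrightarrow> g \<in> X \<Longrightarrow>
      D j (f + g) s = D j f s + D j g s"
    and D_scale: "\<And>j K s f c. j \<in> J \<Longrightarrow> K \<in> \<K> \<Longrightarrow> s \<in> K \<Longrightarrow> f \<in> X \<Longrightarrow>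
      D j (c *\<^sub>R f) s = c * D j f s"
    and D_bounded: "\<And>j K f. j \<in> J \<Longrightarrow> K \<in> \<K> \<Longrightarrow> f \<in> X \<Longrightarrow> \<exists>B. \<forall>s\<in>K. \<bar>D j f s\<bar> \<le> B"
begin

abbreviation "T \<equiv> unif_topology X J \<K> D"

definition le_on :: "('j \<times> 's set) set \<Rightarrow> real \<Rightarrow> 'f \<Rightarrow> bool" where
  "le_on A e h \<longleftrightarrow> (\<forall>(j, K)\<in>A. \<forall>s\<in>K. \<bar>D j h s\<bar> \<le> e)"

text \<open>\<open>unif_nbhd\<close> bounds every difference strictly but only pointwise, so in this
  abstract setting it need not be open. Asking for some \<open>e < \<epsilon>\<close> bounds the
  supremum strictly, which makes the balls open, and both families generate the same
  neighbourhoods.\<close>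

definition oball :: "('j \<times> 's set) set \<Rightarrow> real \<Rightarrow> 'f \<Rightarrow> 'f set" where
  "oball A \<epsilon> f = {g \<in> X. \<exists>e<\<epsilon>. le_on A e (g - f)}"

lemma D_diff:
  assumes "j \<in> J" "K \<in> \<K>" "s \<in> K" "f \<in> X" "g \<in> X"
  shows "D j (f - g) s = D j f s - D j g s"
proof -
  have "D j ((f - g) + g) s = D j (f - g) s + D j g s"
    using assms subspace_diff[OF subspace_X] by (intro D_add) auto
  then show ?thesis by simp
qed

lemma D_zero:
  assumes "j \<in> J" "K \<in> \<K>" "s \<in> K"
  shows "D j 0 s = 0"
  using D_scale[OF assms subspace_0[OF subspace_X], of 0] by simp

lemma le_on_mono: "le_on A e h \<Longrightarrow> e \<le> e' \<Longrightarrow> A' \<subseteq> A \<Longrightarrow> le_on A' e' h"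
  unfolding le_on_def by fastforce

lemma le_on_zero: "A \<subseteq> J \<times> \<K> \<Longrightarrow> 0 \<le> e \<Longrightarrow> le_on A e 0"
  unfolding le_on_def using D_zero by fastforce

lemma le_on_add:
  assumes "le_on A e f" "le_on A e' g" "f \<in> X" "g \<in> X" "A \<subseteq> J \<times> \<K>"
  shows "le_on A (e + e') (f + g)"
  unfolding le_on_def
proof clarify
  fix j K s assume *: "(j, K) \<in> A" "s \<in> K"
  then have "j \<in> J" "K \<in> \<K>" using assms(5) by auto
  then have "D j (f + g) s = D j f s + D j g s" using * assms by (intro D_add)
  moreover have "\<bar>D j f s\<bar> \<le> e" "\<bar>D j g s\<bar> \<le> e'" using * assms(1,2) unfolding le_on_def by auto
  ultimately show "\<bar>D j (f + g) s\<bar> \<le> e + e'" by linarith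
qed

lemma le_on_scale:
  assumes "le_on A e f" "f \<in> X" "A \<subseteq> J \<times> \<K>" "\<bar>c\<bar> * e \<le> e'"
  shows "le_on A e' (c *\<^sub>R f)"
  unfolding le_on_def
proof clarify
  fix j K s assume *: "(j, K) \<in> A" "s \<in> K"
  then have "j \<in> J" "K \<in> \<K>" using assms(3) by auto
  then have "D j (c *\<^sub>R f) s = c * D j f s" using * assms by (intro D_scale)
  moreover have "\<bar>D j f s\<bar> \<le> e" using * assms(1) unfolding le_on_def by auto
  ultimately show "\<bar>D j (c *\<^sub>R f) s\<bar> \<le> e'"
    using mult_left_mono[of "\<bar>D j f s\<bar>" e "\<bar>c\<bar>"] assms(4) by (simp add: abs_mult)
qed

text \<open>\<open>D_bounded\<close> is assumed for the sake of this bound: it makes scalar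
  multiplication continuous in the scalar, and later it bounds every parameter.\<close>

lemma le_on_bounded:
  assumes "finite A" "A \<subseteq> J \<times> \<K>" "f \<in> X"
  shows "\<exists>B>0. le_on A B f"
  using assms(1,2)
proof (induction A)
  case empty
  then show ?case by (auto simp: le_on_def intro: exI[of _ 1])
next
  case (insert a A)
  obtain j K where a: "a = (j, K)" by (cases a)
  obtain B where B: "B > 0" "le_on A B f" using insert by auto
  obtain B' where B': "\<forall>s\<in>K. \<bar>D j f s\<bar> \<le> B'" using D_bounded[of j K f] insert.prems a assms(3) by auto
  have "le_on A (max B B') f" using B by (auto intro: le_on_mono)
  moreover have "\<forall>s\<in>K. \<bar>D j f s\<bar> \<le> max B B'" using B' by fastforce
  ultimately have "le_on (insert a A) (max B B') f" using a by (auto simp: le_on_def)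
  then show ?case using B(1) by (intro exI[of _ "max B B'"]) auto
qed

lemma oball_subset: "oball A \<epsilon> f \<subseteq> X" by (auto simp: oball_def)

lemma oball_centre: "f \<in> X \<Longrightarrow> A \<subseteq> J \<times> \<K> \<Longrightarrow> \<epsilon> > 0 \<Longrightarrow> f \<in> oball A \<epsilon> f"
  unfolding oball_def using le_on_zero[of A 0] by auto

lemma oball_subset_unif_nbhd:
  assumes "f \<in> X" "A \<subseteq> J \<times> \<K>"
  shows "oball A \<epsilon> f \<subseteq> unif_nbhd X D A \<epsilon> f"
proof
  fix g assume "g \<in> oball A \<epsilon> f"
  then obtain e where g: "g \<in> X" "e < \<epsilon>" "le_on A e (g - f)" unfolding oball_def by auto
  have "\<bar>D j g s - D j f s\<bar> < \<epsilon>" if "(j, K) \<in> A" "s \<in> K" for j K s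
  proof -
    have "j \<in> J" "K \<in> \<K>" using that assms(2) by auto
    then have "D j (g - f) s = D j g s - D j f s" using that g assms by (intro D_diff)
    moreover have "\<bar>D j (g - f) s\<bar> \<le> e" using g(3) that unfolding le_on_def by auto
    ultimately show ?thesis using g(2) by linarith
  qed
  then show "g \<in> unif_nbhd X D A \<epsilon> f" using g(1) unfolding unif_nbhd_def by auto
qed

lemma unif_nbhd_subset_oball:
  assumes "f \<in> X" "A \<subseteq> J \<times> \<K>" "\<epsilon> < \<epsilon>'"
  shows "unif_nbhd X D A \<epsilon> f \<subseteq> oball A \<epsilon>' f"
proof
  fix g assume g: "g \<in> unif_nbhd X D A \<epsilon> f"
  then have gX: "g \<in> X" by (simp add: unif_nbhd_def)
  have "\<bar>D j (g - f) s\<bar> \<le> \<epsilon>" if "(j, K) \<in> A" "s \<in> K" for j K s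
  proof -
    have "j \<in> J" "K \<in> \<K>" using that assms(2) by auto
    then have "D j (g - f) s = D j g s - D j f s" using that gX assms by (intro D_diff)
    moreover have "\<bar>D j g s - D j f s\<bar> < \<epsilon>" using g that unfolding unif_nbhd_def by fastforce
    ultimately show ?thesis by linarith
  qed
  then show "g \<in> oball A \<epsilon>' f" using gX assms(3) unfolding oball_def le_on_def by blast
qed

lemma oball_shift:
  assumes "f \<in> X" "A \<subseteq> J \<times> \<K>" "g \<in> oball A \<epsilon> f"
  obtains d where "d > 0" "oball A d g \<subseteq> oball A \<epsilon> f"
proof -
  obtain e where g: "g \<in> X" "e < \<epsilon>" "le_on A e (g - f)" using assms(3) unfolding oball_def by auto
  have "oball A (\<epsilon> - e) g \<subseteq> oball A \<epsilon> f"
  proof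
    fix h assume "h \<in> oball A (\<epsilon> - e) g"
    then obtain e' where h: "h \<in> X" "e' < \<epsilon> - e" "le_on A e' (h - g)" unfolding oball_def by auto
    have "le_on A (e' + e) ((h - g) + (g - f))"
      using h g assms subspace_diff[OF subspace_X] by (intro le_on_add) auto
    then show "h \<in> oball A \<epsilon> f" using h unfolding oball_def by (auto intro!: exI[of _ "e' + e"])
  qed
  then show ?thesis using that[of "\<epsilon> - e"] g(2) by auto
qed

lemma openin_iff_oball:
  "openin T U \<longleftrightarrow> U \<subseteq> X \<and>
     (\<forall>f\<in>U. \<exists>A \<epsilon>. finite A \<and> A \<subseteq> J \<times> \<K> \<and> \<epsilon> > 0 \<and> oball A \<epsilon> f \<subseteq> U)"
  (is "_ \<longleftrightarrow> _ \<and> ?R")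
proof (cases "U \<subseteq> X")
  case UX: True
  show ?thesis
  proof
    assume "openin T U"
    then show "U \<subseteq> X \<and> ?R" unfolding openin_unif_topology
      using oball_subset_unif_nbhd UX by (meson subsetD subset_trans)
  next
    assume R: "U \<subseteq> X \<and> ?R"
    have "\<exists>A \<epsilon>. finite A \<and> A \<subseteq> J \<times> \<K> \<and> \<epsilon> > 0 \<and> unif_nbhd X D A \<epsilon> f \<subseteq> U" if "f \<in> U" for f
    proof -
      obtain A \<epsilon> where A: "finite A" "A \<subseteq> J \<times> \<K>" "\<epsilon> > 0" "oball A \<epsilon> f \<subseteq> U" using R \<open>f \<in> U\<close> by blast
      have "unif_nbhd X D A (\<epsilon>/2) f \<subseteq> oball A \<epsilon> f"
        using A UX that by (intro unif_nbhd_subset_oball) auto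
      then show ?thesis using A by (intro exI[of _ A] exI[of _ "\<epsilon>/2"]) auto
    qed
    then show "openin T U" unfolding openin_unif_topology using UX by blast
  qed
qed (auto simp: openin_unif_topology)

lemma openin_oball:
  assumes "f \<in> X" "finite A" "A \<subseteq> J \<times> \<K>"
  shows "openin T (oball A \<epsilon> f)"
  unfolding openin_iff_oball using oball_subset oball_shift[OF assms(1,3)] assms(2,3) by (metis order_refl)

lemma openin_obtain_oball:
  assumes "openin T U" "f \<in> U"
  obtains A \<epsilon> where "finite A" "A \<subseteq> J \<times> \<K>" "\<epsilon> > 0" "oball A \<epsilon> f \<subseteq> U"
  using assms unfolding openin_iff_oball by blast

lemma limitin_unif:
  assumes l: "l \<in> X" and ev: "\<forall>\<^sub>F t in F. h t \<in> X"
    and lim: "\<And>j K e. j \<in> J \<Longrightarrow> K \<in> \<K> \<Longrightarrow> e > 0 \<Longrightarrow> \<forall>\<^sub>F t in F. \<forall>s\<in>K. \<bar>D j (h t) s - D j l s\<bar> \<le> e"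
  shows "limitin T h l F"
  unfolding limitin_def topspace_unif_topology
proof (intro conjI l allI impI)
  fix U assume "openin T U \<and> l \<in> U"
  then obtain A \<epsilon> where A: "finite A" "A \<subseteq> J \<times> \<K>" "\<epsilon> > 0" "oball A \<epsilon> l \<subseteq> U"
    using openin_obtain_oball by metis
  have "\<forall>\<^sub>F t in F. \<forall>a\<in>A. \<forall>s\<in>snd a. \<bar>D (fst a) (h t) s - D (fst a) l s\<bar> \<le> \<epsilon> / 2"
    using A by (intro eventually_ball_finite A ballI lim) auto
  then show "\<forall>\<^sub>F t in F. h t \<in> U"
    using ev
  proof eventually_elim
    case (elim t)
    have "le_on A (\<epsilon> / 2) (h t - l)"
      unfolding le_on_def
    proof clarify
      fix j K s assume "(j, K) \<in> A" "s \<in> K"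
      moreover from this have "j \<in> J" "K \<in> \<K>" using A by auto
      ultimately show "\<bar>D j (h t - l) s\<bar> \<le> \<epsilon> / 2" using elim l D_diff by fastforce
    qed
    then have "h t \<in> oball A \<epsilon> l" using A(3) elim unfolding oball_def by (auto intro!: exI[of _ "\<epsilon>/2"])
    then show ?case using A by auto
  qed
qed

lemma locally_convex_unif: "locally_convex T"
  unfolding locally_convex_def topspace_unif_topology
proof (intro conjI allI impI subspace_X)
  show "continuous_map (prod_topology T T) T (\<lambda>(x, y). x + y)"
    unfolding continuous_map_def topspace_prod_topology topspace_unif_topology
  proof (intro conjI allI impI)
    show "(\<lambda>(x, y). x + y) \<in> X \<times> X \<rightarrow> X" using subspace_add[OF subspace_X] by auto
    fix U assume U: "openin T U"
    show "openin (prod_topology T T) {x \<in> X \<times> X. (case x of (x, y) \<Rightarrow> x + y) \<in> U}"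
      unfolding openin_prod_topology_alt
    proof clarsimp
      fix f g assume fg: "f \<in> X" "g \<in> X" "f + g \<in> U"
      obtain A \<epsilon> where A: "finite A" "A \<subseteq> J \<times> \<K>" "\<epsilon> > 0" "oball A \<epsilon> (f + g) \<subseteq> U"
        using openin_obtain_oball[OF U fg(3)] by metis
      have "f' + g' \<in> U" if f': "f' \<in> oball A (\<epsilon>/2) f" and g': "g' \<in> oball A (\<epsilon>/2) g" for f' g'
      proof -
        obtain e where e: "f' \<in> X" "e < \<epsilon>/2" "le_on A e (f' - f)" using f' unfolding oball_def by auto
        obtain e' where e': "g' \<in> X" "e' < \<epsilon>/2" "le_on A e' (g' - g)" using g' unfolding oball_def by auto
        have "le_on A (e + e') ((f' - f) + (g' - g))"
          using e e' fg A subspace_diff[OF subspace_X] by (intro le_on_add) auto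
        then have "f' + g' \<in> oball A \<epsilon> (f + g)"
          using e e' subspace_add[OF subspace_X] unfolding oball_def
          by (auto intro!: exI[of _ "e + e'"] simp: algebra_simps)
        then show ?thesis using A by auto
      qed
      moreover have "openin T (oball A (\<epsilon>/2) f)" "openin T (oball A (\<epsilon>/2) g)"
        using fg A by (auto intro: openin_oball)
      moreover have "f \<in> oball A (\<epsilon>/2) f" "g \<in> oball A (\<epsilon>/2) g" using fg A by (auto intro: oball_centre)
      ultimately show "\<exists>V. openin T V \<and> (\<exists>W. openin T W \<and> f \<in> V \<and> g \<in> W \<and>
          V \<times> W \<subseteq> {x \<in> X \<times> X. (case x of (x, y) \<Rightarrow> x + y) \<in> U})"
        using subsetD[OF oball_subset]
        by (intro exI[of _ "oball A (\<epsilon>/2) f"]) (rule conjI, blast, intro exI[of _ "oball A (\<epsilon>/2) g"], auto)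
    qed
  qed
  show "continuous_map (prod_topology euclideanreal T) T (\<lambda>(c, x). c *\<^sub>R x)"
    unfolding continuous_map_def topspace_prod_topology topspace_unif_topology
  proof (intro conjI allI impI)
    show "(\<lambda>(c, x). c *\<^sub>R x) \<in> topspace euclideanreal \<times> X \<rightarrow> X"
      using subspace_scale[OF subspace_X] by auto
    fix U assume U: "openin T U"
    show "openin (prod_topology euclideanreal T)
        {x \<in> topspace euclideanreal \<times> X. (case x of (c, x) \<Rightarrow> c *\<^sub>R x) \<in> U}"
      unfolding openin_prod_topology_alt
    proof clarsimp
      fix c g assume g: "g \<in> X" "c *\<^sub>R g \<in> U"
      obtain A \<epsilon> where A: "finite A" "A \<subseteq> J \<times> \<K>" "\<epsilon> > 0" "oball A \<epsilon> (c *\<^sub>R g) \<subseteq> U"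
        using openin_obtain_oball[OF U g(2)] by metis
      obtain B where B: "B > 0" "le_on A B g" using le_on_bounded A g by metis
      \<comment> \<open>From \<open>c' g' - c g = c' (g' - g) + (c' - c) g\<close>: \<delta>
        controls the second term through the bound \<open>B\<close> of g, and
        \<open>\<delta>'\<close> the first one through
        \<open>\<bar>c'\<bar> \<le> \<bar>c\<bar> + 1\<close>.\<close>
      define \<delta> where "\<delta> = min 1 (\<epsilon> / (4 * B))"
      define \<delta>' where "\<delta>' = \<epsilon> / (4 * (\<bar>c\<bar> + 1))"
      have \<delta>: "\<delta> > 0" "\<delta> \<le> 1" "\<delta> * B \<le> \<epsilon> / 4" using A B by (auto simp: \<delta>_def field_simps min_def)
      have \<delta>': "\<delta>' > 0" "(\<bar>c\<bar> + 1) * \<delta>' \<le> \<epsilon> / 4" using A by (auto simp: \<delta>'_def field_simps)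
      have "c' *\<^sub>R g' \<in> U" if c': "c' \<in> ball c \<delta>" and g': "g' \<in> oball A \<delta>' g" for c' g'
      proof -
        obtain e where e: "g' \<in> X" "e < \<delta>'" "le_on A e (g' - g)" using g' unfolding oball_def by auto
        have c: "\<bar>c' - c\<bar> \<le> \<delta>" "\<bar>c'\<bar> \<le> \<bar>c\<bar> + 1" using c' \<delta> by (auto simp: dist_real_def)
        have "le_on A \<delta>' (g' - g)" using e by (auto intro: le_on_mono)
        moreover have "\<bar>c'\<bar> * \<delta>' \<le> \<epsilon> / 4"
          using order_trans[OF mult_right_mono[OF c(2)] \<delta>'(2)] \<delta>'(1) by (meson less_imp_le)
        ultimately have 1: "le_on A (\<epsilon> / 4) (c' *\<^sub>R (g' - g))"
          using e g A subspace_diff[OF subspace_X] by (intro le_on_scale) auto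
        have "\<bar>c' - c\<bar> * B \<le> \<epsilon> / 4" using mult_right_mono[OF c(1), of B] \<delta>(3) B(1) by linarith
        then have 2: "le_on A (\<epsilon> / 4) ((c' - c) *\<^sub>R g)"
          using B g A by (intro le_on_scale) auto
        have "le_on A (\<epsilon> / 4 + \<epsilon> / 4) (c' *\<^sub>R (g' - g) + (c' - c) *\<^sub>R g)"
          using 1 2 e g A subspace_diff[OF subspace_X] subspace_scale[OF subspace_X]
          by (intro le_on_add) auto
        moreover have "c' *\<^sub>R (g' - g) + (c' - c) *\<^sub>R g = c' *\<^sub>R g' - c *\<^sub>R g"
          by (simp add: algebra_simps)
        ultimately have "c' *\<^sub>R g' \<in> oball A \<epsilon> (c *\<^sub>R g)"
          using e A subspace_scale[OF subspace_X] unfolding oball_def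
          by (auto intro!: exI[of _ "\<epsilon>/4 + \<epsilon>/4"])
        then show ?thesis using A by auto
      qed
      moreover have "openin T (oball A \<delta>' g)" using g A by (auto intro: openin_oball)
      moreover have "g \<in> oball A \<delta>' g" using g A \<delta>' by (auto intro: oball_centre)
      ultimately show "\<exists>V. open V \<and> (\<exists>W. openin T W \<and> c \<in> V \<and> g \<in> W \<and>
          V \<times> W \<subseteq> {x \<in> UNIV \<times> X. (case x of (c, x) \<Rightarrow> c *\<^sub>R x) \<in> U})"
        using subsetD[OF oball_subset] \<delta> by (intro exI[of _ "ball c \<delta>"] conjI exI[of _ "oball A \<delta>' g"]) auto
    qed
  qed
next
  fix U assume "openin T U \<and> 0 \<in> U"
  then obtain A \<epsilon> where A: "finite A" "A \<subseteq> J \<times> \<K>" "\<epsilon> > 0" "oball A \<epsilon> 0 \<subseteq> U"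
    using openin_obtain_oball by metis
  have "convex (oball A \<epsilon> 0)"
  proof (rule convexI)
    fix f g and u v :: real
    assume "f \<in> oball A \<epsilon> 0" "g \<in> oball A \<epsilon> 0" and uv: "0 \<le> u" "0 \<le> v" "u + v = 1"
    then obtain e e' where e: "f \<in> X" "e < \<epsilon>" "le_on A e f" and e': "g \<in> X" "e' < \<epsilon>" "le_on A e' g"
      unfolding oball_def by auto
    define m where "m = max e e'"
    have m: "le_on A m f" "le_on A m g" "m < \<epsilon>" using e e' by (auto simp: m_def intro: le_on_mono)
    have "le_on A (u * m + v * m) (u *\<^sub>R f + v *\<^sub>R g)"
      using m e e' A uv subspace_scale[OF subspace_X] by (intro le_on_add le_on_scale) auto
    moreover have "u * m + v * m = m" using uv by (simp flip: distrib_right)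
    ultimately show "u *\<^sub>R f + v *\<^sub>R g \<in> oball A \<epsilon> 0"
      using m e e' subspace_scale[OF subspace_X] subspace_add[OF subspace_X] unfolding oball_def by auto
  qed
  then show "\<exists>V. openin T V \<and> 0 \<in> V \<and> convex V \<and> V \<subseteq> U"
    using A openin_oball oball_centre subspace_0[OF subspace_X]
    by (intro exI[of _ "oball A \<epsilon> 0"]) auto
qed

lemma zero_nbhd_obtain_oball:
  assumes "zero_nbhd T W"
  obtains A \<epsilon> where "finite A" "A \<subseteq> J \<times> \<K>" "\<epsilon> > 0" "oball A \<epsilon> 0 \<subseteq> W"
proof -
  obtain G where G: "openin T G" "0 \<in> G" "G \<subseteq> W" using assms unfolding zero_nbhd_def by blast
  show ?thesis using openin_obtain_oball[OF G(1,2)] that G(3) by (metis subset_trans)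
qed

end

section \<open>Product of the real line with a locally convex space\<close>

lemma locally_convex_prod_real:
  assumes "locally_convex E"
  shows "locally_convex (prod_topology euclideanreal E)"
  unfolding locally_convex_def
proof (intro conjI allI impI)
  have sub: "subspace (topspace E)"
    and add: "continuous_map (prod_topology E E) E (\<lambda>(x, y). x + y)"
    and scale: "continuous_map (prod_topology euclideanreal E) E (\<lambda>(c, x). c *\<^sub>R x)"
    and conv: "\<And>U. openin E U \<Longrightarrow> 0 \<in> U \<Longrightarrow> \<exists>V. openin E V \<and> 0 \<in> V \<and> convex V \<and> V \<subseteq> U"
    using assms unfolding locally_convex_def by auto
  let ?R = "euclideanreal" and ?P = "prod_topology euclideanreal E"
  show "subspace (topspace ?P)"
    using sub by (auto simp: subspace_def zero_prod_def)
  have c1: "continuous_map (prod_topology ?P ?P) ?R (\<lambda>p. fst (fst p))"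
    "continuous_map (prod_topology ?P ?P) E (\<lambda>p. snd (fst p))"
    "continuous_map (prod_topology ?P ?P) ?R (\<lambda>p. fst (snd p))"
    "continuous_map (prod_topology ?P ?P) E (\<lambda>p. snd (snd p))"
    using continuous_map_compose[OF continuous_map_fst continuous_map_fst]
      continuous_map_compose[OF continuous_map_fst continuous_map_snd]
      continuous_map_compose[OF continuous_map_snd continuous_map_fst]
      continuous_map_compose[OF continuous_map_snd continuous_map_snd]
    by (auto simp: o_def)
  have "continuous_map (prod_topology ?P ?P) ?R (\<lambda>p. fst (fst p) + fst (snd p))"
    using c1 by (intro continuous_map_add)
  moreover have "continuous_map (prod_topology ?P ?P) E (\<lambda>p. snd (fst p) + snd (snd p))"
    using continuous_map_compose[OF _ add, of "prod_topology ?P ?P" "\<lambda>p. (snd (fst p), snd (snd p))"] c1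
    by (simp add: continuous_map_paired o_def)
  ultimately have "continuous_map (prod_topology ?P ?P) ?P
      (\<lambda>p. (fst (fst p) + fst (snd p), snd (fst p) + snd (snd p)))"
    by (simp add: continuous_map_paired)
  then show "continuous_map (prod_topology ?P ?P) ?P (\<lambda>(x, y). x + y)"
    by (simp add: plus_prod_def case_prod_unfold)
  have c2: "continuous_map (prod_topology ?R ?P) ?R fst"
    "continuous_map (prod_topology ?R ?P) ?R (\<lambda>p. fst (snd p))"
    "continuous_map (prod_topology ?R ?P) E (\<lambda>p. snd (snd p))"
    using continuous_map_fst
      continuous_map_compose[OF continuous_map_snd continuous_map_fst]
      continuous_map_compose[OF continuous_map_snd continuous_map_snd]
    by (auto simp: o_def)
  have "continuous_map (prod_topology ?R ?P) ?R (\<lambda>p. fst p * fst (snd p))"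
    using c2 by (intro continuous_map_real_mult)
  moreover have "continuous_map (prod_topology ?R ?P) E (\<lambda>p. fst p *\<^sub>R snd (snd p))"
    using continuous_map_compose[OF _ scale, of "prod_topology ?R ?P" "\<lambda>p. (fst p, snd (snd p))"] c2
    by (simp add: continuous_map_paired o_def)
  ultimately have "continuous_map (prod_topology ?R ?P) ?P
      (\<lambda>p. (fst p * fst (snd p), fst p *\<^sub>R snd (snd p)))"
    by (simp add: continuous_map_paired)
  then show "continuous_map (prod_topology ?R ?P) ?P (\<lambda>(c, x). c *\<^sub>R x)"
    by (simp add: scaleR_prod_def case_prod_unfold)
  fix U assume U: "openin ?P U \<and> 0 \<in> U"
  then obtain A B where A: "open A" "openin E B" "0 \<in> A" "0 \<in> B" "A \<times> B \<subseteq> U"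
    unfolding openin_prod_topology_alt zero_prod_def open_openin[symmetric] by blast
  obtain r where r: "r > 0" "ball 0 r \<subseteq> A" using A open_contains_ball by blast
  obtain V where V: "openin E V" "0 \<in> V" "convex V" "V \<subseteq> B" using conv A by blast
  have "convex (ball (0::real) r \<times> V)" using V by (intro convex_Times) auto
  moreover have "openin ?P (ball 0 r \<times> V)" using V by (auto simp: openin_prod_Times_iff)
  moreover have "ball 0 r \<times> V \<subseteq> U" using A V r by auto
  ultimately show "\<exists>V. openin ?P V \<and> 0 \<in> V \<and> convex V \<and> V \<subseteq> U"
    using V r by (intro exI[of _ "ball 0 r \<times> V"]) (auto simp: zero_prod_def)
qed

section \<open>The spaces of functions of class C^i on the unit interval\<close>

lemma deriv_I_add:
  assumes "f differentiable_on I01" "g differentiable_on I01"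
  shows "deriv_I (f + g) = deriv_I f + deriv_I g"
proof
  fix s
  show "deriv_I (f + g) s = (deriv_I f + deriv_I g) s"
  proof (cases "s \<in> I01")
    case True
    have "(f has_vector_derivative vector_derivative f (at s within I01)) (at s within I01)"
      "(g has_vector_derivative vector_derivative g (at s within I01)) (at s within I01)"
      using assms True by (auto simp: vector_derivative_works[symmetric] differentiable_on_def)
    then have "(f + g has_vector_derivative
        vector_derivative f (at s within I01) + vector_derivative g (at s within I01)) (at s within I01)"
      unfolding plus_fun_def by (rule has_vector_derivative_add)
    then show ?thesis
      using True vector_derivative_within_cbox[of 0 1 s] by (simp add: deriv_I_def)
  qed (auto simp: deriv_I_def)
qed

lemma deriv_I_scale:
  assumes "f differentiable_on I01"
  shows "deriv_I (c *\<^sub>R f) = c *\<^sub>R deriv_I f"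
proof
  fix s
  show "deriv_I (c *\<^sub>R f) s = (c *\<^sub>R deriv_I f) s"
  proof (cases "s \<in> I01")
    case True
    have "(f has_vector_derivative vector_derivative f (at s within I01)) (at s within I01)"
      using assms True by (auto simp: vector_derivative_works[symmetric] differentiable_on_def)
    then have "(c *\<^sub>R f has_vector_derivative c *\<^sub>R vector_derivative f (at s within I01)) (at s within I01)"
      unfolding scaleR_fun_def by (intro derivative_eq_intros) auto
    then show ?thesis
      using True vector_derivative_within_cbox[of 0 1 s] by (simp add: deriv_I_def)
  qed (auto simp: deriv_I_def)
qed

text \<open>The condition amounts to \<open>enat k < i\<close>, in the form that fits inductions
  over orders below \<open>i + 1\<close>, including \<open>i = \<infinity>\<close>.\<close>

lemma C_I_set_differentiable: "f \<in> C_I_set i \<Longrightarrow> enat (Suc k) < i + 1 \<Longrightarrow> (deriv_I ^^ k) f differentiable_on I01"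
  unfolding C_I_set_def by (metis (no_types, lifting) Suc_ile_eq add.commute iless_Suc_eq mem_Collect_eq plus_1_eSuc(1))

lemma deriv_I_funpow_add:
  assumes "f \<in> C_I_set i" "g \<in> C_I_set i" "enat k < i + 1"
  shows "(deriv_I ^^ k) (f + g) = (deriv_I ^^ k) f + (deriv_I ^^ k) g"
  using assms(3)
proof (induction k)
  case (Suc k)
  then have "enat k < i + 1" by (meson Suc_ile_eq order_less_imp_le order_le_less_trans)
  then show ?case using Suc C_I_set_differentiable[OF assms(1)] C_I_set_differentiable[OF assms(2)] 
    by (simp only: funpow.simps o_apply deriv_I_add)
qed simp

lemma deriv_I_funpow_scale:
  assumes "f \<in> C_I_set i" "enat k < i + 1"
  shows "(deriv_I ^^ k) (c *\<^sub>R f) = c *\<^sub>R (deriv_I ^^ k) f"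
  using assms(2)
proof (induction k)
  case (Suc k)
  then have "enat k < i + 1" by (meson Suc_ile_eq order_less_imp_le order_le_less_trans)
  then show ?case using Suc C_I_set_differentiable[OF assms(1)]
    by (simp only: funpow.simps o_apply deriv_I_scale)
qed simp

lemma enat_less_add_one: "enat k < i \<Longrightarrow> enat k < i + 1"
  by (cases i) (auto simp: one_enat_def)

lemma subspace_C_I_set: "subspace (C_I_set i)"
  unfolding subspace_def
proof (intro conjI ballI allI)
  have "deriv_I 0 = 0" using deriv_I_scale[of "\<lambda>_. 0" 0] by (auto simp: zero_fun_def scaleR_fun_def)
  then have "(deriv_I ^^ k) 0 = 0" for k by (induction k) auto
  then show "0 \<in> C_I_set i" unfolding C_I_set_def by (simp add: zero_fun_def differentiable_on_def)
  fix f assume f: "f \<in> C_I_set i"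
  show "f + g \<in> C_I_set i" if g: "g \<in> C_I_set i" for g
    using f g deriv_I_funpow_add[OF f g] unfolding C_I_set_def
    by (auto simp: plus_fun_def enat_less_add_one intro!: continuous_intros differentiable_on_add)
  show "c *\<^sub>R f \<in> C_I_set i" for c
    using f deriv_I_funpow_scale[OF f] unfolding C_I_set_def
    by (auto simp: scaleR_fun_def enat_less_add_one differentiable_on_def intro!: continuous_intros)
qed

interpretation C_I: unif_space "C_I_set i" "{k. enat k < i + 1}" "{I01}" "\<lambda>k. deriv_I ^^ k"
  rewrites "unif_topology (C_I_set i) {k. enat k < i + 1} {I01} (\<lambda>k. deriv_I ^^ k) \<equiv> C_I i"
  for i
proof -
  show "unif_space (C_I_set i) {k. enat k < i + 1} {I01} (\<lambda>k. deriv_I ^^ k)"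
  proof
    fix j K f assume *: "j \<in> {k. enat k < i + 1}" "K \<in> {I01}" "f \<in> C_I_set i"
    then have "continuous_on I01 ((deriv_I ^^ j) f)" by (auto simp: C_I_set_def)
    then have "compact ((deriv_I ^^ j) f ` I01)" by (intro compact_continuous_image) auto
    then show "\<exists>B. \<forall>s\<in>K. \<bar>(deriv_I ^^ j) f s\<bar> \<le> B"
      using * compact_imp_bounded[of "(deriv_I ^^ j) f ` I01"] by (auto simp: bounded_iff)
  qed (auto simp: subspace_C_I_set deriv_I_funpow_add deriv_I_funpow_scale)
qed (simp add: C_I_def)

section \<open>Partial derivatives up to the boundary\<close>

lemma iter_partial_snoc: "iter_partial (bs @ [b]) \<phi> = partial_deriv b (iter_partial bs \<phi>)"
  by (simp add: iter_partial_def)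

lemma open_line_preimage:
  fixes z b :: "'a::real_normed_vector"
  assumes "open G"
  shows "open {t::real. z + t *\<^sub>R b \<in> G}"
proof -
  have "continuous_on UNIV (\<lambda>t::real. z + t *\<^sub>R b)" by (intro continuous_intros)
  then show ?thesis using open_vimage[OF assms] by (fastforce simp: vimage_def)
qed

lemma iter_partial_has_derivative:
  assumes "smooth_on_open G \<phi>" "bs \<in> lists Basis" "b \<in> Basis" "z \<in> G"
  shows "((\<lambda>t. iter_partial bs \<phi> (z + t *\<^sub>R b)) has_real_derivative iter_partial (bs @ [b]) \<phi> z) (at 0)"
proof -
  have "(\<lambda>t. iter_partial bs \<phi> (z + t *\<^sub>R b)) differentiable (at 0)"
    using assms unfolding smooth_on_open_def by auto
  then show ?thesis
    unfolding iter_partial_snoc partial_deriv_def has_real_derivative_iff_has_vector_derivative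
    by (simp add: vector_derivative_works[symmetric])
qed

text \<open>One linear combination covers sums and multiples alike. The equality is known on G only,
  so the next partial derivative relies on G being open along lines.\<close>

lemma iter_partial_lincomb:
  assumes G: "open G" and \<phi>: "smooth_on_open G \<phi>" and \<psi>: "smooth_on_open G \<psi>"
    and "bs \<in> lists Basis" "z \<in> G"
  shows "iter_partial bs (\<lambda>z. c * \<phi> z + d * \<psi> z) z = c * iter_partial bs \<phi> z + d * iter_partial bs \<psi> z"
  using assms(4,5)
proof (induction bs arbitrary: z rule: rev_induct)
  case (snoc b bs)
  have "((\<lambda>t. c * iter_partial bs \<phi> (z + t *\<^sub>R b) + d * iter_partial bs \<psi> (z + t *\<^sub>R b)) has_real_derivative
      (c * iter_partial (bs @ [b]) \<phi> z + d * iter_partial (bs @ [b]) \<psi> z)) (at 0)"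
    using snoc by (intro DERIV_add DERIV_cmult iter_partial_has_derivative[OF \<phi>]
        iter_partial_has_derivative[OF \<psi>]) auto
  then have "((\<lambda>t. iter_partial bs (\<lambda>z. c * \<phi> z + d * \<psi> z) (z + t *\<^sub>R b)) has_real_derivative
      (c * iter_partial (bs @ [b]) \<phi> z + d * iter_partial (bs @ [b]) \<psi> z)) (at 0)"
    by (rule has_field_derivative_transform_within_open[OF _ open_line_preimage[OF G, of z b]])
      (use snoc in auto)
  then show ?case
    unfolding iter_partial_snoc[of bs b "\<lambda>z. c * \<phi> z + d * \<psi> z"] partial_deriv_def
    by (simp add: has_real_derivative_iff_has_vector_derivative vector_derivative_at)
qed (simp add: iter_partial_def)

lemma smooth_on_open_lincomb:
  assumes G: "open G" and \<phi>: "smooth_on_open G \<phi>" and \<psi>: "smooth_on_open G \<psi>"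
  shows "smooth_on_open G (\<lambda>z. c * \<phi> z + d * \<psi> z)"
  unfolding smooth_on_open_def
proof (intro ballI conjI)
  fix bs :: "'a list" assume bs: "bs \<in> lists Basis"
  note eq = iter_partial_lincomb[OF G \<phi> \<psi> bs]
  have "continuous_on G (\<lambda>z. c * iter_partial bs \<phi> z + d * iter_partial bs \<psi> z)"
    using \<phi> \<psi> bs unfolding smooth_on_open_def by (intro continuous_intros) auto
  then show "continuous_on G (iter_partial bs (\<lambda>z. c * \<phi> z + d * \<psi> z))"
    using eq continuous_on_cong[OF refl] by (metis (no_types, lifting))
  fix b z :: 'a assume *: "b \<in> Basis" "z \<in> G"
  have "((\<lambda>t. c * iter_partial bs \<phi> (z + t *\<^sub>R b) + d * iter_partial bs \<psi> (z + t *\<^sub>R b)) has_real_derivative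
      (c * iter_partial (bs @ [b]) \<phi> z + d * iter_partial (bs @ [b]) \<psi> z)) (at 0)"
    using * bs by (intro DERIV_add DERIV_cmult iter_partial_has_derivative[OF \<phi>]
        iter_partial_has_derivative[OF \<psi>]) auto
  then have "((\<lambda>t. iter_partial bs (\<lambda>z. c * \<phi> z + d * \<psi> z) (z + t *\<^sub>R b)) has_real_derivative
      (c * iter_partial (bs @ [b]) \<phi> z + d * iter_partial (bs @ [b]) \<psi> z)) (at 0)"
    by (rule has_field_derivative_transform_within_open[OF _ open_line_preimage[OF G, of z b]])
      (use * eq in auto)
  then show "(\<lambda>t. iter_partial bs (\<lambda>z. c * \<phi> z + d * \<psi> z) (z + t *\<^sub>R b)) differentiable (at 0)"
    by (simp add: has_real_derivative_iff_has_vector_derivative differentiableI_vector)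
qed

abbreviation "e\<^sub>1 \<equiv> (1, 0, 0) :: r3"
abbreviation "e\<^sub>2 \<equiv> (0, 1, 0) :: r3"
abbreviation "e\<^sub>3 \<equiv> (0, 0, 1) :: r3"

lemma Basis_r3: "Basis = {e\<^sub>1, e\<^sub>2, e\<^sub>3}"
proof -
  have "(0 :: real \<times> real) = (0, 0)" by (simp add: zero_prod_def)
  then show ?thesis unfolding Basis_prod_def by auto
qed

text \<open>The mean value inequality for \<open>f u - p * u\<close>, whose derivative is at most
  \<open>e\<close> in absolute value.\<close>

lemma affine_approx_of_deriv_bound:
  fixes f :: "real \<Rightarrow> real"
  assumes "\<And>u. u \<in> closed_segment x y \<Longrightarrow> (f has_real_derivative f' u) (at u)"
    and "\<And>u. u \<in> closed_segment x y \<Longrightarrow> \<bar>f' u - p\<bar> \<le> e"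
  shows "\<bar>f x - f y - p * (x - y)\<bar> \<le> e * \<bar>x - y\<bar>"
proof -
  have "norm ((f x - p * x) - (f y - p * y)) \<le> e * norm (x - y)"
  proof (rule field_differentiable_bound)
    fix u assume u: "u \<in> closed_segment x y"
    have "((\<lambda>u. f u - p * u) has_real_derivative f' u - p) (at u)"
      using assms(1)[OF u] by (intro DERIV_diff DERIV_cmult_Id)
    then show "((\<lambda>u. f u - p * u) has_real_derivative f' u - p) (at u within closed_segment x y)"
      by (rule has_field_derivative_at_within)
    show "norm (f' u - p) \<le> e" using assms(2)[OF u] by simp
  qed auto
  then show ?thesis by (simp add: algebra_simps)
qed

section \<open>Relatively open subsets of the strip and extended partial derivatives\<close>

locale rel_open =
  fixes \<Omega> :: "r3 set"
  assumes rel_open: "openin (top_of_set (I01 \<times> UNIV \<times> UNIV)) \<Omega>"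
begin

abbreviation "P \<equiv> partial_ext \<Omega>"

lemma \<Omega>_strip: "(s, a, b) \<in> \<Omega> \<Longrightarrow> s \<in> I01"
  using openin_imp_subset[OF rel_open] by auto

lemma interior_\<Omega>: "interior \<Omega> = \<Omega> \<inter> ({0<..<1} \<times> UNIV \<times> UNIV)"
proof -
  obtain G where "open G" "\<Omega> = (I01 \<times> UNIV \<times> UNIV) \<inter> G"
    using rel_open unfolding openin_open by auto
  then show ?thesis by (auto simp: interior_open interior_Times)
qed

text \<open>The strip is convex with nonempty interior, hence in the closure of that interior, and
  intersecting with an open set preserves this. It is what makes continuous extensions from the
  interior unique.\<close>

lemma \<Omega>_subset_closure: "\<Omega> \<subseteq> closure (interior \<Omega>)"
proof -
  let ?S = "I01 \<times> (UNIV :: (real \<times> real) set)"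
  obtain G where G: "open G" "\<Omega> = ?S \<inter> G"
    using rel_open unfolding openin_open by (auto simp: UNIV_Times_UNIV)
  have "convex ?S" by (intro convex_Times) auto
  moreover have "interior ?S \<noteq> {}" by (simp add: interior_Times)
  ultimately have "closure (interior ?S) = closure ?S" by (rule convex_closure_interior)
  then have "\<Omega> \<subseteq> G \<inter> closure (interior ?S)" using G closure_subset[of ?S] by auto
  also have "\<dots> \<subseteq> closure (G \<inter> interior ?S)" using G by (intro open_Int_closure_subset)
  also have "G \<inter> interior ?S = interior \<Omega>" using G by (auto simp: interior_open)
  finally show ?thesis .
qed

lemma interior_nontrivial: "z \<in> \<Omega> \<Longrightarrow> at z within interior \<Omega> \<noteq> bot"
proof -
  assume z: "z \<in> \<Omega>"
  have "z islimpt interior \<Omega>"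
  proof (cases "z \<in> interior \<Omega>")
    case True then show ?thesis by (simp add: open_imp_islimpt)
  next
    case False then show ?thesis using z \<Omega>_subset_closure by (auto simp: islimpt_in_closure)
  qed
  then show ?thesis using trivial_limit_within[of z "interior \<Omega>"] by auto
qed

text \<open>Identifies the \<open>Lim\<close> in \<open>partial_ext\<close> with whatever continuous
  extension is at hand. Along a trivial filter \<open>Lim\<close> would be arbitrary, hence
  \<open>interior_nontrivial\<close>.\<close>

lemma partial_ext_unique:
  assumes "continuous_on \<Omega> h" "\<And>z. z \<in> interior \<Omega> \<Longrightarrow> h z = iter_partial bs \<phi> z" "z \<in> \<Omega>"
  shows "P bs \<phi> z = h z"
proof -
  have "(h \<longlongrightarrow> h z) (at z within interior \<Omega>)"
    using assms(1,3) interior_subset[of \<Omega>] by (meson continuous_on_def tendsto_within_subset)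
  moreover have "\<forall>\<^sub>F x in at z within interior \<Omega>. h x = iter_partial bs \<phi> x"
    using assms(2) by (auto simp: eventually_at_filter)
  ultimately have "(iter_partial bs \<phi> \<longlongrightarrow> h z) (at z within interior \<Omega>)"
    by (rule Lim_transform_eventually)
  then show ?thesis using tendsto_Lim[OF interior_nontrivial[OF assms(3)]] assms(3)
    by (simp add: partial_ext_def)
qed

lemma
  assumes "\<phi> \<in> C_infty_set \<Omega>" "bs \<in> lists Basis"
  shows partial_ext_interior: "z \<in> interior \<Omega> \<Longrightarrow> P bs \<phi> z = iter_partial bs \<phi> z"
    and continuous_on_partial_ext: "continuous_on \<Omega> (P bs \<phi>)"
proof -
  obtain h where h: "continuous_on \<Omega> h" "\<forall>z \<in> interior \<Omega>. h z = iter_partial bs \<phi> z"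
    using assms unfolding C_infty_set_def by blast
  have eq: "P bs \<phi> z = h z" if "z \<in> \<Omega>" for z using h that by (intro partial_ext_unique) auto
  show "z \<in> interior \<Omega> \<Longrightarrow> P bs \<phi> z = iter_partial bs \<phi> z"
    using eq h(2) interior_subset by (metis subsetD)
  show "continuous_on \<Omega> (P bs \<phi>)" using h(1) eq continuous_on_cong[OF refl] by (metis (no_types, lifting))
qed

lemma partial_ext_Nil: "\<phi> \<in> C_infty_set \<Omega> \<Longrightarrow> P [] \<phi> z = \<phi> z"
  using partial_ext_unique[of \<phi> "[]" \<phi> z]
  by (cases "z \<in> \<Omega>"; cases z) (simp_all add: C_infty_set_def iter_partial_def partial_ext_def)

lemma partial_ext_outside: "z \<notin> \<Omega> \<Longrightarrow> P bs \<phi> z = 0"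
  by (simp add: partial_ext_def)

lemma
  assumes \<phi>: "\<phi> \<in> C_infty_set \<Omega>" and \<psi>: "\<psi> \<in> C_infty_set \<Omega>"
  shows partial_ext_lincomb: "bs \<in> lists Basis \<Longrightarrow>
      P bs (\<lambda>z. c * \<phi> z + d * \<psi> z) z = c * P bs \<phi> z + d * P bs \<psi> z"
    and C_infty_set_lincomb: "(\<lambda>z. c * \<phi> z + d * \<psi> z) \<in> C_infty_set \<Omega>"
proof -
  have sm: "smooth_on_open (interior \<Omega>) \<phi>" "smooth_on_open (interior \<Omega>) \<psi>"
    using assms by (auto simp: C_infty_set_def)
  have *: "continuous_on \<Omega> (\<lambda>z. c * P bs \<phi> z + d * P bs \<psi> z)"
    "\<And>z. z \<in> interior \<Omega> \<Longrightarrow> c * P bs \<phi> z + d * P bs \<psi> z = iter_partial bs (\<lambda>z. c * \<phi> z + d * \<psi> z) z"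
    if "bs \<in> lists Basis" for bs
    using that iter_partial_lincomb[OF _ sm that, of _ c d] assms
    by (auto intro!: continuous_intros continuous_on_partial_ext simp: partial_ext_interior)
  show "P bs (\<lambda>z. c * \<phi> z + d * \<psi> z) z = c * P bs \<phi> z + d * P bs \<psi> z" if "bs \<in> lists Basis"
    using partial_ext_unique[OF *[OF that]] by (cases "z \<in> \<Omega>") (auto simp: partial_ext_outside)
  have "\<exists>h. continuous_on \<Omega> h \<and>
      (\<forall>z\<in>interior \<Omega>. h z = iter_partial bs (\<lambda>z. c * \<phi> z + d * \<psi> z) z)" if "bs \<in> lists Basis" for bs
    using *[OF that] by blast
  then show "(\<lambda>z. c * \<phi> z + d * \<psi> z) \<in> C_infty_set \<Omega>"
    using smooth_on_open_lincomb[OF _ sm, of c d] assms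
    unfolding C_infty_set_def by (auto intro!: continuous_intros)
qed

lemma zero_in_C_infty_set: "(\<lambda>_. 0) \<in> C_infty_set \<Omega>"
proof -
  have z: "iter_partial bs (\<lambda>_. 0) = (\<lambda>_::r3. 0)" for bs :: "r3 list"
    by (induction bs rule: rev_induct) (auto simp: iter_partial_snoc iter_partial_def partial_deriv_def fun_eq_iff)
  have "\<exists>h. continuous_on \<Omega> h \<and> (\<forall>z\<in>interior \<Omega>. h z = (0::real))"
    by (intro exI[of _ "\<lambda>_. 0"]) auto
  then show ?thesis unfolding C_infty_set_def smooth_on_open_def by (auto simp: z)
qed

lemma subspace_C_infty_set: "subspace (C_infty_set \<Omega>)"
  unfolding subspace_def
proof (intro conjI ballI allI)
  show "0 \<in> C_infty_set \<Omega>" using zero_in_C_infty_set by (simp add: zero_fun_def)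
  fix \<phi> assume \<phi>: "\<phi> \<in> C_infty_set \<Omega>"
  show "\<phi> + \<psi> \<in> C_infty_set \<Omega>" if "\<psi> \<in> C_infty_set \<Omega>" for \<psi>
    using C_infty_set_lincomb[OF \<phi> that, of 1 1] by (simp add: plus_fun_def)
  show "c *\<^sub>R \<phi> \<in> C_infty_set \<Omega>" for c
    using C_infty_set_lincomb[OF \<phi> \<phi>, of c 0] by (simp add: scaleR_fun_def)
qed

lemma partial_ext_add:
  assumes "\<phi> \<in> C_infty_set \<Omega>" "\<psi> \<in> C_infty_set \<Omega>" "bs \<in> lists Basis"
  shows "P bs (\<phi> + \<psi>) z = P bs \<phi> z + P bs \<psi> z"
  using partial_ext_lincomb[OF assms, of 1 1] by (simp add: plus_fun_def)

lemma partial_ext_scale: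
  assumes "\<phi> \<in> C_infty_set \<Omega>" "bs \<in> lists Basis"
  shows "P bs (c *\<^sub>R \<phi>) z = c * P bs \<phi> z"
  using partial_ext_lincomb[OF assms(1) assms, of c 0] by (simp add: scaleR_fun_def)

lemma partial_ext_bounded:
  assumes "compact K" "K \<subseteq> \<Omega>" "\<phi> \<in> C_infty_set \<Omega>" "bs \<in> lists Basis"
  shows "\<exists>B. \<forall>z\<in>K. \<bar>P bs \<phi> z\<bar> \<le> B"
proof -
  have "compact (P bs \<phi> ` K)"
    using assms continuous_on_partial_ext continuous_on_subset by (intro compact_continuous_image) blast+
  then show ?thesis using compact_imp_bounded[of "P bs \<phi> ` K"] by (auto simp: bounded_iff)
qed

sublocale C_infty: unif_space "C_infty_set \<Omega>" "lists Basis" "{K. compact K \<and> K \<subseteq> \<Omega>}" P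
  rewrites "unif_topology (C_infty_set \<Omega>) (lists Basis) {K. compact K \<and> K \<subseteq> \<Omega>} P \<equiv> C_infty \<Omega>"
proof -
  show "unif_space (C_infty_set \<Omega>) (lists Basis) {K. compact K \<and> K \<subseteq> \<Omega>} P"
    by unfold_locales (auto simp: subspace_C_infty_set partial_ext_add partial_ext_scale partial_ext_bounded)
qed (simp add: C_infty_def)

text \<open>In the interior this is the usual passage from continuous partial derivatives to the
  total derivative, changing one coordinate at a time. On the faces \<open>f\<^sub>1\<close>,
  \<open>f\<^sub>2\<close>, \<open>f\<^sub>3\<close> are only extensions; there the estimate is
  obtained as a limit of interior estimates.\<close>

lemma has_derivative_of_partials:
  assumes f: "continuous_on \<Omega> f" and f1: "continuous_on \<Omega> f\<^sub>1"
    and f2: "continuous_on \<Omega> f\<^sub>2" and f3: "continuous_on \<Omega> f\<^sub>3"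
    and d1: "\<And>s a b. (s, a, b) \<in> interior \<Omega> \<Longrightarrow> ((\<lambda>s. f (s, a, b)) has_real_derivative f\<^sub>1 (s, a, b)) (at s)"
    and d2: "\<And>s a b. (s, a, b) \<in> interior \<Omega> \<Longrightarrow> ((\<lambda>a. f (s, a, b)) has_real_derivative f\<^sub>2 (s, a, b)) (at a)"
    and d3: "\<And>s a b. (s, a, b) \<in> interior \<Omega> \<Longrightarrow> ((\<lambda>b. f (s, a, b)) has_real_derivative f\<^sub>3 (s, a, b)) (at b)"
    and z: "z \<in> \<Omega>"
  shows "(f has_derivative (\<lambda>(h\<^sub>1, h\<^sub>2, h\<^sub>3). f\<^sub>1 z * h\<^sub>1 + f\<^sub>2 z * h\<^sub>2 + f\<^sub>3 z * h\<^sub>3)) (at z within \<Omega>)"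
  unfolding has_derivative_within_alt
proof (intro conjI allI impI)
  show "bounded_linear (\<lambda>(h\<^sub>1, h\<^sub>2, h\<^sub>3). f\<^sub>1 z * h\<^sub>1 + f\<^sub>2 z * h\<^sub>2 + f\<^sub>3 z * h\<^sub>3)"
    unfolding case_prod_unfold
    by (intro bounded_linear_add bounded_linear_const_mult bounded_linear_fst
        bounded_linear_compose[OF bounded_linear_fst bounded_linear_snd]
        bounded_linear_compose[OF bounded_linear_snd bounded_linear_snd])
  fix e :: real assume e: "e > 0"
  obtain s\<^sub>0 a\<^sub>0 b\<^sub>0 where z_eq: "z = (s\<^sub>0, a\<^sub>0, b\<^sub>0)" by (metis prod.collapse)
  obtain G where G: "open G" "\<Omega> = (I01 \<times> UNIV \<times> UNIV) \<inter> G"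
    using rel_open unfolding openin_open by auto
  obtain d\<^sub>0 where d0: "d\<^sub>0 > 0" "ball z d\<^sub>0 \<subseteq> G" using G z open_contains_ball by blast
  have near: "\<exists>d>0. \<forall>y\<in>\<Omega>. dist y z < d \<longrightarrow> \<bar>g y - g z\<bar> \<le> e / 3"
    if "continuous_on \<Omega> g" for g :: "r3 \<Rightarrow> real"
    using that z e unfolding continuous_on_iff dist_real_def
    by (metis divide_pos_pos less_eq_real_def zero_less_numeral)
  obtain d\<^sub>1 where e1: "d\<^sub>1 > 0" "\<And>y. y \<in> \<Omega> \<Longrightarrow> dist y z < d\<^sub>1 \<Longrightarrow> \<bar>f\<^sub>1 y - f\<^sub>1 z\<bar> \<le> e / 3"
    using near[OF f1] by metis
  obtain d\<^sub>2 where e2: "d\<^sub>2 > 0" "\<And>y. y \<in> \<Omega> \<Longrightarrow> dist y z < d\<^sub>2 \<Longrightarrow> \<bar>f\<^sub>2 y - f\<^sub>2 z\<bar> \<le> e / 3"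
    using near[OF f2] by metis
  obtain d\<^sub>3 where e3: "d\<^sub>3 > 0" "\<And>y. y \<in> \<Omega> \<Longrightarrow> dist y z < d\<^sub>3 \<Longrightarrow> \<bar>f\<^sub>3 y - f\<^sub>3 z\<bar> \<le> e / 3"
    using near[OF f3] by metis
  \<comment> \<open>A point whose coordinates each differ from those of z by less than
    \<open>d\<close> lies within \<open>3 * d\<close> of z, hence within all four radii.\<close>
  define d where "d = Min {d\<^sub>0, d\<^sub>1, d\<^sub>2, d\<^sub>3} / 3"
  have d: "d > 0" "3 * d \<le> d\<^sub>0" "3 * d \<le> d\<^sub>1" "3 * d \<le> d\<^sub>2" "3 * d \<le> d\<^sub>3"
    using d0 e1 e2 e3 by (auto simp: d_def)
  define Q where "Q = {(s, a, b). s \<in> I01 \<and> \<bar>s - s\<^sub>0\<bar> < d \<and> \<bar>a - a\<^sub>0\<bar> < d \<and> \<bar>b - b\<^sub>0\<bar> < d}"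
  have dist_Q: "dist y z < 3 * d" if "y \<in> Q" for y
  proof -
    obtain s a b where y: "y = (s, a, b)" by (metis prod.collapse)
    have "dist y z \<le> \<bar>s - s\<^sub>0\<bar> + (\<bar>a - a\<^sub>0\<bar> + \<bar>b - b\<^sub>0\<bar>)"
      using norm_Pair_le[of "s - s\<^sub>0" "(a - a\<^sub>0, b - b\<^sub>0)"] norm_Pair_le[of "a - a\<^sub>0" "b - b\<^sub>0"]
      by (simp add: y z_eq dist_norm)
    then show ?thesis using that by (auto simp: y Q_def)
  qed
  have Q\<Omega>: "Q \<subseteq> \<Omega>"
  proof
    fix y assume "y \<in> Q"
    then have "y \<in> ball z d\<^sub>0" "y \<in> I01 \<times> UNIV \<times> UNIV"
      using dist_Q[of y] d by (auto simp: dist_commute Q_def)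
    then show "y \<in> \<Omega>" using d0 G by auto
  qed
  have close: "\<bar>f\<^sub>1 y - f\<^sub>1 z\<bar> \<le> e / 3" "\<bar>f\<^sub>2 y - f\<^sub>2 z\<bar> \<le> e / 3" "\<bar>f\<^sub>3 y - f\<^sub>3 z\<bar> \<le> e / 3" if "y \<in> Q" for y
  proof -
    have "y \<in> \<Omega>" "dist y z < d\<^sub>1" "dist y z < d\<^sub>2" "dist y z < d\<^sub>3"
      using dist_Q[OF that] that d Q\<Omega> by auto
    then show "\<bar>f\<^sub>1 y - f\<^sub>1 z\<bar> \<le> e / 3" "\<bar>f\<^sub>2 y - f\<^sub>2 z\<bar> \<le> e / 3" "\<bar>f\<^sub>3 y - f\<^sub>3 z\<bar> \<le> e / 3"
      using e1(2) e2(2) e3(2) by blast+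
  qed
  let ?L = "\<lambda>s a b s' a' b'. f\<^sub>1 z * (s - s') + f\<^sub>2 z * (a - a') + f\<^sub>3 z * (b - b')"
  \<comment> \<open>The path consists of three axis-parallel segments. They stay in the box
    \<open>Q\<close>, and in the interior because both s and s' lie strictly between 0 and
    1.\<close>
  have inner: "\<bar>f (s, a, b) - f (s', a', b') - ?L s a b s' a' b'\<bar>
      \<le> e / 3 * (\<bar>s - s'\<bar> + \<bar>a - a'\<bar> + \<bar>b - b'\<bar>)"
    if y: "(s, a, b) \<in> Q" "(s', a', b') \<in> Q" "s \<in> {0<..<1}" "s' \<in> {0<..<1}" for s a b s' a' b'
  proof -
    have segm: "u \<in> closed_segment x x' \<Longrightarrow> \<bar>x - c\<bar> < d \<Longrightarrow> \<bar>x' - c\<bar> < d \<Longrightarrow> \<bar>u - c\<bar> < d"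
      for u x x' c :: real
      by (auto simp: closed_segment_eq_real_ivl split: if_splits)
    have sg: "u \<in> closed_segment s s' \<Longrightarrow> u \<in> {0<..<1}" for u
      using y by (auto simp: closed_segment_eq_real_ivl split: if_splits)
    have i1: "(u, a, b) \<in> Q \<and> (u, a, b) \<in> interior \<Omega>" if "u \<in> closed_segment s s'" for u
      using segm[OF that, of s\<^sub>0] sg[OF that] y Q\<Omega> by (auto simp: Q_def interior_\<Omega>)
    have i2: "(s', u, b) \<in> Q \<and> (s', u, b) \<in> interior \<Omega>" if "u \<in> closed_segment a a'" for u
      using segm[OF that, of a\<^sub>0] y Q\<Omega> by (auto simp: Q_def interior_\<Omega>)
    have i3: "(s', a', u) \<in> Q \<and> (s', a', u) \<in> interior \<Omega>" if "u \<in> closed_segment b b'" for u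
      using segm[OF that, of b\<^sub>0] y Q\<Omega> by (auto simp: Q_def interior_\<Omega>)
    have "\<bar>f (s, a, b) - f (s', a, b) - f\<^sub>1 z * (s - s')\<bar> \<le> e / 3 * \<bar>s - s'\<bar>"
      using i1 d1 close by (intro affine_approx_of_deriv_bound[of _ _ _ "\<lambda>u. f\<^sub>1 (u, a, b)"]) auto
    moreover have "\<bar>f (s', a, b) - f (s', a', b) - f\<^sub>2 z * (a - a')\<bar> \<le> e / 3 * \<bar>a - a'\<bar>"
      using i2 d2 close by (intro affine_approx_of_deriv_bound[of _ _ _ "\<lambda>u. f\<^sub>2 (s', u, b)"]) auto
    moreover have "\<bar>f (s', a', b) - f (s', a', b') - f\<^sub>3 z * (b - b')\<bar> \<le> e / 3 * \<bar>b - b'\<bar>"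
      using i3 d3 close by (intro affine_approx_of_deriv_bound[of _ _ _ "\<lambda>u. f\<^sub>3 (s', a', u)"]) auto
    ultimately show ?thesis by (simp only: distrib_left) linarith
  qed
  \<comment> \<open>\<open>\<sigma> t\<close> moves s towards the midpoint 1/2, so
    \<open>inner\<close> applies for small \<open>t > 0\<close>. Letting t tend to 0 carries the
    estimate to the faces, by continuity of f.\<close>
  define \<sigma> where "\<sigma> t s = s + t * (1 / 2 - s)" for t s :: real
  have \<sigma>: "\<sigma> t s \<in> {0<..<1}" if "0 < t" "t < 1" "s \<in> I01" for t s
  proof -
    have "\<sigma> t s = (1 - t) * s + t / 2" by (simp add: \<sigma>_def algebra_simps)
    moreover have "0 \<le> (1 - t) * s" "(1 - t) * s \<le> (1 - t) * 1"
      using that by (auto intro!: mult_nonneg_nonneg mult_left_mono)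
    ultimately show ?thesis using that unfolding greaterThanLessThan_iff mult_1_right by linarith
  qed
  have \<sigma>_tendsto: "((\<lambda>t. \<sigma> t s) \<longlongrightarrow> s) (at_right 0)" for s
    unfolding \<sigma>_def by (auto intro!: tendsto_eq_intros)
  have \<sigma>_Q: "\<forall>\<^sub>F t in at_right 0. (\<sigma> t s, a, b) \<in> Q" if "(s, a, b) \<in> Q" for s a b
  proof -
    have "\<forall>\<^sub>F t in at_right 0. \<bar>\<sigma> t s - s\<^sub>0\<bar> < d"
      using that by (intro order_tendstoD(2)[OF tendsto_rabs[OF tendsto_diff[OF \<sigma>_tendsto tendsto_const]]])
        (auto simp: Q_def)
    moreover have "\<forall>\<^sub>F t in at_right (0::real). t < 1" by (rule eventually_at_rightI[of 0 1]) auto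
    moreover have "\<forall>\<^sub>F t in at_right (0::real). 0 < t" by (rule eventually_at_right_less)
    ultimately show ?thesis
    proof eventually_elim
      case (elim t)
      then show ?case using \<sigma>[of t s] that by (auto simp: Q_def)
    qed
  qed
  have lim: "((\<lambda>t. f (\<sigma> t s, a, b)) \<longlongrightarrow> f (s, a, b)) (at_right 0)" if y: "(s, a, b) \<in> Q" for s a b
    using y Q\<Omega> \<sigma>_Q[OF y]
    by (intro continuous_on_tendsto_compose[OF f] tendsto_Pair \<sigma>_tendsto tendsto_const)
      (auto elim: eventually_mono)
  have outer: "\<bar>f (s, a, b) - f z - ?L s a b s\<^sub>0 a\<^sub>0 b\<^sub>0\<bar> \<le> e / 3 * (\<bar>s - s\<^sub>0\<bar> + \<bar>a - a\<^sub>0\<bar> + \<bar>b - b\<^sub>0\<bar>)"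
    if y: "(s, a, b) \<in> Q" for s a b
  proof (rule tendsto_le)
    have zQ: "(s\<^sub>0, a\<^sub>0, b\<^sub>0) \<in> Q" using z d \<Omega>_strip unfolding z_eq Q_def by auto
    show "((\<lambda>t. e / 3 * (\<bar>\<sigma> t s - \<sigma> t s\<^sub>0\<bar> + \<bar>a - a\<^sub>0\<bar> + \<bar>b - b\<^sub>0\<bar>)) \<longlongrightarrow>
        e / 3 * (\<bar>s - s\<^sub>0\<bar> + \<bar>a - a\<^sub>0\<bar> + \<bar>b - b\<^sub>0\<bar>)) (at_right 0)"
      by (intro tendsto_intros \<sigma>_tendsto)
    show "((\<lambda>t. \<bar>f (\<sigma> t s, a, b) - f (\<sigma> t s\<^sub>0, a\<^sub>0, b\<^sub>0) - ?L (\<sigma> t s) a b (\<sigma> t s\<^sub>0) a\<^sub>0 b\<^sub>0\<bar>) \<longlongrightarrow>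
        \<bar>f (s, a, b) - f z - ?L s a b s\<^sub>0 a\<^sub>0 b\<^sub>0\<bar>) (at_right 0)"
      unfolding z_eq by (intro tendsto_intros \<sigma>_tendsto lim y zQ)
    have "\<forall>\<^sub>F t in at_right (0::real). t < 1" by (rule eventually_at_rightI[of 0 1]) auto
    moreover have "\<forall>\<^sub>F t in at_right (0::real). 0 < t" by (rule eventually_at_right_less)
    ultimately show "\<forall>\<^sub>F t in at_right 0.
        \<bar>f (\<sigma> t s, a, b) - f (\<sigma> t s\<^sub>0, a\<^sub>0, b\<^sub>0) - ?L (\<sigma> t s) a b (\<sigma> t s\<^sub>0) a\<^sub>0 b\<^sub>0\<bar>
          \<le> e / 3 * (\<bar>\<sigma> t s - \<sigma> t s\<^sub>0\<bar> + \<bar>a - a\<^sub>0\<bar> + \<bar>b - b\<^sub>0\<bar>)"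
      using \<sigma>_Q[OF y] \<sigma>_Q[OF zQ]
    proof eventually_elim
      case (elim t)
      then show ?case using \<sigma>[of t s] \<sigma>[of t s\<^sub>0] y zQ by (intro inner) (auto simp: Q_def)
    qed
  qed simp
  show "\<exists>d>0. \<forall>y\<in>\<Omega>. norm (y - z) < d \<longrightarrow>
      norm (f y - f z - (case y - z of (h\<^sub>1, h\<^sub>2, h\<^sub>3) \<Rightarrow> f\<^sub>1 z * h\<^sub>1 + f\<^sub>2 z * h\<^sub>2 + f\<^sub>3 z * h\<^sub>3))
        \<le> e * norm (y - z)"
  proof (intro exI[of _ d] conjI d ballI impI)
    fix y assume y: "y \<in> \<Omega>" "norm (y - z) < d"
    obtain s a b where y_eq: "y = (s, a, b)" by (metis prod.collapse)
    have n: "\<bar>s - s\<^sub>0\<bar> \<le> norm (y - z)" "\<bar>a - a\<^sub>0\<bar> \<le> norm (y - z)" "\<bar>b - b\<^sub>0\<bar> \<le> norm (y - z)"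
      using norm_fst_le[of "s - s\<^sub>0" "(a - a\<^sub>0, b - b\<^sub>0)"] norm_snd_le[of "(a - a\<^sub>0, b - b\<^sub>0)" "s - s\<^sub>0"]
        norm_fst_le[of "a - a\<^sub>0" "b - b\<^sub>0"] norm_snd_le[of "b - b\<^sub>0" "a - a\<^sub>0"]
      by (auto simp: y_eq z_eq)
    then have "(s, a, b) \<in> Q" using y \<Omega>_strip by (auto simp: Q_def y_eq)
    from outer[OF this] have "\<bar>f y - f z - ?L s a b s\<^sub>0 a\<^sub>0 b\<^sub>0\<bar> \<le> e / 3 * (\<bar>s - s\<^sub>0\<bar> + \<bar>a - a\<^sub>0\<bar> + \<bar>b - b\<^sub>0\<bar>)"
      by (simp add: y_eq)
    also have "\<dots> \<le> e / 3 * (norm (y - z) + norm (y - z) + norm (y - z))"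
      using n e by (intro mult_left_mono add_mono) auto
    finally show "norm (f y - f z - (case y - z of (h\<^sub>1, h\<^sub>2, h\<^sub>3) \<Rightarrow> f\<^sub>1 z * h\<^sub>1 + f\<^sub>2 z * h\<^sub>2 + f\<^sub>3 z * h\<^sub>3))
        \<le> e * norm (y - z)"
      by (simp add: y_eq z_eq)
  qed
qed

lemma partial_ext_has_derivative:
  assumes \<phi>: "\<phi> \<in> C_infty_set \<Omega>" and bs: "bs \<in> lists Basis" and z: "z \<in> \<Omega>"
  shows "(P bs \<phi> has_derivative (\<lambda>(h\<^sub>1, h\<^sub>2, h\<^sub>3).
    P (bs @ [e\<^sub>1]) \<phi> z * h\<^sub>1 + P (bs @ [e\<^sub>2]) \<phi> z * h\<^sub>2 + P (bs @ [e\<^sub>3]) \<phi> z * h\<^sub>3)) (at z within \<Omega>)"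
proof -
  have sm: "smooth_on_open (interior \<Omega>) \<phi>" using \<phi> by (simp add: C_infty_set_def)
  have b: "bs @ [e\<^sub>1] \<in> lists Basis" "bs @ [e\<^sub>2] \<in> lists Basis" "bs @ [e\<^sub>3] \<in> lists Basis"
    using bs by (auto simp: Basis_r3)
  have line: "((\<lambda>t. P bs \<phi> (y + t *\<^sub>R b)) has_real_derivative P (bs @ [b]) \<phi> y) (at 0)"
    if "y \<in> interior \<Omega>" "b \<in> Basis" for y b
  proof -
    have "((\<lambda>t. P bs \<phi> (y + t *\<^sub>R b)) has_real_derivative iter_partial (bs @ [b]) \<phi> y) (at 0)"
      by (rule has_field_derivative_transform_within_open
          [OF iter_partial_has_derivative[OF sm bs that(2,1)] open_line_preimage[of "interior \<Omega>" y b]])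
        (use that partial_ext_interior[OF \<phi> bs] in auto)
    then show ?thesis using partial_ext_interior[OF \<phi>, of "bs @ [b]" y] bs that by auto
  qed
  show ?thesis
  proof (rule has_derivative_of_partials[OF _ _ _ _ _ _ _ z])
    fix s a b assume i: "(s, a, b) \<in> interior \<Omega>"
    show "((\<lambda>s. P bs \<phi> (s, a, b)) has_real_derivative P (bs @ [e\<^sub>1]) \<phi> (s, a, b)) (at s)"
      using line[OF i, of e\<^sub>1] DERIV_shift[of "\<lambda>s. P bs \<phi> (s, a, b)" _ 0 s] by (simp add: Basis_r3 add.commute)
    show "((\<lambda>a. P bs \<phi> (s, a, b)) has_real_derivative P (bs @ [e\<^sub>2]) \<phi> (s, a, b)) (at a)"
      using line[OF i, of e\<^sub>2] DERIV_shift[of "\<lambda>a. P bs \<phi> (s, a, b)" _ 0 a] by (simp add: Basis_r3 add.commute)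
    show "((\<lambda>b. P bs \<phi> (s, a, b)) has_real_derivative P (bs @ [e\<^sub>3]) \<phi> (s, a, b)) (at b)"
      using line[OF i, of e\<^sub>3] DERIV_shift[of "\<lambda>b. P bs \<phi> (s, a, b)" _ 0 b] by (simp add: Basis_r3 add.commute)
  qed (intro continuous_on_partial_ext \<phi> bs b)+
qed

end

section \<open>Implicit first-order equations\<close>

text \<open>Passing to \<open>u\<^sup>2\<close> avoids the derivative of \<open>\<bar>u\<bar>\<close>.\<close>

lemma gronwall_I01:
  fixes u u' :: "real \<Rightarrow> real"
  assumes der: "\<And>s. s \<in> I01 \<Longrightarrow> (u has_real_derivative u' s) (at s within I01)"
    and le: "\<And>s. s \<in> I01 \<Longrightarrow> \<bar>u' s\<bar> \<le> a * \<bar>u s\<bar> + b"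
    and init: "\<bar>u 0\<bar> \<le> b" and a: "a \<ge> 0" and s: "s \<in> I01"
  shows "\<bar>u s\<bar> \<le> 2 * exp (2 * a + 1) * b"
proof -
  \<comment> \<open>Since \<open>2 u u' \<le> 2 a u^2 + 2 \<bar>u\<bar> b \<le> (2 a + 1) u^2 +
    b^2\<close>, this k makes \<open>v\<close> nonincreasing.\<close>
  define k where "k = 2 * a + 1"
  define v where "v s = exp (- k * s) * ((u s)\<^sup>2 + b\<^sup>2)" for s
  define v' where "v' s = exp (- k * s) * (2 * u s * u' s - k * ((u s)\<^sup>2 + b\<^sup>2))" for s
  have b: "b \<ge> 0" using init by linarith
  have k: "k \<ge> 1" using a by (simp add: k_def)
  have v: "(v has_real_derivative v' r) (at r within I01)" if "r \<in> I01" for r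
    unfolding v_def v'_def by (auto intro!: derivative_eq_intros der that simp: algebra_simps)
  have v'_le: "v' r \<le> 0" if "r \<in> I01" for r
  proof -
    have "2 * u r * u' r \<le> 2 * (\<bar>u r\<bar> * \<bar>u' r\<bar>)"
      using abs_ge_self[of "u r * u' r"] by (simp add: abs_mult)
    also have "\<dots> \<le> 2 * (\<bar>u r\<bar> * (a * \<bar>u r\<bar> + b))"
      using le[OF that] by (intro mult_left_mono) auto
    also have "\<dots> = 2 * a * (u r)\<^sup>2 + 2 * \<bar>u r\<bar> * b"
      by (simp add: algebra_simps power2_eq_square flip: abs_mult)
    also have "\<dots> \<le> 2 * a * (u r)\<^sup>2 + ((u r)\<^sup>2 + b\<^sup>2)"
      using sum_squares_bound[of "\<bar>u r\<bar>" b] by simp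
    also have "\<dots> \<le> k * ((u r)\<^sup>2 + b\<^sup>2)"
      using a by (simp add: k_def algebra_simps)
    finally show ?thesis unfolding v'_def by (simp add: mult_nonneg_nonpos)
  qed
  have "v s \<le> v 0"
  proof (cases "s = 0")
    case False
    then have "0 < s" using s by simp
    have "\<exists>x\<in>{0<..<s}. v s - v 0 = v' x * (s - 0)"
      by (rule mvt_simple[OF \<open>0 < s\<close>]) (use s v in \<open>auto simp: has_field_derivative_def
        intro: has_derivative_subset[of _ _ _ I01]\<close>)
    then obtain x where x: "x \<in> {0<..<s}" "v s - v 0 = v' x * (s - 0)" by blast
    then show ?thesis using mult_nonpos_nonneg[OF v'_le[of x], of s] \<open>0 < s\<close> s by simp
  qed simp
  also have "v 0 \<le> 2 * b\<^sup>2"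
    using power_mono[OF init, of 2] by (simp add: v_def)
  finally have "exp (- k * s) * (u s)\<^sup>2 \<le> 2 * b\<^sup>2"
    using mult_nonneg_nonneg[OF exp_ge_zero zero_le_power2, of "- k * s" b] unfolding v_def distrib_left
    by linarith
  then have "exp (k * s) * (exp (- k * s) * (u s)\<^sup>2) \<le> exp (k * s) * (2 * b\<^sup>2)"
    by (intro mult_left_mono) auto
  moreover have "exp (k * s) * (exp (- k * s) * (u s)\<^sup>2) = (u s)\<^sup>2"
    unfolding mult.assoc[symmetric] exp_add[symmetric] by simp
  ultimately have "(u s)\<^sup>2 \<le> exp (k * s) * (2 * b\<^sup>2)" by linarith
  also have "\<dots> \<le> exp k * (2 * b\<^sup>2)"
    using s k mult_left_mono[of s 1 k] by (intro mult_right_mono) auto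
  \<comment> \<open>A wasteful bound that turns the right-hand side into a perfect square.\<close>
  also have "\<dots> \<le> (exp k * exp k) * (4 * b\<^sup>2)"
    using k mult_left_mono[of 1 "exp k" "exp k"] by (intro mult_mono) auto
  also have "\<dots> = (2 * exp k * b)\<^sup>2" by (simp add: power2_eq_square)
  finally have "\<bar>u s\<bar> \<le> \<bar>2 * exp k * b\<bar>" by (simp only: abs_le_square_iff)
  then show ?thesis using b by (simp add: k_def abs_mult)
qed

text \<open>Integrating the weight gains the factor \<open>1 / L\<close>, which the Picard iteration
  plays off against \<Lambda>.\<close>

lemma integral_exp_weight_bound:
  fixes q :: "real \<Rightarrow> real"
  assumes "continuous_on I01 q" "\<And>r. r \<in> I01 \<Longrightarrow> \<bar>q r\<bar> \<le> D" "L > 0" "s \<in> I01"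
  shows "\<bar>integral {0..s} (\<lambda>r. exp (L * r) * q r)\<bar> \<le> D * exp (L * s) / L"
proof -
  have D: "D \<ge> 0" using assms(2)[of 0] by fastforce
  have sub: "{0..s} \<subseteq> I01" using assms(4) by auto
  have "((\<lambda>r. exp (L * r) * D) has_integral exp (L * s) * D / L - exp (L * 0) * D / L) {0..s}"
    using assms(3,4) by (intro fundamental_theorem_of_calculus)
      (auto intro!: derivative_eq_intros simp flip: has_real_derivative_iff_has_vector_derivative)
  then have int: "(\<lambda>r. exp (L * r) * D) integrable_on {0..s}"
    "integral {0..s} (\<lambda>r. exp (L * r) * D) = exp (L * s) * D / L - exp (L * 0) * D / L"
    by (auto simp: has_integral_iff)
  have "norm (integral {0..s} (\<lambda>r. exp (L * r) * q r)) \<le> integral {0..s} (\<lambda>r. exp (L * r) * D)"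
    using assms sub int by (intro integral_norm_bound_integral integrable_continuous_real continuous_intros)
      (auto simp: abs_mult intro: continuous_on_subset)
  also have "\<dots> \<le> exp (L * s) * D / L" unfolding int(2) using D assms(3) by simp
  finally show ?thesis by (simp add: mult.commute)
qed

text \<open>Picard iteration. The unknown is
  \<open>q = exp (- L s) (y' - z\<^sub>0)\<close>: the exponential weight makes the contribution of \<open>y\<close>, an integral of
  the unknown, small compared with the gap \<open>1 - \<kappa>\<close>.\<close>

lemma implicit_ode_solution:
  fixes \<Psi> :: "real \<Rightarrow> real \<Rightarrow> real \<Rightarrow> real" and y\<^sub>0 z\<^sub>0 :: "real \<Rightarrow> real"
  assumes z0: "continuous_on I01 z\<^sub>0"
    and y0: "\<And>s. s \<in> I01 \<Longrightarrow> (y\<^sub>0 has_real_derivative z\<^sub>0 s) (at s within I01)"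
    and r: "r > 0" and \<kappa>: "0 \<le> \<kappa>" "\<kappa> < 1" and \<Lambda>: "\<Lambda> \<ge> 0"
    and L: "L = 4 * \<Lambda> / (1 - \<kappa>) + 1"
    and tube: "\<And>s a b. tube s a b \<longleftrightarrow> s \<in> I01 \<and> \<bar>a - y\<^sub>0 s\<bar> \<le> r \<and> \<bar>b - z\<^sub>0 s\<bar> \<le> r"
    and cont: "continuous_on {(s, a, b). tube s a b} (\<lambda>(s, a, b). \<Psi> s a b)"
    and contr: "\<And>s a b a' b'. tube s a b \<Longrightarrow> tube s a' b' \<Longrightarrow>
      \<bar>(b - b') - (\<Psi> s a b - \<Psi> s a' b')\<bar> \<le> \<kappa> * \<bar>b - b'\<bar> + \<Lambda> * \<bar>a - a'\<bar>"
    and \<eta>: "\<bar>\<eta> - y\<^sub>0 0\<bar> \<le> r / 4"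
    and small: "\<And>s. s \<in> I01 \<Longrightarrow> \<bar>\<Psi> s (y\<^sub>0 s + (\<eta> - y\<^sub>0 0)) (z\<^sub>0 s)\<bar> \<le> (1 - \<kappa>) / 2 * (r / (4 * exp L))"
  obtains y z where "continuous_on I01 z" "y 0 = \<eta>"
    "\<And>s. s \<in> I01 \<Longrightarrow> (y has_real_derivative z s) (at s within I01)"
    "\<And>s. s \<in> I01 \<Longrightarrow> \<bar>y s - y\<^sub>0 s\<bar> \<le> r / 2" "\<And>s. s \<in> I01 \<Longrightarrow> \<bar>z s - z\<^sub>0 s\<bar> \<le> r / 2"
    "\<And>s. s \<in> I01 \<Longrightarrow> \<Psi> s (y s) (z s) = 0"
proof -
  \<comment> \<open>The weight is at most \<open>exp L\<close> on I. Hence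
    \<open>\<bar>q\<bar> \<le> \<rho>\<close> keeps \<open>Z q\<close> within \<open>r / 4\<close>
    of \<open>z\<^sub>0\<close>, and \<open>Y q\<close> within \<open>r / 2\<close> of
    \<open>y\<^sub>0\<close>, half of which is due to the initial value.\<close>
  define \<rho> where "\<rho> = r / (4 * exp L)"
  have \<rho>: "\<rho> > 0" "\<rho> * exp L = r / 4" using r by (auto simp: \<rho>_def)
  have L1: "L \<ge> 1" using \<Lambda> \<kappa> by (simp add: L)
  \<comment> \<open>The origin of \<open>L\<close>: it makes \<open>\<kappa> + \<Lambda> / L\<close>
    at most \<open>(1 + \<kappa>) / 2\<close>, a contraction constant below 1.\<close>
  have \<Lambda>L: "\<Lambda> / L \<le> (1 - \<kappa>) / 4"
  proof -
    have "(L - 1) * (1 - \<kappa>) = 4 * \<Lambda>" using \<kappa> by (simp add: L)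
    then have "4 * \<Lambda> \<le> L * (1 - \<kappa>)" using \<kappa> by (simp add: algebra_simps)
    then show ?thesis using L1 by (simp add: field_simps)
  qed
  define Z where "Z q s = z\<^sub>0 s + exp (L * s) * q s" for q :: "real \<Rightarrow> real" and s
  define Y where "Y q s = y\<^sub>0 s + (\<eta> - y\<^sub>0 0) + integral {0..s} (\<lambda>r. exp (L * r) * q r)"
    for q :: "real \<Rightarrow> real" and s
  \<comment> \<open>The exponential never vanishes, so the fixed points of \<open>F\<close> are the
    q with \<open>\<Psi> s (Y q s) (Z q s) = 0\<close>. The initial condition is built into
    \<open>Y\<close>.\<close>
  define F where "F q s = q s - exp (- L * s) * \<Psi> s (Y q s) (Z q s)" for q :: "real \<Rightarrow> real" and s
  \<comment> \<open>Bounded continuous functions live on the whole line here; \<open>cl\<close>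
    retracts the line onto I.\<close>
  define cl :: "real \<Rightarrow> real" where "cl s = max 0 (min 1 s)" for s
  have cl: "cl s \<in> I01" "s \<in> I01 \<Longrightarrow> cl s = s" for s by (auto simp: cl_def)
  have cont_cl: "continuous_on UNIV cl" unfolding cl_def by (intro continuous_intros)
  have expL: "exp (L * s) \<le> exp L" "exp (L * s) > 0" if "s \<in> I01" for s
    using that L1 mult_left_mono[of s 1 L] by auto
  have Y': "(Y q has_real_derivative Z q s) (at s within I01)" if "continuous_on I01 q" "s \<in> I01" for q s
  proof -
    have "((\<lambda>s. integral {0..s} (\<lambda>r. exp (L * r) * q r)) has_real_derivative exp (L * s) * q s) (at s within I01)"
      by (rule integral_has_real_derivative) (use that in \<open>auto intro!: continuous_intros\<close>)
    then show ?thesis unfolding Y_def Z_def using y0[OF that(2)]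
      by (auto intro!: derivative_eq_intros)
  qed
  have contZ: "continuous_on I01 (Z q)" if "continuous_on I01 q" for q
    unfolding Z_def using that z0 by (intro continuous_intros)
  have contY: "continuous_on I01 (Y q)" if "continuous_on I01 q" for q
    using Y'[OF that] by (metis DERIV_continuous_on)
  have Zb: "\<bar>Z q s - z\<^sub>0 s\<bar> \<le> r / 4" if "\<bar>q s\<bar> \<le> \<rho>" "s \<in> I01" for q s
  proof -
    have "exp (L * s) * \<bar>q s\<bar> \<le> exp L * \<rho>" using that expL[of s] by (intro mult_mono) auto
    then show ?thesis using \<rho> by (simp add: Z_def abs_mult mult.commute)
  qed
  have Yb: "\<bar>Y q s - y\<^sub>0 s\<bar> \<le> r / 2" if q: "continuous_on I01 q" "\<And>s. s \<in> I01 \<Longrightarrow> \<bar>q s\<bar> \<le> \<rho>" "s \<in> I01" for q s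
  proof -
    have "\<bar>integral {0..s} (\<lambda>r. exp (L * r) * q r)\<bar> \<le> \<rho> * exp (L * s) / L"
      using L1 q by (intro integral_exp_weight_bound) auto
    also have "\<dots> \<le> \<rho> * exp (L * s) / 1" using \<rho> L1 by (intro divide_left_mono) auto
    also have "\<dots> \<le> \<rho> * exp L" using \<rho> expL[OF q(3)] by simp
    finally show ?thesis unfolding Y_def using \<eta> \<rho>(2) by linarith
  qed
  have in_tube: "tube s (Y q s) (Z q s)" if "continuous_on I01 q" "\<And>s. s \<in> I01 \<Longrightarrow> \<bar>q s\<bar> \<le> \<rho>" "s \<in> I01" for q s
    unfolding tube using Yb[OF that] Zb[of q s] that r by fastforce
  have contF: "continuous_on I01 (F q)" if q: "continuous_on I01 q" "\<And>s. s \<in> I01 \<Longrightarrow> \<bar>q s\<bar> \<le> \<rho>" for q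
  proof -
    have "continuous_on I01 (\<lambda>s. (\<lambda>(s, a, b). \<Psi> s a b) (s, Y q s, Z q s))"
      by (rule continuous_on_compose2[OF cont])
        (use contY[OF q(1)] contZ[OF q(1)] in_tube[OF q] in \<open>auto intro!: continuous_intros\<close>)
    then show ?thesis unfolding F_def using q by (intro continuous_intros) auto
  qed
  have F_lip: "\<bar>F q s - F p s\<bar> \<le> (1 + \<kappa>) / 2 * D"
    if q: "continuous_on I01 q" "\<And>s. s \<in> I01 \<Longrightarrow> \<bar>q s\<bar> \<le> \<rho>"
      and p: "continuous_on I01 p" "\<And>s. s \<in> I01 \<Longrightarrow> \<bar>p s\<bar> \<le> \<rho>"
      and D: "\<And>s. s \<in> I01 \<Longrightarrow> \<bar>q s - p s\<bar> \<le> D" and s: "s \<in> I01" for q p D s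
  proof -
    have D0: "D \<ge> 0" using D[OF s] by linarith
    have int: "(\<lambda>r. exp (L * r) * q r) integrable_on {0..s}" "(\<lambda>r. exp (L * r) * p r) integrable_on {0..s}"
      using q(1) p(1) s by (auto intro!: integrable_continuous_real continuous_intros intro: continuous_on_subset)
    have "Y q s - Y p s = integral {0..s} (\<lambda>r. exp (L * r) * (q r - p r))"
      using integral_diff[OF int] by (simp add: Y_def right_diff_distrib)
    moreover have "\<bar>integral {0..s} (\<lambda>r. exp (L * r) * (q r - p r))\<bar> \<le> D * exp (L * s) / L"
      using L1 q p D s by (intro integral_exp_weight_bound continuous_intros) auto
    ultimately have dY: "\<bar>Y q s - Y p s\<bar> \<le> D * exp (L * s) / L" by simp
    have dZ: "Z q s - Z p s = exp (L * s) * (q s - p s)" by (simp add: Z_def algebra_simps)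
    have "\<bar>Z q s - Z p s\<bar> \<le> exp (L * s) * D" using D[OF s] by (simp add: dZ abs_mult)
    have e: "exp (- L * s) * exp (L * s) = 1" by (simp flip: exp_add)
    have "F q s - F p s = exp (- L * s) * ((Z q s - Z p s) - (\<Psi> s (Y q s) (Z q s) - \<Psi> s (Y p s) (Z p s)))"
      unfolding dZ F_def right_diff_distrib[of "exp (- L * s)"] mult.assoc[symmetric] e by (simp add: algebra_simps)
    also have "\<bar>\<dots>\<bar> \<le> exp (- L * s) * (\<kappa> * (exp (L * s) * D) + \<Lambda> * (D * exp (L * s) / L))"
      unfolding abs_mult
    proof (intro mult_mono)
      have "\<bar>Z q s - Z p s - (\<Psi> s (Y q s) (Z q s) - \<Psi> s (Y p s) (Z p s))\<bar>
          \<le> \<kappa> * \<bar>Z q s - Z p s\<bar> + \<Lambda> * \<bar>Y q s - Y p s\<bar>"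
        by (rule contr) (use in_tube[OF q s] in_tube[OF p s] in auto)
      also have "\<dots> \<le> \<kappa> * (exp (L * s) * D) + \<Lambda> * (D * exp (L * s) / L)"
        using \<kappa> \<Lambda> dY \<open>\<bar>Z q s - Z p s\<bar> \<le> _\<close> by (intro add_mono mult_left_mono) auto
      finally show "\<bar>Z q s - Z p s - (\<Psi> s (Y q s) (Z q s) - \<Psi> s (Y p s) (Z p s))\<bar>
          \<le> \<kappa> * (exp (L * s) * D) + \<Lambda> * (D * exp (L * s) / L)" .
    qed auto
    \<comment> \<open>The weights cancel, and the dependence on y has shrunk from \<Lambda> to
      \<open>\<Lambda> / L\<close>.\<close>
    also have "\<dots> = (exp (- L * s) * exp (L * s)) * ((\<kappa> + \<Lambda> / L) * D)" by (simp add: algebra_simps)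
    also have "\<dots> = (\<kappa> + \<Lambda> / L) * D" by (simp only: e mult_1)
    also have "\<dots> \<le> (1 + \<kappa>) / 2 * D"
    proof (rule mult_right_mono[OF _ D0])
      show "\<kappa> + \<Lambda> / L \<le> (1 + \<kappa>) / 2" using \<Lambda>L \<kappa> by argo
    qed
    finally show ?thesis .
  qed
  have F_bound: "\<bar>F q s\<bar> \<le> \<rho>" if q: "continuous_on I01 q" "\<And>s. s \<in> I01 \<Longrightarrow> \<bar>q s\<bar> \<le> \<rho>" and s: "s \<in> I01" for q s
  proof -
    \<comment> \<open>The ball is mapped into itself: the contraction accounts for
      \<open>(1 + \<kappa>) / 2 * \<rho>\<close>, and \<open>small\<close> bounds the value at 0 by
      the remaining \<open>(1 - \<kappa>) / 2 * \<rho>\<close>.\<close>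
    have "\<bar>F q s - F (\<lambda>_. 0) s\<bar> \<le> (1 + \<kappa>) / 2 * \<rho>"
      using q \<rho> s by (intro F_lip) auto
    moreover have "\<bar>F (\<lambda>_. 0) s\<bar> \<le> 1 * ((1 - \<kappa>) / 2 * \<rho>)"
    proof -
      have "exp (- L * s) \<le> 1" using L1 s by simp
      then have "exp (- L * s) * \<bar>\<Psi> s (y\<^sub>0 s + (\<eta> - y\<^sub>0 0)) (z\<^sub>0 s)\<bar> \<le> 1 * ((1 - \<kappa>) / 2 * \<rho>)"
        using small[OF s] unfolding \<rho>_def by (intro mult_mono) auto
      then show ?thesis by (simp add: F_def Y_def Z_def abs_mult)
    qed
    ultimately have "\<bar>F q s\<bar> \<le> ((1 + \<kappa>) / 2 + (1 - \<kappa>) / 2) * \<rho>" unfolding distrib_right by linarith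
    then show ?thesis by (simp add: field_simps)
  qed
  define S where "S = cball (0 :: real \<Rightarrow>\<^sub>C real) \<rho>"
  have S: "q \<in> S \<longleftrightarrow> (\<forall>s. \<bar>apply_bcontfun q s\<bar> \<le> \<rho>)" for q
    unfolding S_def using norm_bounded[of q] norm_bound[of q \<rho>]
    by (auto simp: dist_norm intro: order_trans)
  define T where "T q = Bcontfun (\<lambda>s. F (apply_bcontfun q) (cl s))" for q
  have T: "apply_bcontfun (T q) s = F (apply_bcontfun q) (cl s)" if "q \<in> S" for q s
  proof -
    have q: "continuous_on I01 (apply_bcontfun q)" "\<And>s. s \<in> I01 \<Longrightarrow> \<bar>apply_bcontfun q s\<bar> \<le> \<rho>"
      using that by (auto simp: S)
    have "continuous_on UNIV (\<lambda>s. F (apply_bcontfun q) (cl s))"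
      by (rule continuous_on_compose2[OF contF[OF q] cont_cl]) (use cl in auto)
    then have "(\<lambda>s. F (apply_bcontfun q) (cl s)) \<in> bcontfun"
      by (rule bcontfun_normI[where b = \<rho>]) (use F_bound[OF q] cl in auto)
    then show ?thesis by (simp add: T_def Bcontfun_inverse)
  qed
  have "\<exists>!q\<in>S. T q = q"
  proof (rule Banach_fix)
    show "complete S" unfolding S_def by (simp add: complete_eq_closed)
    show "S \<noteq> {}" using \<rho> by (simp add: S_def)
    show "0 \<le> (1 + \<kappa>) / 2" "(1 + \<kappa>) / 2 < 1" using \<kappa> by auto
    show "T ` S \<subseteq> S"
    proof clarify
      fix q assume "q \<in> S"
      then show "T q \<in> S" using F_bound[of "apply_bcontfun q"] cl(1) by (auto simp: S T[OF \<open>q \<in> S\<close>])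
    qed
    show "dist (T q) (T p) \<le> (1 + \<kappa>) / 2 * dist q p" if "q \<in> S" "p \<in> S" for q p
    proof (rule dist_bound)
      fix s
      have D: "\<bar>apply_bcontfun q s - apply_bcontfun p s\<bar> \<le> dist q p" for s
        using dist_bounded[of q s p] by (simp add: dist_real_def)
      show "dist (apply_bcontfun (T q) s) (apply_bcontfun (T p) s) \<le> (1 + \<kappa>) / 2 * dist q p"
        using that cl D unfolding T[OF that(1)] T[OF that(2)] dist_real_def by (intro F_lip) (auto simp: S)
    qed
  qed
  then obtain q where q: "q \<in> S" "T q = q" by blast
  define q' where "q' = apply_bcontfun q"
  have q': "continuous_on I01 q'" "\<And>s. s \<in> I01 \<Longrightarrow> \<bar>q' s\<bar> \<le> \<rho>" using q by (auto simp: S q'_def)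
  have fixp: "\<Psi> s (Y q' s) (Z q' s) = 0" if "s \<in> I01" for s
    using T[OF q(1), of s] cl(2)[OF that] q(2) by (simp add: F_def q'_def)
  show ?thesis
  proof (rule that)
    show "continuous_on I01 (Z q')" using contZ q' by auto
    show "Y q' 0 = \<eta>" by (simp add: Y_def)
    show "s \<in> I01 \<Longrightarrow> (Y q' has_real_derivative Z q' s) (at s within I01)" for s using Y' q' by auto
    show "s \<in> I01 \<Longrightarrow> \<bar>Y q' s - y\<^sub>0 s\<bar> \<le> r / 2" for s using Yb q' by auto
    show "s \<in> I01 \<Longrightarrow> \<bar>Z q' s - z\<^sub>0 s\<bar> \<le> r / 2" for s using Zb q' r by fastforce
  qed (rule fixp)
qed

section \<open>Solutions near a given one\<close>

text \<open>With named directions the derivative lists of bounded length form a finite set, so a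
  bound on all of them involves finitely many seminorms.\<close>

datatype axis = Ax1 | Ax2 | Ax3

fun axis_vec :: "axis \<Rightarrow> r3" where
  "axis_vec Ax1 = e\<^sub>1"
| "axis_vec Ax2 = e\<^sub>2"
| "axis_vec Ax3 = e\<^sub>3"

lemma axis_vec_lists: "map axis_vec ds \<in> lists Basis"
proof -
  have "axis_vec d \<in> Basis" for d by (cases d) (auto simp: Basis_r3)
  then show ?thesis by auto
qed

lemma finite_axis_lists: "finite {ds :: axis list. length ds \<le> M}"
proof -
  have "UNIV = {Ax1, Ax2, Ax3}" using axis.exhaust by auto
  moreover have "finite {Ax1, Ax2, Ax3}" by simp
  ultimately have "finite (UNIV :: axis set)" by metis
  from finite_lists_length_le[OF this, of M] show ?thesis by simp
qed

context rel_open
begin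

definition PP :: "axis list \<Rightarrow> (r3 \<Rightarrow> real) \<Rightarrow> r3 \<Rightarrow> real" where
  "PP ds = P (map axis_vec ds)"

lemma PP_Nil: "\<phi> \<in> C_infty_set \<Omega> \<Longrightarrow> PP [] \<phi> p = \<phi> p"
  by (simp add: PP_def partial_ext_Nil)

lemma PP_add: "\<phi> \<in> C_infty_set \<Omega> \<Longrightarrow> \<psi> \<in> C_infty_set \<Omega> \<Longrightarrow> PP ds (\<phi> + \<psi>) p = PP ds \<phi> p + PP ds \<psi> p"
  unfolding PP_def by (intro partial_ext_add axis_vec_lists)

lemma PP_scale: "\<phi> \<in> C_infty_set \<Omega> \<Longrightarrow> PP ds (c *\<^sub>R \<phi>) p = c * PP ds \<phi> p"
  unfolding PP_def by (intro partial_ext_scale axis_vec_lists)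

lemma PP_diff:
  assumes "\<phi> \<in> C_infty_set \<Omega>" "\<psi> \<in> C_infty_set \<Omega>"
  shows "PP ds (\<phi> - \<psi>) p = PP ds \<phi> p - PP ds \<psi> p"
  using PP_add[of "\<phi> - \<psi>" \<psi> ds p] assms subspace_diff[OF subspace_C_infty_set] by simp

lemma PP_zero: "PP ds 0 p = 0"
  using PP_scale[OF zero_in_C_infty_set, of ds 0 p] by (simp add: scaleR_fun_def zero_fun_def)

lemma continuous_on_PP: "\<phi> \<in> C_infty_set \<Omega> \<Longrightarrow> continuous_on \<Omega> (PP ds \<phi>)"
  unfolding PP_def by (intro continuous_on_partial_ext axis_vec_lists)

text \<open>The total derivative is taken within \<Omega>, so the curve may run in or end on the
  faces s = 0 and s = 1.\<close>

lemma PP_chain: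
  assumes \<phi>: "\<phi> \<in> C_infty_set \<Omega>"
    and c: "(c\<^sub>1 has_real_derivative c\<^sub>1') (at t within S)" "(c\<^sub>2 has_real_derivative c\<^sub>2') (at t within S)"
      "(c\<^sub>3 has_real_derivative c\<^sub>3') (at t within S)"
    and sub: "\<And>t. t \<in> S \<Longrightarrow> (c\<^sub>1 t, c\<^sub>2 t, c\<^sub>3 t) \<in> \<Omega>" and t: "t \<in> S"
  shows "((\<lambda>t. PP ds \<phi> (c\<^sub>1 t, c\<^sub>2 t, c\<^sub>3 t)) has_real_derivative
    (PP (ds @ [Ax1]) \<phi> (c\<^sub>1 t, c\<^sub>2 t, c\<^sub>3 t) * c\<^sub>1' + PP (ds @ [Ax2]) \<phi> (c\<^sub>1 t, c\<^sub>2 t, c\<^sub>3 t) * c\<^sub>2'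
      + PP (ds @ [Ax3]) \<phi> (c\<^sub>1 t, c\<^sub>2 t, c\<^sub>3 t) * c\<^sub>3')) (at t within S)"
proof -
  let ?c = "\<lambda>t. (c\<^sub>1 t, c\<^sub>2 t, c\<^sub>3 t)"
  have 1: "(?c has_derivative (\<lambda>h. (c\<^sub>1' * h, c\<^sub>2' * h, c\<^sub>3' * h))) (at t within S)"
    using c unfolding has_field_derivative_def by (intro has_derivative_Pair)
  have "(PP ds \<phi> has_derivative (\<lambda>(h\<^sub>1, h\<^sub>2, h\<^sub>3). PP (ds @ [Ax1]) \<phi> (?c t) * h\<^sub>1 +
      PP (ds @ [Ax2]) \<phi> (?c t) * h\<^sub>2 + PP (ds @ [Ax3]) \<phi> (?c t) * h\<^sub>3)) (at (?c t) within \<Omega>)"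
    using partial_ext_has_derivative[OF \<phi> axis_vec_lists sub[OF t], of ds] by (simp add: PP_def)
  then have 2: "(PP ds \<phi> has_derivative (\<lambda>(h\<^sub>1, h\<^sub>2, h\<^sub>3). PP (ds @ [Ax1]) \<phi> (?c t) * h\<^sub>1 +
      PP (ds @ [Ax2]) \<phi> (?c t) * h\<^sub>2 + PP (ds @ [Ax3]) \<phi> (?c t) * h\<^sub>3)) (at (?c t) within ?c ` S)"
    by (rule has_derivative_subset) (use sub in auto)
  show ?thesis
    unfolding has_field_derivative_def
    by (rule has_derivative_eq_rhs[OF has_derivative_in_compose[OF 1 2]]) (auto simp: fun_eq_iff algebra_simps)
qed

end

section \<open>Functions of class C^1 on the interval and tubes around their jets\<close>

lemma C_I_1_has_derivative:
  assumes "y \<in> C_I_set 1" "s \<in> I01"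
  shows "(y has_real_derivative deriv_I y s) (at s within I01)"
proof -
  have "y differentiable_on I01" using C_I_set_differentiable[OF assms(1), of 0]
    by (simp add: one_enat_def)
  then show ?thesis using assms(2)
    unfolding has_real_derivative_iff_has_vector_derivative deriv_I_def differentiable_on_def
    by (simp add: vector_derivative_works[symmetric])
qed

lemma C_I_1_continuous:
  assumes "y \<in> C_I_set 1"
  shows "continuous_on I01 y" "continuous_on I01 (deriv_I y)"
proof -
  have "\<forall>k. enat k < 1 + 1 \<longrightarrow> continuous_on I01 ((deriv_I ^^ k) y)" using assms by (simp add: C_I_set_def)
  from this[rule_format, of 0] this[rule_format, of 1]
  show "continuous_on I01 y" "continuous_on I01 (deriv_I y)" by (simp_all add: one_enat_def)
qed

lemma deriv_I_eqI: "(y has_real_derivative d) (at s within I01) \<Longrightarrow> s \<in> I01 \<Longrightarrow> deriv_I y s = d"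
  using vector_derivative_within_cbox[of 0 1 s y d]
  by (simp add: deriv_I_def has_real_derivative_iff_has_vector_derivative)

text \<open>The tube is closed, hence compact, so suprema over it are seminorms of
  \<open>C_infty \<Omega>\<close>. Solutions are compared only inside it.\<close>

locale tube = rel_open +
  fixes y\<^sub>0 :: "real \<Rightarrow> real" and r :: real
  assumes r: "r > 0" and y0: "y\<^sub>0 \<in> C_I_set 1"
    and K_subset': "{(s, a, b). s \<in> I01 \<and> \<bar>a - y\<^sub>0 s\<bar> \<le> r \<and> \<bar>b - deriv_I y\<^sub>0 s\<bar> \<le> r} \<subseteq> \<Omega>"
begin

definition K :: "r3 set" where
  "K = {(s, a, b). s \<in> I01 \<and> \<bar>a - y\<^sub>0 s\<bar> \<le> r \<and> \<bar>b - deriv_I y\<^sub>0 s\<bar> \<le> r}"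

text \<open>The bound is some \<open>e < r\<close>, so this is an open ball in C^1, and it leaves
  the margin to the boundary of the tube on which \<open>zS_has_derivative\<close> relies.\<close>

definition near :: "(real \<Rightarrow> real) \<Rightarrow> bool" where
  "near y \<longleftrightarrow> (\<exists>e<r. \<forall>s\<in>I01. \<bar>y s - y\<^sub>0 s\<bar> \<le> e \<and> \<bar>deriv_I y s - deriv_I y\<^sub>0 s\<bar> \<le> e)"

lemma K_subset: "K \<subseteq> \<Omega>"
  using K_subset' by (simp add: K_def)

abbreviation "E \<equiv> topspace (param_space \<Omega>)"

lemma E_iff: "x \<in> E \<longleftrightarrow> snd x \<in> C_infty_set \<Omega>"
  by (cases x) (simp add: param_space_def C_infty_def)

lemma subspace_E: "subspace E"
  unfolding subspace_def
  by (intro conjI ballI allI; unfold E_iff)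
    (simp_all add: subspace_0 subspace_add subspace_scale subspace_C_infty_set)

lemma near_in_K: "near y \<Longrightarrow> s \<in> I01 \<Longrightarrow> (s, y s, deriv_I y s) \<in> K"
  unfolding near_def K_def by fastforce

lemma compact_K: "compact K"
proof -
  have "K = (\<lambda>(s, u, v). (s, y\<^sub>0 s + u, deriv_I y\<^sub>0 s + v)) ` (I01 \<times> {-r..r} \<times> {-r..r})" (is "_ = ?f ` ?B")
  proof (intro set_eqI iffI)
    fix p assume "p \<in> K"
    then obtain s a b where p: "p = (s, a, b)" "s \<in> I01" "\<bar>a - y\<^sub>0 s\<bar> \<le> r" "\<bar>b - deriv_I y\<^sub>0 s\<bar> \<le> r"
      by (auto simp: K_def)
    show "p \<in> ?f ` ?B"
      by (rule image_eqI[of _ _ "(s, a - y\<^sub>0 s, b - deriv_I y\<^sub>0 s)"]) (use p in auto)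
  qed (auto simp: K_def)
  moreover have "continuous_on ?B ?f"
    unfolding case_prod_unfold
    by (intro continuous_intros continuous_on_compose2[OF C_I_1_continuous(1)[OF y0]]
        continuous_on_compose2[OF C_I_1_continuous(2)[OF y0]]) auto
  moreover have "compact ?B" by (intro compact_Times) auto
  ultimately show ?thesis using compact_continuous_image[of ?B ?f] by simp
qed

text \<open>The tube need not be convex, as its axis bends with s; but each fibre over a fixed s is
  a square. All comparisons of points therefore take place in one fibre.\<close>

lemma K_fibre_convex:
  assumes "(s, a, b) \<in> K" "(s, a', b') \<in> K" "0 \<le> t" "t \<le> 1"
  shows "(s, a + t * (a' - a), b + t * (b' - b)) \<in> K"
proof -
  have *: "\<bar>u + t * (u' - u) - w\<bar> \<le> r" if "\<bar>u - w\<bar> \<le> r" "\<bar>u' - w\<bar> \<le> r" for u u' w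
  proof -
    have "\<bar>u + t * (u' - u) - w\<bar> = \<bar>(1 - t) * (u - w) + t * (u' - w)\<bar>" by (simp add: algebra_simps)
    also have "\<dots> \<le> (1 - t) * \<bar>u - w\<bar> + t * \<bar>u' - w\<bar>"
      using assms by (intro order_trans[OF abs_triangle_ineq]) (simp add: abs_mult)
    also have "\<dots> \<le> (1 - t) * r + t * r" using assms that by (intro add_mono mult_left_mono) auto
    finally show ?thesis by (simp add: algebra_simps)
  qed
  then show ?thesis using assms(1,2) by (auto simp: K_def)
qed

text \<open>The mean value theorem along the segment joining the two points, so that both partial
  derivatives are taken at the same intermediate point.\<close>

lemma PP_fibre_mvt:
  assumes \<phi>: "\<phi> \<in> C_infty_set \<Omega>" and p: "(s, a, b) \<in> K" "(s, a', b') \<in> K"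
  obtains t where "0 \<le> t" "t \<le> 1" "(s, a + t * (a' - a), b + t * (b' - b)) \<in> K"
    "PP ds \<phi> (s, a', b') - PP ds \<phi> (s, a, b) =
      PP (ds @ [Ax2]) \<phi> (s, a + t * (a' - a), b + t * (b' - b)) * (a' - a)
      + PP (ds @ [Ax3]) \<phi> (s, a + t * (a' - a), b + t * (b' - b)) * (b' - b)"
proof -
  let ?q = "\<lambda>t. (s, a + t * (a' - a), b + t * (b' - b))"
  have "((\<lambda>t. PP ds \<phi> (?q t)) has_real_derivative
      PP (ds @ [Ax1]) \<phi> (?q t) * 0 + PP (ds @ [Ax2]) \<phi> (?q t) * (a' - a) + PP (ds @ [Ax3]) \<phi> (?q t) * (b' - b))
      (at t within {0..1})" if "t \<in> {0..1}" for t
    by (rule PP_chain[OF \<phi>])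
      (use that K_fibre_convex[OF p] K_subset in \<open>auto intro!: derivative_eq_intros\<close>)
  then have "\<exists>t\<in>{0<..<1}. PP ds \<phi> (?q 1) - PP ds \<phi> (?q 0) =
      (PP (ds @ [Ax1]) \<phi> (?q t) * 0 + PP (ds @ [Ax2]) \<phi> (?q t) * (a' - a) + PP (ds @ [Ax3]) \<phi> (?q t) * (b' - b)) * (1 - 0)"
    unfolding has_field_derivative_def by (intro mvt_simple) auto
  then obtain t where "0 < t" "t < 1" "PP ds \<phi> (?q 1) - PP ds \<phi> (?q 0) =
      PP (ds @ [Ax2]) \<phi> (?q t) * (a' - a) + PP (ds @ [Ax3]) \<phi> (?q t) * (b' - b)" by auto
  then show ?thesis using that[of t] K_fibre_convex[OF p, of t] by auto
qed

text \<open>The seminorms, graded by the order of differentiation, through which all estimates run;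
  a predicate takes the place of the suprema.\<close>

definition bnd :: "nat \<Rightarrow> real \<Rightarrow> real \<times> (r3 \<Rightarrow> real) \<Rightarrow> bool" where
  "bnd M B x \<longleftrightarrow> \<bar>fst x\<bar> \<le> B \<and> (\<forall>ds. length ds \<le> M \<longrightarrow> (\<forall>p\<in>K. \<bar>PP ds (snd x) p\<bar> \<le> B))"

lemma bnd_nonneg: "bnd M B x \<Longrightarrow> 0 \<le> B"
  unfolding bnd_def by linarith

lemma bnd_mono: "bnd M B x \<Longrightarrow> M' \<le> M \<Longrightarrow> B \<le> B' \<Longrightarrow> bnd M' B' x"
  unfolding bnd_def by (meson order_trans)

lemma bnd_scale: "bnd M B x \<Longrightarrow> x \<in> E \<Longrightarrow> bnd M (\<bar>t\<bar> * B) (t *\<^sub>R x)"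
  unfolding bnd_def E_iff by (auto simp: abs_mult PP_scale intro!: mult_left_mono)

lemma bnd_add: "bnd M B x \<Longrightarrow> bnd M B' x' \<Longrightarrow> x \<in> E \<Longrightarrow> x' \<in> E \<Longrightarrow> bnd M (B + B') (x + x')"
  unfolding bnd_def E_iff by (auto simp: PP_add intro!: order_trans[OF abs_triangle_ineq] add_mono)

lemma bnd_zero: "0 \<le> B \<Longrightarrow> bnd M B 0"
  unfolding bnd_def by (simp add: PP_zero)

lemma bnd_exists: "x \<in> E \<Longrightarrow> \<exists>B. bnd M B x"
proof -
  assume x: "x \<in> E"
  obtain B where B: "C_infty.le_on (map axis_vec ` {ds. length ds \<le> M} \<times> {K}) B (snd x)"
    using C_infty.le_on_bounded[of "map axis_vec ` {ds. length ds \<le> M} \<times> {K}" "snd x"]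
      finite_axis_lists axis_vec_lists compact_K K_subset x E_iff by blast
  have "bnd M (max B \<bar>fst x\<bar>) x"
    using B unfolding bnd_def C_infty.le_on_def PP_def by fastforce
  then show ?thesis by blast
qed

lemma PP_fibre_lipschitz:
  assumes x: "x \<in> E" "bnd (Suc (length ds)) B x" and p: "(s, a, b) \<in> K" "(s, a', b') \<in> K"
  shows "\<bar>PP ds (snd x) (s, a', b') - PP ds (snd x) (s, a, b)\<bar> \<le> B * (\<bar>a' - a\<bar> + \<bar>b' - b\<bar>)"
proof -
  have \<phi>: "snd x \<in> C_infty_set \<Omega>" using x E_iff by blast
  obtain q where t: "q \<in> K"
    "PP ds (snd x) (s, a', b') - PP ds (snd x) (s, a, b) =
      PP (ds @ [Ax2]) (snd x) q * (a' - a) + PP (ds @ [Ax3]) (snd x) q * (b' - b)"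
    using PP_fibre_mvt[OF \<phi> p] by metis
  have "\<bar>PP (ds @ [Ax2]) (snd x) q * (a' - a)\<bar> \<le> B * \<bar>a' - a\<bar>"
    "\<bar>PP (ds @ [Ax3]) (snd x) q * (b' - b)\<bar> \<le> B * \<bar>b' - b\<bar>"
    using x t(1) unfolding abs_mult bnd_def by (auto intro!: mult_right_mono)
  then show ?thesis unfolding t(2) distrib_left by linarith
qed

lemma openin_bnd_ball:
  assumes v: "v \<in> E"
  shows "openin (param_space \<Omega>) {w \<in> E. \<exists>d'<d. bnd M d' (w - v)}"
proof -
  let ?A = "map axis_vec ` {ds. length ds \<le> M} \<times> {K}"
  have A: "finite ?A" "?A \<subseteq> lists Basis \<times> {K. compact K \<and> K \<subseteq> \<Omega>}"
    using finite_axis_lists axis_vec_lists compact_K K_subset by auto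
  have bnd_iff: "bnd M d' w \<longleftrightarrow> \<bar>fst w\<bar> \<le> d' \<and> C_infty.le_on ?A d' (snd w)" for d' w
    unfolding bnd_def C_infty.le_on_def PP_def by auto
  have "w \<in> {w \<in> E. \<exists>d'<d. bnd M d' (w - v)} \<longleftrightarrow> w \<in> ball (fst v) d \<times> C_infty.oball ?A d (snd v)" for w
  proof
    assume "w \<in> {w \<in> E. \<exists>d'<d. bnd M d' (w - v)}"
    then show "w \<in> ball (fst v) d \<times> C_infty.oball ?A d (snd v)"
      unfolding bnd_iff C_infty.oball_def E_iff by (auto simp: mem_Times_iff dist_real_def abs_minus_commute)
  next
    assume "w \<in> ball (fst v) d \<times> C_infty.oball ?A d (snd v)"
    then obtain d' where w: "snd w \<in> C_infty_set \<Omega>" "\<bar>fst w - fst v\<bar> < d" "d' < d" "C_infty.le_on ?A d' (snd w - snd v)"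
      unfolding C_infty.oball_def by (auto simp: mem_Times_iff dist_real_def abs_minus_commute)
    then have "bnd M (max d' \<bar>fst w - fst v\<bar>) (w - v)"
      unfolding bnd_iff by (auto intro: C_infty.le_on_mono)
    then show "w \<in> {w \<in> E. \<exists>d'<d. bnd M d' (w - v)}"
      using w E_iff[of w] by (auto intro!: exI[of _ "max d' \<bar>fst w - fst v\<bar>"])
  qed
  then have "{w \<in> E. \<exists>d'<d. bnd M d' (w - v)} = ball (fst v) d \<times> C_infty.oball ?A d (snd v)" by blast
  moreover have "openin (C_infty \<Omega>) (C_infty.oball ?A d (snd v))"
    using v E_iff by (intro C_infty.openin_oball A) blast
  ultimately show ?thesis unfolding param_space_def by (simp add: openin_prod_Times_iff)
qed

end

text \<open>The interface between the analysis near a regular solution, which supplies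
  \<open>N\<close>, \<open>A\<close> and \<open>c\<close>, and the smoothness proof.
  \<open>monotone\<close> is a quantitative injectivity in the third variable: it controls the slope
  by the position and the value of \<phi>.\<close>

locale solution_chart = tube +
  fixes N :: "(real \<times> (r3 \<Rightarrow> real)) set" and A c :: real
  assumes openin_N: "openin (param_space \<Omega>) N"
    and solvable: "\<And>x. x \<in> N \<Longrightarrow> \<exists>y. near y \<and> (x, y) \<in> solutions \<Omega>"
    and A: "A \<ge> 0" and c: "c > 0"
    and monotone: "\<And>x s a b a' b'. x \<in> N \<Longrightarrow> (s, a, b) \<in> K \<Longrightarrow> (s, a', b') \<in> K \<Longrightarrow>
      \<bar>b - b'\<bar> \<le> A * (\<bar>a - a'\<bar> + \<bar>snd x (s, a, b) - snd x (s, a', b')\<bar>)"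
    and p3_PP: "\<And>x p. x \<in> N \<Longrightarrow> p \<in> K \<Longrightarrow> c \<le> \<bar>PP [Ax3] (snd x) p\<bar>"
begin

lemma N_subset: "N \<subseteq> E"
  using openin_subset[OF openin_N] .

lemma N_snd: "x \<in> N \<Longrightarrow> snd x \<in> C_infty_set \<Omega>"
  using N_subset E_iff by blast

definition chart :: "((real \<times> (r3 \<Rightarrow> real)) \<times> (real \<Rightarrow> real)) set" where
  "chart = {(x, y). x \<in> N \<and> near y \<and> (x, y) \<in> solutions \<Omega>}"

text \<open>By monotonicity in the third variable, the difference of two solutions satisfies a linear
  differential inequality.\<close>

lemma solution_difference:
  assumes "(x, y) \<in> chart" "(x', y') \<in> chart" and d: "\<bar>fst x - fst x'\<bar> \<le> d"
    "\<And>p. p \<in> K \<Longrightarrow> \<bar>snd x p - snd x' p\<bar> \<le> d" and s: "s \<in> I01"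
  shows "\<bar>y s - y' s\<bar> \<le> 2 * exp (2 * A + 1) * (A + 1) * d"
    and "\<bar>deriv_I y s - deriv_I y' s\<bar> \<le> A * (2 * exp (2 * A + 1) * (A + 1) * d + d)"
proof -
  have y: "x \<in> N" "near y" "y \<in> C_I_set 1" "y 0 = fst x" "\<And>s. s \<in> I01 \<Longrightarrow> snd x (s, y s, deriv_I y s) = 0"
    using assms(1) by (auto simp: chart_def solutions_def)
  have y': "near y'" "y' \<in> C_I_set 1" "y' 0 = fst x'" "\<And>s. s \<in> I01 \<Longrightarrow> snd x' (s, y' s, deriv_I y' s) = 0"
    using assms(2) by (auto simp: chart_def solutions_def)
  have d0: "d \<ge> 0" using d(1) by linarith
  have le: "\<bar>deriv_I y s - deriv_I y' s\<bar> \<le> A * (\<bar>y s - y' s\<bar> + d)" if s: "s \<in> I01" for s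
  proof -
    have "\<bar>deriv_I y s - deriv_I y' s\<bar> \<le>
        A * (\<bar>y s - y' s\<bar> + \<bar>snd x (s, y s, deriv_I y s) - snd x (s, y' s, deriv_I y' s)\<bar>)"
      using near_in_K y y' s by (intro monotone) auto
    also have "\<bar>snd x (s, y s, deriv_I y s) - snd x (s, y' s, deriv_I y' s)\<bar> \<le> d"
      using d(2)[OF near_in_K[OF y'(1) s]] y(5)[OF s] y'(4)[OF s] by simp
    finally show ?thesis using A by (simp add: mult_left_mono)
  qed
  \<comment> \<open>\<open>gronwall_I01\<close> has one constant for the inhomogeneity, here
    \<open>A * d\<close>, and for the initial difference, here at most \<open>d\<close>;
    \<open>(A + 1) * d\<close> dominates both.\<close>
  have "\<bar>y s - y' s\<bar> \<le> 2 * exp (2 * A + 1) * ((A + 1) * d)"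
  proof (rule gronwall_I01[of "\<lambda>s. y s - y' s" "\<lambda>s. deriv_I y s - deriv_I y' s"])
    fix s assume s: "s \<in> I01"
    show "((\<lambda>s. y s - y' s) has_real_derivative deriv_I y s - deriv_I y' s) (at s within I01)"
      using y y' s by (intro derivative_intros C_I_1_has_derivative)
    show "\<bar>deriv_I y s - deriv_I y' s\<bar> \<le> A * \<bar>y s - y' s\<bar> + (A + 1) * d"
      using le[OF s] d0 by (simp add: algebra_simps)
  next
    have "0 \<le> A * d" using A d0 by simp
    then show "\<bar>y 0 - y' 0\<bar> \<le> (A + 1) * d" using y y' d by (simp add: distrib_right)
  qed (use A s in auto)
  then show *: "\<bar>y s - y' s\<bar> \<le> 2 * exp (2 * A + 1) * (A + 1) * d" by (simp add: mult.assoc)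
  show "\<bar>deriv_I y s - deriv_I y' s\<bar> \<le> A * (2 * exp (2 * A + 1) * (A + 1) * d + d)"
    using le[OF s] * A by (meson add_right_mono mult_left_mono order_trans)
qed

lemma chart_unique: "(x, y) \<in> chart \<Longrightarrow> (x, y') \<in> chart \<Longrightarrow> y = y'"
proof
  fix s assume *: "(x, y) \<in> chart" "(x, y') \<in> chart"
  show "y s = y' s"
  proof (cases "s \<in> I01")
    case True
    then show ?thesis using solution_difference(1)[OF *, of 0 s] by simp
  next
    case False
    then show ?thesis using * by (auto simp: chart_def solutions_def C_I_set_def)
  qed
qed

definition yS :: "real \<times> (r3 \<Rightarrow> real) \<Rightarrow> real \<Rightarrow> real" where "yS x = app chart x"

abbreviation zS :: "real \<times> (r3 \<Rightarrow> real) \<Rightarrow> real \<Rightarrow> real" where "zS x \<equiv> deriv_I (yS x)"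

lemma yS_chart: "x \<in> N \<Longrightarrow> (x, yS x) \<in> chart"
proof -
  assume "x \<in> N"
  then obtain y where "(x, y) \<in> chart" using solvable[OF \<open>x \<in> N\<close>] by (auto simp: chart_def)
  then show ?thesis unfolding yS_def app_def using chart_unique by (metis theI')
qed

lemma chart_iff: "(x, y) \<in> chart \<longleftrightarrow> x \<in> N \<and> y = yS x"
  using yS_chart[of x] chart_unique[of x y "yS x"] by (auto simp: chart_def)

lemma
  assumes "x \<in> N"
  shows near_yS: "near (yS x)" and yS_0: "yS x 0 = fst x" and yS_C_I_1: "yS x \<in> C_I_set 1"
    and yS_eq: "s \<in> I01 \<Longrightarrow> snd x (s, yS x s, zS x s) = 0"
    and yS_in_K: "s \<in> I01 \<Longrightarrow> (s, yS x s, zS x s) \<in> K"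
  using yS_chart[OF assms] near_in_K[of "yS x" s] by (auto simp: chart_def solutions_def)

lemma yS_has_derivative: "x \<in> N \<Longrightarrow> s \<in> I01 \<Longrightarrow> (yS x has_real_derivative zS x s) (at s within I01)"
  using C_I_1_has_derivative yS_C_I_1 by blast

lemma in_Omega: "x \<in> N \<Longrightarrow> s \<in> I01 \<Longrightarrow> (s, yS x s, zS x s) \<in> \<Omega>"
  using yS_in_K K_subset by blast

text \<open>Comparing \<open>\<phi>(s', y s', y' s') = 0\<close> with
  \<open>\<phi>(s', y s', y' s)\<close> by the mean value theorem in the third variable expresses the difference
  quotient of \<open>y'\<close> at \<open>s\<close> by that of the differentiable function \<open>s' \<mapsto> \<phi>(s', y s', y' s)\<close>.\<close>

lemma zS_has_derivative:
  assumes x: "x \<in> N" and s: "s \<in> I01"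
  shows "(zS x has_real_derivative
    - (PP [Ax1] (snd x) (s, yS x s, zS x s) + PP [Ax2] (snd x) (s, yS x s, zS x s) * zS x s)
      / PP [Ax3] (snd x) (s, yS x s, zS x s)) (at s within I01)"
proof -
  define \<phi> where "\<phi> = snd x"
  define y where "y = yS x"
  define z where "z = zS x"
  have \<phi>: "\<phi> \<in> C_infty_set \<Omega>" using N_snd[OF x] by (simp add: \<phi>_def)
  have y': "(y has_real_derivative z s) (at s within I01)" if "s \<in> I01" for s
    using yS_has_derivative[OF x that] by (simp add: y_def z_def)
  have cont: "continuous_on I01 y" "continuous_on I01 z"
    using C_I_1_continuous[OF yS_C_I_1[OF x]] by (simp_all add: y_def z_def)
  have K: "(s, y s, z s) \<in> K" if "s \<in> I01" for s using yS_in_K[OF x that] by (simp add: y_def z_def)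
  have z0: "continuous_on I01 (deriv_I y\<^sub>0)" using C_I_1_continuous(2)[OF y0] .
  obtain e where e: "e < r" "\<And>s. s \<in> I01 \<Longrightarrow> \<bar>z s - deriv_I y\<^sub>0 s\<bar> \<le> e"
    using near_yS[OF x] by (auto simp: near_def z_def)
  \<comment> \<open>For s' near s the mixed point \<open>(s', y s', z s)\<close> stays in
    \<open>K\<close>: the margin \<open>r - e\<close> absorbs the variation of
    \<open>deriv_I y\<^sub>0\<close>.\<close>
  obtain \<delta> where \<delta>: "\<delta> > 0" "\<And>s'. s' \<in> I01 \<Longrightarrow> \<bar>s' - s\<bar> < \<delta> \<Longrightarrow> \<bar>deriv_I y\<^sub>0 s' - deriv_I y\<^sub>0 s\<bar> < r - e"
    using z0 s e(1) unfolding continuous_on_iff dist_real_def by (metis diff_gt_0_iff_gt)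
  define S where "S = I01 \<inter> ball s \<delta>"
  have S: "s' \<in> S \<longleftrightarrow> s' \<in> I01 \<and> \<bar>s' - s\<bar> < \<delta>" for s' by (auto simp: S_def dist_real_def)
  have sS: "s \<in> S" using s \<delta> by (simp add: S)
  have at_S: "at s within S = at s within I01"
    by (rule at_within_nhd[of _ "ball s \<delta>"]) (use \<delta> in \<open>auto simp: S_def\<close>)
  have K': "(s', y s', z s) \<in> K" if "s' \<in> S" for s'
  proof -
    have "\<bar>z s - deriv_I y\<^sub>0 s'\<bar> \<le> r" using e(2)[OF s] \<delta>(2)[of s'] that by (simp add: S)
    then show ?thesis using K[of s'] that by (auto simp: K_def S)
  qed
  define g where "g s' = PP [] \<phi> (s', y s', z s)" for s'
  define g' where "g' = PP [Ax1] \<phi> (s, y s, z s) + PP [Ax2] \<phi> (s, y s, z s) * z s"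
  have "(g has_real_derivative PP ([] @ [Ax1]) \<phi> (s, y s, z s) * 1 + PP ([] @ [Ax2]) \<phi> (s, y s, z s) * z s
      + PP ([] @ [Ax3]) \<phi> (s, y s, z s) * 0) (at s within S)"
    unfolding g_def
    by (rule PP_chain[OF \<phi>]) (use K' K_subset sS y'[OF s] at_S in \<open>auto intro!: derivative_eq_intros\<close>)
  then have g: "((\<lambda>s'. (g s' - g s) / (s' - s)) \<longlongrightarrow> g') (at s within S)"
    by (simp add: has_field_derivative_iff g'_def)
  have g_s: "g s = 0" using yS_eq[OF x s] \<phi> by (simp add: g_def PP_Nil y_def z_def \<phi>_def)
  \<comment> \<open>The intermediate value b is no farther from \<open>z s\<close> than
    \<open>z s'\<close> is. Continuity of z, all that is known so far, therefore squeezes b to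
    \<open>z s\<close>.\<close>
  have "\<exists>b. (s', y s', b) \<in> K \<and> \<bar>b - z s\<bar> \<le> \<bar>z s' - z s\<bar> \<and> - g s' = PP [Ax3] \<phi> (s', y s', b) * (z s' - z s)"
    if s': "s' \<in> S" for s'
  proof -
    have "s' \<in> I01" using s' by (simp add: S)
    obtain t where t: "0 \<le> t" "t \<le> 1" "(s', y s' + t * (y s' - y s'), z s + t * (z s' - z s)) \<in> K"
      "PP [] \<phi> (s', y s', z s') - PP [] \<phi> (s', y s', z s) =
        PP ([] @ [Ax2]) \<phi> (s', y s' + t * (y s' - y s'), z s + t * (z s' - z s)) * (y s' - y s')
        + PP ([] @ [Ax3]) \<phi> (s', y s' + t * (y s' - y s'), z s + t * (z s' - z s)) * (z s' - z s)"
      by (rule PP_fibre_mvt[OF \<phi> K'[OF s'] K[OF \<open>s' \<in> I01\<close>]])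
    moreover have "PP [] \<phi> (s', y s', z s') = 0"
      using yS_eq[OF x \<open>s' \<in> I01\<close>] \<phi> by (simp add: PP_Nil y_def z_def \<phi>_def)
    moreover have "t * \<bar>z s' - z s\<bar> \<le> 1 * \<bar>z s' - z s\<bar>" using t by (intro mult_right_mono) auto
    ultimately show ?thesis
      by (intro exI[of _ "z s + t * (z s' - z s)"]) (auto simp: g_def abs_mult)
  qed
  then obtain b where b: "\<And>s'. s' \<in> S \<Longrightarrow> (s', y s', b s') \<in> K"
    "\<And>s'. s' \<in> S \<Longrightarrow> \<bar>b s' - z s\<bar> \<le> \<bar>z s' - z s\<bar>"
    "\<And>s'. s' \<in> S \<Longrightarrow> - g s' = PP [Ax3] \<phi> (s', y s', b s') * (z s' - z s)" by metis
  have inS: "\<forall>\<^sub>F s' in at s within S. s' \<in> S" by (simp add: eventually_at_filter)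
  have ne: "\<forall>\<^sub>F s' in at s within S. s' \<noteq> s" by (simp add: eventually_at_filter)
  have z_lim: "(z \<longlongrightarrow> z s) (at s within S)" and y_lim: "(y \<longlongrightarrow> y s) (at s within S)"
    using cont s at_S by (auto simp: continuous_on_def)
  have "((\<lambda>s'. \<bar>z s' - z s\<bar>) \<longlongrightarrow> 0) (at s within S)"
    using tendsto_rabs[OF tendsto_diff[OF z_lim tendsto_const[of "z s"]]] by simp
  then have "((\<lambda>s'. b s' - z s) \<longlongrightarrow> 0) (at s within S)"
    by (rule Lim_null_comparison[rotated]) (use b inS in \<open>auto elim: eventually_mono\<close>)
  then have b_lim: "(b \<longlongrightarrow> z s) (at s within S)" by (simp add: LIM_zero_iff)
  have ev: "\<forall>\<^sub>F s' in at s within S. (s', y s', b s') \<in> \<Omega>"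
    using inS by eventually_elim (use b(1) K_subset in blast)
  have "((\<lambda>s'. PP [Ax3] \<phi> (s', y s', b s')) \<longlongrightarrow> PP [Ax3] \<phi> (s, y s, z s)) (at s within S)"
    by (rule continuous_on_tendsto_compose[OF continuous_on_PP[OF \<phi>]])
      (use y_lim b_lim K[OF s] K_subset ev in \<open>auto intro!: tendsto_intros\<close>)
  moreover have p3: "PP [Ax3] \<phi> p \<noteq> 0" if "p \<in> K" for p
    using p3_PP[OF x that] c by (auto simp: \<phi>_def)
  ultimately have "((\<lambda>s'. - ((g s' - g s) / (s' - s)) / PP [Ax3] \<phi> (s', y s', b s')) \<longlongrightarrow>
      - g' / PP [Ax3] \<phi> (s, y s, z s)) (at s within S)"
    using K[OF s] by (intro tendsto_divide tendsto_minus g) auto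
  moreover have "\<forall>\<^sub>F s' in at s within S.
      - ((g s' - g s) / (s' - s)) / PP [Ax3] \<phi> (s', y s', b s') = (z s' - z s) / (s' - s)"
    using inS ne
  proof eventually_elim
    case (elim s')
    then show ?case using b(3)[of s'] p3[OF b(1)[of s']] g_s by (simp add: field_simps)
  qed
  ultimately have "((\<lambda>s'. (z s' - z s) / (s' - s)) \<longlongrightarrow> - g' / PP [Ax3] \<phi> (s, y s, z s)) (at s within S)"
    by (rule Lim_transform_eventually)
  then show ?thesis
    unfolding has_field_derivative_iff at_S by (simp add: g'_def \<phi>_def y_def z_def)
qed

end

section \<open>Symbolic derivatives of the solution\<close>

text \<open>Symbolic expressions for the functions on \<open>I\<close> that occur as iterated derivatives of the
  solution. In an environment \<open>e\<close>, slot \<open>0\<close> holds the parameter \<open>(\<eta>, \<phi>)\<close> and the other slots hold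
  directions; \<open>Pd ds i\<close> is the partial derivative \<open>ds\<close> of the function in slot \<open>i\<close>, evaluated along
  the solution \<open>y\<close> of the parameter, \<open>Zt\<close> is \<open>y'\<close>, and \<open>Inv\<close> is \<open>1 / p\<^sub>3\<close>. \<open>Ds\<close> differentiates
  in \<open>s\<close>, and \<open>Dk k\<close> in the parameter, in the direction in slot \<open>k\<close>.\<close>

datatype tm = Const real | Eta nat | Pd "axis list" nat | Zt | Inv
  | Add tm tm | Mul tm tm | Prim tm | Expo tm

abbreviation "Neg a \<equiv> Mul (Const (-1)) a"

definition "ZZ = Neg (Mul (Add (Pd [Ax1] 0) (Mul (Pd [Ax2] 0) Zt)) Inv)"

definition "dsP ds i = Add (Pd (ds @ [Ax1]) i) (Add (Mul (Pd (ds @ [Ax2]) i) Zt) (Mul (Pd (ds @ [Ax3]) i) ZZ))"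

primrec Ds :: "tm \<Rightarrow> tm" where
  "Ds (Const c) = Const 0"
| "Ds (Eta i) = Const 0"
| "Ds (Pd ds i) = dsP ds i"
| "Ds Zt = ZZ"
| "Ds Inv = Neg (Mul (Mul Inv Inv) (dsP [Ax3] 0))"
| "Ds (Add a b) = Add (Ds a) (Ds b)"
| "Ds (Mul a b) = Add (Mul (Ds a) b) (Mul a (Ds b))"
| "Ds (Prim a) = a"
| "Ds (Expo a) = Mul (Expo a) (Ds a)"

text \<open>The derivative \<open>U k\<close> of the solution in the direction \<open>(h, \<psi>)\<close> of slot \<open>k\<close> solves
  \<open>p\<^sub>3 u' + p\<^sub>2 u = - \<psi>(s, y, y')\<close>, \<open>u(0) = h\<close>, and is given by variation of constants.\<close>

definition "LinA = Prim (Mul (Pd [Ax2] 0) Inv)"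

definition "U k = Mul (Expo (Neg LinA)) (Add (Eta k) (Prim (Mul (Expo LinA) (Neg (Mul (Pd [] k) Inv)))))"

definition "U' k = Neg (Mul (Add (Pd [] k) (Mul (Pd [Ax2] 0) (U k))) Inv)"

text \<open>In slot 0 the function itself moves, from \<phi> to \<open>\<phi> + t \<psi>\<close>,
  which contributes \<open>Pd ds k\<close>. In every slot the point of evaluation moves with the
  solution, at the rates \<open>U k\<close> and \<open>U' k\<close>.\<close>

definition "dkP k ds i = Add (if i = 0 then Pd ds k else Const 0)
  (Add (Mul (Pd (ds @ [Ax2]) i) (U k)) (Mul (Pd (ds @ [Ax3]) i) (U' k)))"

primrec Dk :: "nat \<Rightarrow> tm \<Rightarrow> tm" where
  "Dk k (Const c) = Const 0"
| "Dk k (Eta i) = (if i = 0 then Eta k else Const 0)"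
| "Dk k (Pd ds i) = dkP k ds i"
| "Dk k Zt = U' k"
| "Dk k Inv = Neg (Mul (Mul Inv Inv) (dkP k [Ax3] 0))"
| "Dk k (Add a b) = Add (Dk k a) (Dk k b)"
| "Dk k (Mul a b) = Add (Mul (Dk k a) b) (Mul a (Dk k b))"
| "Dk k (Prim a) = Prim (Dk k a)"
| "Dk k (Expo a) = Mul (Expo a) (Dk k a)"

primrec fresh :: "nat \<Rightarrow> tm \<Rightarrow> bool" where
  "fresh k (Const c) \<longleftrightarrow> True"
| "fresh k (Eta i) \<longleftrightarrow> i \<noteq> k"
| "fresh k (Pd ds i) \<longleftrightarrow> i \<noteq> k"
| "fresh k Zt \<longleftrightarrow> True"
| "fresh k Inv \<longleftrightarrow> True"
| "fresh k (Add a b) \<longleftrightarrow> fresh k a \<and> fresh k b"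
| "fresh k (Mul a b) \<longleftrightarrow> fresh k a \<and> fresh k b"
| "fresh k (Prim a) \<longleftrightarrow> fresh k a"
| "fresh k (Expo a) \<longleftrightarrow> fresh k a"

text \<open>A syntactic condition sufficient for linear dependence on slot k. \<open>Const 0\<close>
  qualifies because \<open>Dk\<close> produces it.\<close>

primrec lin :: "nat \<Rightarrow> tm \<Rightarrow> bool" where
  "lin k (Const c) \<longleftrightarrow> c = 0"
| "lin k (Eta i) \<longleftrightarrow> i = k"
| "lin k (Pd ds i) \<longleftrightarrow> i = k"
| "lin k Zt \<longleftrightarrow> False"
| "lin k Inv \<longleftrightarrow> False"
| "lin k (Add a b) \<longleftrightarrow> lin k a \<and> lin k b"
| "lin k (Mul a b) \<longleftrightarrow> lin k a \<and> fresh k b \<or> fresh k a \<and> lin k b"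
| "lin k (Prim a) \<longleftrightarrow> lin k a"
| "lin k (Expo a) \<longleftrightarrow> False"

lemmas tm_defs = ZZ_def dsP_def LinA_def U_def U'_def dkP_def

lemma fresh_Dk: "fresh k a \<Longrightarrow> k \<noteq> j \<Longrightarrow> k \<noteq> 0 \<Longrightarrow> fresh k (Dk j a)"
  by (induction a) (auto simp: tm_defs)

text \<open>Each basic rule of \<open>Dk k\<close> yields 0 or brings in slot k linearly, and by the
  Leibniz rule every resulting summand has one factor differentiated and all others still free of
  k.\<close>

lemma lin_Dk_new: "fresh k a \<Longrightarrow> k \<noteq> 0 \<Longrightarrow> lin k (Dk k a)"
  by (induction a) (auto simp: tm_defs)

lemma lin_Dk: "lin k a \<Longrightarrow> k \<noteq> j \<Longrightarrow> k \<noteq> 0 \<Longrightarrow> lin k (Dk j a)"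
  by (induction a) (auto simp: tm_defs fresh_Dk)

lemma has_real_derivative_of_quadratic_bound:
  fixes f :: "real \<Rightarrow> real"
  assumes "\<delta> > 0" "\<And>t. \<bar>t\<bar> < \<delta> \<Longrightarrow> \<bar>f t - f 0 - t * D\<bar> \<le> C * t\<^sup>2"
  shows "(f has_real_derivative D) (at 0)"
proof -
  have "((\<lambda>h. (f h - f 0) / h - D) \<longlongrightarrow> 0) (at 0)"
  proof (rule Lim_null_comparison)
    show "((\<lambda>h. C * \<bar>h\<bar>) \<longlongrightarrow> 0) (at (0::real))" by (auto intro!: tendsto_eq_intros)
    show "\<forall>\<^sub>F h in at 0. norm ((f h - f 0) / h - D) \<le> C * \<bar>h\<bar>"
      unfolding eventually_at
    proof (intro exI[of _ \<delta>] conjI assms(1) ballI impI)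
      fix h :: real assume h: "h \<noteq> 0 \<and> dist h 0 < \<delta>"
      then have "\<bar>f h - f 0 - h * D\<bar> / \<bar>h\<bar> \<le> C * h\<^sup>2 / \<bar>h\<bar>"
        using assms(2)[of h] by (intro divide_right_mono) auto
      moreover have "(f h - f 0) / h - D = (f h - f 0 - h * D) / h" using h by (simp add: field_simps)
      moreover have "h\<^sup>2 / \<bar>h\<bar> = \<bar>h\<bar>" using h by (simp add: power2_eq_square field_simps abs_if)
      ultimately show "norm ((f h - f 0) / h - D) \<le> C * \<bar>h\<bar>"
        by (metis abs_divide real_norm_def times_divide_eq_right)
    qed
  qed
  then show ?thesis by (simp add: has_field_derivative_iff LIM_zero_iff)
qed

type_synonym env = "nat \<Rightarrow> real \<times> (r3 \<Rightarrow> real)"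

definition shift :: "env \<Rightarrow> nat \<Rightarrow> real \<Rightarrow> env" where
  "shift e k t = e(0 := e 0 + t *\<^sub>R e k)"

lemma shift_0: "shift e k 0 = e"
  by (auto simp: shift_def)

text \<open>For \<open>k = 0\<close> the direction itself would change under the first
  shift.\<close>

lemma shift_shift: "k \<noteq> 0 \<Longrightarrow> shift (shift e k s) k t = shift e k (s + t)"
  by (auto simp: shift_def algebra_simps)

section \<open>Interpretation of terms along the solution\<close>

context solution_chart
begin

text \<open>Finite support lets a single bound serve all slots at once, as \<open>close\<close>
  demands.\<close>

definition ok :: "env \<Rightarrow> bool" where
  "ok e \<longleftrightarrow> e 0 \<in> N \<and> (\<forall>i. e i \<in> E) \<and> finite {i. e i \<noteq> 0}"

primrec sem :: "tm \<Rightarrow> env \<Rightarrow> real \<Rightarrow> real" where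
  "sem (Const k) e = (\<lambda>s. k)"
| "sem (Eta i) e = (\<lambda>s. fst (e i))"
| "sem (Pd ds i) e = (\<lambda>s. PP ds (snd (e i)) (s, yS (e 0) s, zS (e 0) s))"
| "sem Zt e = zS (e 0)"
| "sem Inv e = (\<lambda>s. inverse (PP [Ax3] (snd (e 0)) (s, yS (e 0) s, zS (e 0) s)))"
| "sem (Add a b) e = (\<lambda>s. sem a e s + sem b e s)"
| "sem (Mul a b) e = (\<lambda>s. sem a e s * sem b e s)"
| "sem (Prim a) e = (\<lambda>s. integral {0..s} (sem a e))"
| "sem (Expo a) e = (\<lambda>s. exp (sem a e s))"

lemma ok_N: "ok e \<Longrightarrow> e 0 \<in> N" and ok_E: "ok e \<Longrightarrow> e i \<in> E" and ok_snd: "ok e \<Longrightarrow> snd (e i) \<in> C_infty_set \<Omega>"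
  using E_iff[of "e i"] by (auto simp: ok_def)

lemma p3_nonzero: "ok e \<Longrightarrow> s \<in> I01 \<Longrightarrow> PP [Ax3] (snd (e 0)) (s, yS (e 0) s, zS (e 0) s) \<noteq> 0"
  using p3_PP[OF ok_N yS_in_K[OF ok_N]] c by fastforce

lemma Pd_has_derivative:
  assumes e: "ok e" and s: "s \<in> I01"
  shows "(sem (Pd ds i) e has_real_derivative sem (dsP ds i) e s) (at s within I01)"
  unfolding sem.simps
  by (rule DERIV_cong[OF PP_chain[OF ok_snd[OF e] DERIV_ident
          yS_has_derivative[OF ok_N[OF e] s] zS_has_derivative[OF ok_N[OF e] s]]])
    (use s in_Omega[OF ok_N[OF e]] in \<open>auto simp: dsP_def ZZ_def divide_inverse algebra_simps\<close>)

lemma sem_has_derivative: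
  assumes e: "ok e"
  shows "s \<in> I01 \<Longrightarrow> (sem a e has_real_derivative sem (Ds a) e s) (at s within I01)"
proof (induction a arbitrary: s)
  case (Pd ds i)
  then show ?case using Pd_has_derivative[OF e] by simp
next
  case Zt
  then show ?case using zS_has_derivative[OF ok_N[OF e]] by (simp add: ZZ_def divide_inverse algebra_simps)
next
  case Inv
  have "((\<lambda>s. inverse (sem (Pd [Ax3] 0) e s)) has_real_derivative
      - (inverse (sem (Pd [Ax3] 0) e s) * sem (dsP [Ax3] 0) e s * inverse (sem (Pd [Ax3] 0) e s))) (at s within I01)"
    using p3_nonzero[OF e Inv] by (intro DERIV_inverse' Pd_has_derivative[OF e Inv]) simp
  then show ?case by (simp add: algebra_simps)
next
  case (Mul a b)
  then show ?case unfolding sem.simps Ds.simps by (auto intro!: derivative_eq_intros)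
next
  case (Prim a)
  then have "continuous_on I01 (sem a e)" by (metis DERIV_continuous_on)
  then show ?case using integral_has_real_derivative[of 0 1 "sem a e" s] Prim by simp
next
  case (Expo a)
  then show ?case unfolding sem.simps Ds.simps by (auto intro!: derivative_eq_intros)
next
  case (Add a b)
  then show ?case unfolding sem.simps Ds.simps by (auto intro!: derivative_eq_intros)
qed auto

lemma sem_continuous: "ok e \<Longrightarrow> continuous_on I01 (sem a e)"
  using sem_has_derivative by (metis DERIV_continuous_on)

lemma sem_integrable: "ok e \<Longrightarrow> s \<in> I01 \<Longrightarrow> sem a e integrable_on {0..s}"
  by (intro integrable_continuous_real continuous_on_subset[OF sem_continuous]) auto

section \<open>Bounds and Lipschitz estimates for the values of terms\<close>

lemma abs_integral_bound:
  fixes f :: "real \<Rightarrow> real"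
  assumes "continuous_on I01 f" "\<And>r. r \<in> I01 \<Longrightarrow> \<bar>f r\<bar> \<le> B" "s \<in> I01"
  shows "\<bar>integral {0..s} f\<bar> \<le> B"
proof -
  have "norm (integral {0..s} f) \<le> B * (s - 0)"
    using assms by (intro integral_bound continuous_on_subset[OF assms(1)]) auto
  moreover have "B \<ge> 0" using assms(2)[of 0] by fastforce
  then have "B * (s - 0) \<le> B * 1" using assms(3) by (intro mult_left_mono) auto
  ultimately show ?thesis by simp
qed

lemma bnd_env_exists: "ok e \<Longrightarrow> \<exists>B. \<forall>i. bnd M B (e i)"
proof -
  assume e: "ok e"
  have "\<forall>i. \<exists>B. bnd M B (e i)" using bnd_exists ok_E[OF e] by blast
  then obtain b where b: "\<And>i. bnd M (b i) (e i)" by metis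
  have b_nonneg: "0 \<le> b i" for i using b bnd_nonneg by blast
  define S where "S = {i. e i \<noteq> 0}"
  have S: "finite S" using e by (simp add: ok_def S_def)
  have "bnd M (sum b S) (e i)" for i
  proof (cases "i \<in> S")
    case True
    then have "b i \<le> sum b S" using S b_nonneg by (intro member_le_sum) auto
    then show ?thesis using b bnd_mono by blast
  next
    case False
    then show ?thesis using b_nonneg by (auto simp: S_def intro!: bnd_zero sum_nonneg)
  qed
  then show ?thesis by blast
qed

definition close :: "nat \<Rightarrow> real \<Rightarrow> real \<Rightarrow> env \<Rightarrow> env \<Rightarrow> bool" where
  "close M B d e e' \<longleftrightarrow> ok e \<and> ok e' \<and> (\<forall>i. bnd M B (e i) \<and> bnd M B (e' i) \<and> bnd M d (e i - e' i))"

text \<open>One constant serves both as a bound and as a Lipschitz constant, so that products,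
  exponentials and reciprocals stay within the notion.\<close>

definition lips :: "nat \<Rightarrow> real \<Rightarrow> real \<Rightarrow> (env \<Rightarrow> real \<Rightarrow> real) \<Rightarrow> bool" where
  "lips M B C g \<longleftrightarrow> 0 \<le> C \<and> (\<forall>e e' d. close M B d e e' \<longrightarrow>
     (\<forall>s\<in>I01. \<bar>g e s\<bar> \<le> C \<and> \<bar>g e' s\<bar> \<le> C \<and> \<bar>g e s - g e' s\<bar> \<le> C * d))"

text \<open>The order \<open>M\<close> precedes the bound \<open>B\<close>, since how large a given
  parameter is depends on the seminorm; only then is the constant chosen.\<close>

definition tame :: "nat \<Rightarrow> (env \<Rightarrow> real \<Rightarrow> real) \<Rightarrow> bool" where
  "tame M g \<longleftrightarrow> (\<forall>B. \<exists>C. lips M B C g)"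

lemma close_mono: "close M B d e e' \<Longrightarrow> M' \<le> M \<Longrightarrow> close M' B d e e'"
  unfolding close_def using bnd_mono by blast

lemma close_nonneg: "close M B d e e' \<Longrightarrow> 0 \<le> d" "close M B d e e' \<Longrightarrow> 0 \<le> B"
  unfolding close_def using bnd_nonneg by blast+

lemma lipsD: "lips M B C g \<Longrightarrow> close M B d e e' \<Longrightarrow> s \<in> I01 \<Longrightarrow>
    \<bar>g e s\<bar> \<le> C \<and> \<bar>g e' s\<bar> \<le> C \<and> \<bar>g e s - g e' s\<bar> \<le> C * d"
  unfolding lips_def by blast

lemma lipsI:
  assumes "0 \<le> C" "\<And>e e' d s. close M B d e e' \<Longrightarrow> s \<in> I01 \<Longrightarrow>
    \<bar>g e s\<bar> \<le> C \<and> \<bar>g e' s\<bar> \<le> C \<and> \<bar>g e s - g e' s\<bar> \<le> C * d"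
  shows "lips M B C g"
  using assms unfolding lips_def by blast

lemma lips_mono:
  assumes g: "lips M B C g" and "M \<le> M'" "C \<le> C'"
  shows "lips M' B C' g"
proof (rule lipsI)
  show "0 \<le> C'" using assms by (auto simp: lips_def)
  fix e e' d s assume cl: "close M' B d e e'" and s: "s \<in> I01"
  have "C * d \<le> C' * d" using close_nonneg(1)[OF cl] assms(3) by (intro mult_right_mono)
  then show "\<bar>g e s\<bar> \<le> C' \<and> \<bar>g e' s\<bar> \<le> C' \<and> \<bar>g e s - g e' s\<bar> \<le> C' * d"
    using lipsD[OF g close_mono[OF cl assms(2)] s] assms(3) by linarith
qed

lemma tameD:
  assumes "tame M g"
  obtains C where "0 \<le> C" "lips M B C g"
  using assms unfolding tame_def lips_def by blast

lemma tameI: "(\<And>B. \<exists>C. lips M B C g) \<Longrightarrow> tame M g"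
  unfolding tame_def by blast

lemma tame_mono: "tame M g \<Longrightarrow> M \<le> M' \<Longrightarrow> tame M' g"
  unfolding tame_def using lips_mono by blast

lemma tame_const: "tame M (\<lambda>_ _. k)"
  by (intro tameI exI[of _ "\<bar>k\<bar>"] lipsI) (use close_nonneg in \<open>auto intro: mult_nonneg_nonneg\<close>)

lemma tame_fst: "tame M (\<lambda>e _. fst (e i))"
proof (rule tameI)
  fix B
  have "\<bar>fst (e i)\<bar> \<le> max B 1 \<and> \<bar>fst (e' i)\<bar> \<le> max B 1 \<and> \<bar>fst (e i) - fst (e' i)\<bar> \<le> max B 1 * d"
    if cl: "close M B d e e'" for e e' d
  proof -
    have "bnd M B (e i)" "bnd M B (e' i)" "bnd M d (e i - e' i)" using cl by (auto simp: close_def)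
    then have "\<bar>fst (e i)\<bar> \<le> B" "\<bar>fst (e' i)\<bar> \<le> B" "\<bar>fst (e i) - fst (e' i)\<bar> \<le> 1 * d"
      by (auto simp: bnd_def)
    moreover have "1 * d \<le> max B 1 * d" using close_nonneg[OF cl] by (intro mult_right_mono) auto
    ultimately show ?thesis by linarith
  qed
  then show "\<exists>C. lips M B C (\<lambda>e _. fst (e i))"
    by (intro exI[of _ "max B 1"] lipsI) auto
qed

lemma tame_add:
  assumes "tame M f" "tame M g"
  shows "tame M (\<lambda>e s. f e s + g e s)"
proof (rule tameI)
  fix B
  obtain C where C: "C \<ge> 0" "lips M B C f" using tameD[OF assms(1)] by metis
  obtain C' where C': "C' \<ge> 0" "lips M B C' g" using tameD[OF assms(2)] by metis
  have "\<bar>f e s + g e s\<bar> \<le> C + C' \<and> \<bar>f e' s + g e' s\<bar> \<le> C + C' \<and>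
      \<bar>f e s + g e s - (f e' s + g e' s)\<bar> \<le> (C + C') * d" if "close M B d e e'" "s \<in> I01" for e e' d s
    using lipsD[OF C(2) that] lipsD[OF C'(2) that] unfolding distrib_right by linarith
  then show "\<exists>C. lips M B C (\<lambda>e s. f e s + g e s)"
    using C C' by (intro exI[of _ "C + C'"] lipsI) auto
qed

lemma tame_mult:
  assumes "tame M f" "tame M g"
  shows "tame M (\<lambda>e s. f e s * g e s)"
proof (rule tameI)
  fix B
  obtain C where C: "C \<ge> 0" "lips M B C f" using tameD[OF assms(1)] by metis
  obtain C' where C': "C' \<ge> 0" "lips M B C' g" using tameD[OF assms(2)] by metis
  have "\<bar>f e s * g e s\<bar> \<le> 2 * C * C' \<and> \<bar>f e' s * g e' s\<bar> \<le> 2 * C * C' \<and>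
      \<bar>f e s * g e s - f e' s * g e' s\<bar> \<le> 2 * C * C' * d" if cl: "close M B d e e'" "s \<in> I01" for e e' d s
  proof -
    have f: "\<bar>f e s\<bar> \<le> C" "\<bar>f e' s\<bar> \<le> C" "\<bar>f e s - f e' s\<bar> \<le> C * d" using lipsD[OF C(2) that] by auto
    have g: "\<bar>g e s\<bar> \<le> C'" "\<bar>g e' s\<bar> \<le> C'" "\<bar>g e s - g e' s\<bar> \<le> C' * d" using lipsD[OF C'(2) that] by auto
    have d: "0 \<le> d" using close_nonneg[OF cl(1)] by auto
    have "f e s * g e s - f e' s * g e' s = f e s * (g e s - g e' s) + (f e s - f e' s) * g e' s"
      by (simp add: algebra_simps)
    also have "\<bar>\<dots>\<bar> \<le> C * (C' * d) + (C * d) * C'"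
      using f g C(1) C'(1) d
      by (intro order_trans[OF abs_triangle_ineq] add_mono) (auto simp: abs_mult intro!: mult_mono)
    finally have "\<bar>f e s * g e s - f e' s * g e' s\<bar> \<le> 2 * C * C' * d" by (simp add: algebra_simps)
    moreover have "\<bar>f e s * g e s\<bar> \<le> C * C'" "\<bar>f e' s * g e' s\<bar> \<le> C * C'"
      using f g C(1) unfolding abs_mult by (auto intro!: mult_mono)
    moreover have "0 \<le> C * C'" using C(1) C'(1) by simp
    ultimately show ?thesis by linarith
  qed
  then show "\<exists>C. lips M B C (\<lambda>e s. f e s * g e s)"
    using C C' by (intro exI[of _ "2 * C * C'"] lipsI) auto
qed

lemma tame_inverse:
  assumes "tame M f" and low: "\<And>e s. ok e \<Longrightarrow> s \<in> I01 \<Longrightarrow> c \<le> \<bar>f e s\<bar>"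
  shows "tame M (\<lambda>e s. inverse (f e s))"
proof (rule tameI)
  fix B
  obtain C where C: "C \<ge> 0" "lips M B C f" using tameD[OF assms(1)] by metis
  define C' where "C' = inverse c + inverse c * C * inverse c"
  have C': "0 \<le> inverse c" "inverse c \<le> C'" "inverse c * C * inverse c \<le> C'" using C(1) c by (auto simp: C'_def)
  have "\<bar>inverse (f e s)\<bar> \<le> C' \<and> \<bar>inverse (f e' s)\<bar> \<le> C' \<and>
      \<bar>inverse (f e s) - inverse (f e' s)\<bar> \<le> C' * d" if cl: "close M B d e e'" "s \<in> I01" for e e' d s
  proof -
    have low': "c \<le> \<bar>f e s\<bar>" "c \<le> \<bar>f e' s\<bar>" using low cl by (auto simp: close_def)
    then have nz: "f e s \<noteq> 0" "f e' s \<noteq> 0" using c by auto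
    have i: "\<bar>inverse (f e s)\<bar> \<le> inverse c" "\<bar>inverse (f e' s)\<bar> \<le> inverse c"
      unfolding abs_inverse using low' c by (auto intro: le_imp_inverse_le)
    have d: "0 \<le> d" using close_nonneg[OF cl(1)] by auto
    have "inverse (f e s) - inverse (f e' s) = - (inverse (f e s) * (f e s - f e' s) * inverse (f e' s))"
      using nz by (rule inverse_diff_inverse)
    then have "\<bar>inverse (f e s) - inverse (f e' s)\<bar>
        = \<bar>inverse (f e s)\<bar> * \<bar>f e s - f e' s\<bar> * \<bar>inverse (f e' s)\<bar>" by (simp add: abs_mult)
    also have "\<dots> \<le> inverse c * (C * d) * inverse c"
      using i lipsD[OF C(2) cl] C'(1) C(1) d by (intro mult_mono) auto
    also have "\<dots> = inverse c * C * inverse c * d" by simp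
    also have "\<dots> \<le> C' * d" using C' d by (intro mult_right_mono)
    finally show ?thesis using i C' by linarith
  qed
  then show "\<exists>C. lips M B C (\<lambda>e s. inverse (f e s))"
    using order_trans[OF C'(1,2)] by (intro exI[of _ C'] lipsI) auto
qed

lemma tame_exp:
  assumes "tame M f"
  shows "tame M (\<lambda>e s. exp (f e s))"
proof (rule tameI)
  fix B
  obtain C where C: "C \<ge> 0" "lips M B C f" using tameD[OF assms(1)] by metis
  define C' where "C' = exp C + exp C * C"
  have C': "exp C \<le> C'" "exp C * C \<le> C'" using C(1) by (auto simp: C'_def)
  have "\<bar>exp (f e s)\<bar> \<le> C' \<and> \<bar>exp (f e' s)\<bar> \<le> C' \<and>
      \<bar>exp (f e s) - exp (f e' s)\<bar> \<le> C' * d" if cl: "close M B d e e'" "s \<in> I01" for e e' d s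
  proof -
    have f: "\<bar>f e s\<bar> \<le> C" "\<bar>f e' s\<bar> \<le> C" "\<bar>f e s - f e' s\<bar> \<le> C * d" using lipsD[OF C(2) that] by auto
    have d: "0 \<le> d" using close_nonneg[OF cl(1)] by auto
    have "\<bar>exp (f e s) - exp (f e' s) - 0 * (f e s - f e' s)\<bar> \<le> exp C * \<bar>f e s - f e' s\<bar>"
    proof (rule affine_approx_of_deriv_bound[where f' = exp])
      fix u assume "u \<in> closed_segment (f e s) (f e' s)"
      then have "u \<le> C" using f by (auto simp: closed_segment_eq_real_ivl split: if_splits)
      then show "\<bar>exp u - 0\<bar> \<le> exp C" by simp
    qed (rule DERIV_exp)
    then have "\<bar>exp (f e s) - exp (f e' s)\<bar> \<le> exp C * \<bar>f e s - f e' s\<bar>" by simp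
    also have "\<dots> \<le> exp C * (C * d)" using f by (intro mult_left_mono) auto
    also have "\<dots> = exp C * C * d" by simp
    also have "\<dots> \<le> C' * d" using C' d by (intro mult_right_mono)
    finally have 1: "\<bar>exp (f e s) - exp (f e' s)\<bar> \<le> C' * d" .
    have "exp (f e s) \<le> exp C" "exp (f e' s) \<le> exp C" using f by auto
    then have "exp (f e s) \<le> C'" "exp (f e' s) \<le> C'" using C' by linarith+
    then show ?thesis using 1 by simp
  qed
  then show "\<exists>C. lips M B C (\<lambda>e s. exp (f e s))"
    using C' order_trans[OF exp_ge_zero C'(1)] by (intro exI[of _ C'] lipsI) auto
qed

lemma tame_integral:
  assumes "tame M f" and cont: "\<And>e. ok e \<Longrightarrow> continuous_on I01 (f e)"
  shows "tame M (\<lambda>e s. integral {0..s} (f e))"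
proof (rule tameI)
  fix B
  obtain C where C: "C \<ge> 0" "lips M B C f" using tameD[OF assms(1)] by metis
  have "\<bar>integral {0..s} (f e)\<bar> \<le> C \<and> \<bar>integral {0..s} (f e')\<bar> \<le> C \<and>
      \<bar>integral {0..s} (f e) - integral {0..s} (f e')\<bar> \<le> C * d" if cl: "close M B d e e'" and s: "s \<in> I01" for e e' d s
  proof -
    have ct: "continuous_on I01 (f e)" "continuous_on I01 (f e')" using cont cl by (auto simp: close_def)
    then have "f e integrable_on {0..s}" "f e' integrable_on {0..s}"
      using s by (auto intro!: integrable_continuous_real intro: continuous_on_subset)
    then have "integral {0..s} (f e) - integral {0..s} (f e') = integral {0..s} (\<lambda>r. f e r - f e' r)"
      by (simp add: integral_diff)
    then show ?thesis using lipsD[OF C(2) cl] s ct by (auto intro!: abs_integral_bound continuous_on_diff)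
  qed
  then show "\<exists>C. lips M B C (\<lambda>e s. integral {0..s} (f e))"
    using C by (intro exI[of _ C] lipsI) auto
qed

text \<open>This and the next constant are the factors of \<open>d\<close> in the two estimates of
  \<open>solution_difference\<close>.\<close>

definition C\<^sub>y where "C\<^sub>y = 2 * exp (2 * A + 1) * (A + 1)"
definition C\<^sub>z where "C\<^sub>z = A * (C\<^sub>y + 1)"

lemma C_nonneg: "0 \<le> C\<^sub>y" "0 \<le> C\<^sub>z"
  using A by (auto simp: C\<^sub>y_def C\<^sub>z_def)

lemma solution_lipschitz:
  assumes x: "x \<in> N" and x': "x' \<in> N" and d: "bnd 0 d (x - x')" and s: "s \<in> I01"
  shows "\<bar>yS x s - yS x' s\<bar> \<le> C\<^sub>y * d" "\<bar>zS x s - zS x' s\<bar> \<le> C\<^sub>z * d"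
proof -
  have "\<bar>snd x p - snd x' p\<bar> \<le> d" if "p \<in> K" for p
  proof -
    have "\<bar>PP [] (snd (x - x')) p\<bar> \<le> d" using d that by (simp add: bnd_def)
    then show ?thesis using N_snd[OF x] N_snd[OF x'] by (simp add: PP_diff PP_Nil)
  qed
  moreover have "\<bar>fst x - fst x'\<bar> \<le> d" using d by (simp add: bnd_def)
  ultimately show "\<bar>yS x s - yS x' s\<bar> \<le> C\<^sub>y * d" "\<bar>zS x s - zS x' s\<bar> \<le> C\<^sub>z * d"
    using solution_difference[OF yS_chart[OF x] yS_chart[OF x'] _ _ s, of d]
    by (auto simp: C\<^sub>y_def C\<^sub>z_def algebra_simps)
qed

text \<open>Two effects add up: the function changes, by at most \<open>d\<close>, and the point of
  evaluation moves, by at most \<open>(C\<^sub>y + C\<^sub>z) * d\<close>. The second one costs one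
  more derivative of the function; this is where derivatives are lost.\<close>

lemma tame_Pd: "tame (Suc (length ds)) (\<lambda>e s. PP ds (snd (e i)) (s, yS (e 0) s, zS (e 0) s))"
proof (rule tameI)
  fix B
  let ?M = "Suc (length ds)" and ?g = "\<lambda>e s. PP ds (snd (e i)) (s, yS (e 0) s, zS (e 0) s)"
  define C where "C = \<bar>B\<bar> + 1 + \<bar>B\<bar> * (C\<^sub>y + C\<^sub>z)"
  have C: "1 + \<bar>B\<bar> * (C\<^sub>y + C\<^sub>z) \<le> C" "\<bar>B\<bar> \<le> C" using C_nonneg by (auto simp: C_def)
  have "\<bar>?g e s\<bar> \<le> C \<and> \<bar>?g e' s\<bar> \<le> C \<and> \<bar>?g e s - ?g e' s\<bar> \<le> C * d"
    if cl: "close ?M B d e e'" and s: "s \<in> I01" for e e' :: env and d s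
  proof -
    have e: "ok e" "ok e'" and b: "\<And>i. bnd ?M B (e i)" "\<And>i. bnd ?M B (e' i)" "\<And>i. bnd ?M d (e i - e' i)"
      using cl by (auto simp: close_def)
    have d: "0 \<le> d" "0 \<le> B" using close_nonneg[OF cl] by auto
    have K: "(s, yS (e 0) s, zS (e 0) s) \<in> K" "(s, yS (e' 0) s, zS (e' 0) s) \<in> K"
      using yS_in_K[OF ok_N s] e by auto
    have 1: "\<bar>?g e s\<bar> \<le> B" "\<bar>?g e' s\<bar> \<le> B" using b(1,2)[of i] K by (auto simp: bnd_def)
    have "bnd 0 d (e 0 - e' 0)" using b(3)[of 0] by (rule bnd_mono) auto
    note lip = solution_lipschitz[OF ok_N[OF e(1)] ok_N[OF e(2)] this s]
    have "\<bar>PP ds (snd (e i)) (s, yS (e 0) s, zS (e 0) s) - PP ds (snd (e i)) (s, yS (e' 0) s, zS (e' 0) s)\<bar>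
        \<le> B * (\<bar>yS (e 0) s - yS (e' 0) s\<bar> + \<bar>zS (e 0) s - zS (e' 0) s\<bar>)"
      using PP_fibre_lipschitz[OF ok_E[OF e(1)] b(1) K(2,1)] .
    also have "\<dots> \<le> B * (C\<^sub>y * d + C\<^sub>z * d)" using lip d by (intro mult_left_mono add_mono) auto
    finally have 2: "\<bar>PP ds (snd (e i)) (s, yS (e 0) s, zS (e 0) s) - PP ds (snd (e i)) (s, yS (e' 0) s, zS (e' 0) s)\<bar>
        \<le> B * (C\<^sub>y * d + C\<^sub>z * d)" .
    have "\<bar>PP ds (snd (e i - e' i)) (s, yS (e' 0) s, zS (e' 0) s)\<bar> \<le> d" using b(3)[of i] K by (auto simp: bnd_def)
    then have "\<bar>PP ds (snd (e i)) (s, yS (e' 0) s, zS (e' 0) s) - PP ds (snd (e' i)) (s, yS (e' 0) s, zS (e' 0) s)\<bar> \<le> d"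
      using ok_snd e by (simp add: PP_diff)
    then have "\<bar>?g e s - ?g e' s\<bar> \<le> B * (C\<^sub>y * d + C\<^sub>z * d) + d" using 2 by linarith
    also have "\<dots> = (1 + \<bar>B\<bar> * (C\<^sub>y + C\<^sub>z)) * d" using d by (simp add: algebra_simps)
    also have "\<dots> \<le> C * d" using C d by (intro mult_right_mono)
    finally show ?thesis using 1 C d by linarith
  qed
  then show "\<exists>C. lips (Suc (length ds)) B C (\<lambda>e s. PP ds (snd (e i)) (s, yS (e 0) s, zS (e 0) s))"
    using C by (intro exI[of _ C] lipsI) auto
qed

text \<open>The bound comes from the tube, the Lipschitz constant from
  \<open>solution_lipschitz\<close>; neither depends on \<open>B\<close>.\<close>

lemma tame_Zt: "tame 0 (\<lambda>e. zS (e 0))"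
proof (rule tameI)
  fix B
  have "compact (deriv_I y\<^sub>0 ` I01)" using C_I_1_continuous(2)[OF y0] by (intro compact_continuous_image) auto
  then obtain Z where "\<forall>z \<in> deriv_I y\<^sub>0 ` I01. norm z \<le> Z"
    using compact_imp_bounded bounded_iff by blast
  then have Z: "\<And>s. s \<in> I01 \<Longrightarrow> \<bar>deriv_I y\<^sub>0 s\<bar> \<le> Z" by simp
  have Zr: "\<bar>zS x s\<bar> \<le> Z + r" if "x \<in> N" "s \<in> I01" for x s
    using yS_in_K[OF that] Z[OF that(2)] by (auto simp: K_def)
  have Z0: "0 \<le> Z" using Z[of 0] by fastforce
  have "\<bar>zS (e 0) s\<bar> \<le> Z + r + C\<^sub>z \<and> \<bar>zS (e' 0) s\<bar> \<le> Z + r + C\<^sub>z \<and> \<bar>zS (e 0) s - zS (e' 0) s\<bar> \<le> (Z + r + C\<^sub>z) * d"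
    if cl: "close 0 B d e e'" and s: "s \<in> I01" for e e' d s
  proof -
    have e: "ok e" "ok e'" and b: "bnd 0 d (e 0 - e' 0)" using cl by (auto simp: close_def)
    have "C\<^sub>z * d \<le> (Z + r + C\<^sub>z) * d" using Z0 r close_nonneg[OF cl] by (intro mult_right_mono) auto
    then show ?thesis
      using solution_lipschitz(2)[OF ok_N[OF e(1)] ok_N[OF e(2)] b s] Zr[OF ok_N[OF e(1)] s]
        Zr[OF ok_N[OF e(2)] s] C_nonneg by linarith
  qed
  then show "\<exists>C. lips 0 B C (\<lambda>e. zS (e 0))"
    using Z0 r C_nonneg by (intro exI[of _ "Z + r + C\<^sub>z"] lipsI) auto
qed

lemma tame_sem: "\<exists>M. tame M (sem a)"
proof (induction a)
  case (Const c)
  show ?case unfolding sem.simps using tame_const by blast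
next
  case (Eta i)
  show ?case unfolding sem.simps using tame_fst by blast
next
  case (Pd ds i)
  show ?case unfolding sem.simps using tame_Pd by blast
next
  case Zt
  show ?case unfolding sem.simps using tame_Zt by blast
next
  case Inv
  have "tame (Suc (length [Ax3])) (\<lambda>e s. inverse (PP [Ax3] (snd (e 0)) (s, yS (e 0) s, zS (e 0) s)))"
    using p3_PP[OF ok_N yS_in_K[OF ok_N]] by (intro tame_inverse tame_Pd) auto
  then show ?case unfolding sem.simps by blast
next
  case (Add a b)
  then obtain M M' where "tame M (sem a)" "tame M' (sem b)" by blast
  then have "tame (max M M') (sem a)" "tame (max M M') (sem b)" using tame_mono by auto
  then show ?case unfolding sem.simps using tame_add by blast
next
  case (Mul a b)
  then obtain M M' where "tame M (sem a)" "tame M' (sem b)" by blast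
  then have "tame (max M M') (sem a)" "tame (max M M') (sem b)" using tame_mono by auto
  then show ?case unfolding sem.simps using tame_mult by blast
next
  case (Prim a)
  then show ?case unfolding sem.simps using tame_integral sem_continuous by blast
next
  case (Expo a)
  then show ?case unfolding sem.simps using tame_exp by blast
qed

end

section \<open>Directional derivatives in the parameter\<close>

lemma continuous_map_line:
  assumes "locally_convex T" "x \<in> topspace T" "u \<in> topspace T"
  shows "continuous_map euclideanreal T (\<lambda>t. x + t *\<^sub>R u)"
proof -
  have add: "continuous_map (prod_topology T T) T (\<lambda>(x, y). x + y)"
    and scale: "continuous_map (prod_topology euclideanreal T) T (\<lambda>(c, x). c *\<^sub>R x)"
    using assms(1) by (auto simp: locally_convex_def)
  have "continuous_map euclideanreal T (\<lambda>t. t *\<^sub>R u)"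
    using continuous_map_compose[OF _ scale, of euclideanreal "\<lambda>t. (t, u)"] assms
    by (simp add: continuous_map_paired o_def)
  then show ?thesis
    using continuous_map_compose[OF _ add, of euclideanreal "\<lambda>t. (x, t *\<^sub>R u)"] assms
    by (simp add: continuous_map_paired o_def)
qed

context solution_chart
begin

lemma locally_convex_param_space: "locally_convex (param_space \<Omega>)"
  unfolding param_space_def by (rule locally_convex_prod_real[OF C_infty.locally_convex_unif])

lemma N_line:
  assumes "x \<in> N" "u \<in> E"
  shows "\<exists>\<delta>>0. \<forall>t. \<bar>t\<bar> < \<delta> \<longrightarrow> x + t *\<^sub>R u \<in> N"
proof -
  have "continuous_map euclideanreal (param_space \<Omega>) (\<lambda>t. x + t *\<^sub>R u)"
    using assms N_subset by (intro continuous_map_line locally_convex_param_space) auto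
  from openin_continuous_map_preimage[OF this openin_N]
  have "open {t. x + t *\<^sub>R u \<in> N}" by simp
  moreover have "0 \<in> {t. x + t *\<^sub>R u \<in> N}" using assms by simp
  ultimately obtain \<delta> where "\<delta> > 0" "ball 0 \<delta> \<subseteq> {t. x + t *\<^sub>R u \<in> N}"
    using open_contains_ball by blast
  then show ?thesis by (intro exI[of _ \<delta>]) (auto simp: subset_iff)
qed

lemma ok_shift: "ok e \<Longrightarrow> \<exists>\<delta>>0. \<forall>t. \<bar>t\<bar> < \<delta> \<longrightarrow> ok (shift e k t)"
proof -
  assume e: "ok e"
  obtain \<delta> where \<delta>: "\<delta> > 0" "\<And>t. \<bar>t\<bar> < \<delta> \<Longrightarrow> e 0 + t *\<^sub>R e k \<in> N" using N_line[OF ok_N[OF e] ok_E[OF e]] by blast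
  have "ok (shift e k t)" if "\<bar>t\<bar> < \<delta>" for t
  proof -
    have "{i. shift e k t i \<noteq> 0} \<subseteq> insert 0 {i. e i \<noteq> 0}" by (auto simp: shift_def)
    then have "finite {i. shift e k t i \<noteq> 0}" using e finite_subset by (auto simp: ok_def)
    then show ?thesis using \<delta>(2)[OF that] N_subset ok_E[OF e] unfolding ok_def by (auto simp: shift_def)
  qed
  then show ?thesis using \<delta>(1) by blast
qed

lemma close_shift:
  assumes e: "ok e" "ok (shift e k t)" and B: "\<And>i. bnd M B (e i)" and t: "\<bar>t\<bar> \<le> 1"
  shows "close M (2 * B) (\<bar>t\<bar> * B) (shift e k t) e"
  unfolding close_def
proof (intro conjI allI e)
  fix i
  have B0: "0 \<le> B" using bnd_nonneg[OF B] .
  have s: "bnd M (\<bar>t\<bar> * B) (t *\<^sub>R e k)" using bnd_scale[OF B ok_E[OF e(1)]] .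
  show 1: "bnd M (2 * B) (e i)" using bnd_mono[OF B, of M "2 * B" i] B0 by simp
  have "bnd M (B + \<bar>t\<bar> * B) (e 0 + t *\<^sub>R e k)"
    using bnd_add[OF B s ok_E[OF e(1)]] subspace_scale[OF subspace_E ok_E[OF e(1)]] by blast
  then have "bnd M (2 * B) (e 0 + t *\<^sub>R e k)"
    using mult_right_mono[OF t B0] by (auto elim!: bnd_mono)
  then show "bnd M (2 * B) (shift e k t i)" using 1 by (simp add: shift_def)
  show "bnd M (\<bar>t\<bar> * B) (shift e k t i - e i)"
    using s bnd_zero[of "\<bar>t\<bar> * B"] B0 by (simp add: shift_def)
qed

text \<open>The two sides are different terms whose values agree, because the exponential factors of
  the variation of constants cancel. In other words, \<open>U k\<close> does solve the linearised
  equation.\<close>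

lemma sem_Ds_U: "ok e \<Longrightarrow> s \<in> I01 \<Longrightarrow> sem (Ds (U k)) e s = sem (U' k) e s"
proof -
  assume "ok e" "s \<in> I01"
  have e: "exp (sem (Neg LinA) e s) * exp (sem LinA e s) = 1" by (simp flip: exp_add)
  have "sem (Ds (U k)) e s = - (sem (Mul (Pd [Ax2] 0) Inv) e s) * sem (U k) e s
      - (exp (sem (Neg LinA) e s) * exp (sem LinA e s)) * sem (Mul (Pd [] k) Inv) e s"
    by (simp add: U_def LinA_def algebra_simps)
  also have "\<dots> = sem (U' k) e s" unfolding e by (simp add: U'_def algebra_simps)
  finally show ?thesis .
qed

text \<open>With \<open>w = y\<^sub>t - y - t u\<close>, where \<open>u\<close> is the candidate derivative, \<open>p\<^sub>3 w' + p\<^sub>2 w\<close> is the Taylor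
  remainder of the equation and hence \<open>O(t\<^sup>2)\<close>.\<close>

lemma solution_quadratic_approximation:
  assumes e: "ok e"
  shows "\<exists>C \<delta>. \<delta> > 0 \<and> (\<forall>t s. \<bar>t\<bar> < \<delta> \<longrightarrow> s \<in> I01 \<longrightarrow>
    \<bar>yS (shift e k t 0) s - yS (e 0) s - t * sem (U k) e s\<bar> \<le> C * t\<^sup>2 \<and>
    \<bar>zS (shift e k t 0) s - zS (e 0) s - t * sem (U' k) e s\<bar> \<le> C * t\<^sup>2)"
proof -
  obtain B where B: "\<And>i. bnd 2 B (e i)" using bnd_env_exists[OF e] by blast
  have B0: "0 \<le> B" using bnd_nonneg[OF B] .
  obtain \<delta> where \<delta>: "\<delta> > 0" "\<And>t. \<bar>t\<bar> < \<delta> \<Longrightarrow> ok (shift e k t)" using ok_shift[OF e] by blast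
  \<comment> \<open>\<open>C3 * B * \<bar>t\<bar>\<close> will bound the C^1 distance of the two
    solutions and \<open>C4 * t^2\<close> the Taylor remainder; \<open>a\<close> bounds the quotient
    of \<open>p2\<close> by \<open>p3\<close>, and \<open>C5\<close> is what Gronwall's inequality
    makes of these.\<close>
  define C3 where "C3 = C\<^sub>y + C\<^sub>z"
  define C4 where "C4 = B * (C3 * B)\<^sup>2 + B * (C3 * B)"
  define a where "a = B / c"
  define C5 where "C5 = 2 * exp (2 * a + 1) * (C4 / c)"
  have C3: "0 \<le> C3" using C_nonneg by (simp add: C3_def)
  have C4: "0 \<le> C4" using C3 B0 by (simp add: C4_def)
  have a: "0 \<le> a" using B0 c by (simp add: a_def)
  have C5: "0 \<le> C5" using C4 c by (simp add: C5_def)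
  have main: "\<bar>yS (shift e k t 0) s - yS (e 0) s - t * sem (U k) e s\<bar> \<le> C5 * t\<^sup>2 \<and>
    \<bar>zS (shift e k t 0) s - zS (e 0) s - t * sem (U' k) e s\<bar> \<le> (a * C5 + C4 / c) * t\<^sup>2"
    if t: "\<bar>t\<bar> < min \<delta> 1" and s: "s \<in> I01" for t s
  proof -
    define x where "x = e 0"
    define \<phi> where "\<phi> = snd (e 0)"
    define \<psi> where "\<psi> = snd (e k)"
    define x' where "x' = shift e k t 0"
    have x'_eq: "x' = x + t *\<^sub>R e k" by (simp add: x'_def x_def shift_def)
    have ok': "ok (shift e k t)" using \<delta>(2) t by auto
    have N: "x \<in> N" "x' \<in> N" using ok_N[OF e] ok_N[OF ok'] by (auto simp: x_def x'_def)
    have \<phi>: "\<phi> \<in> C_infty_set \<Omega>" and \<psi>: "\<psi> \<in> C_infty_set \<Omega>" using ok_snd[OF e] by (auto simp: \<phi>_def \<psi>_def)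
    have "bnd 2 (\<bar>t\<bar> * B) (x' - x)" using bnd_scale[OF B ok_E[OF e], of t k] by (simp add: x'_eq)
    then have diff: "bnd 0 (\<bar>t\<bar> * B) (x' - x)" by (rule bnd_mono) auto
    note lip = solution_lipschitz[OF N(2,1) diff]
    let ?\<Delta>y = "\<lambda>s. yS x' s - yS x s" and ?\<Delta>z = "\<lambda>s. zS x' s - zS x s"
    let ?p = "\<lambda>s. (s, yS x s, zS x s)" and ?p' = "\<lambda>s. (s, yS x' s, zS x' s)"
    define w where "w s = ?\<Delta>y s - t * sem (U k) e s" for s
    define w' where "w' s = ?\<Delta>z s - t * sem (U' k) e s" for s
    have est: "\<bar>w' s\<bar> \<le> a * \<bar>w s\<bar> + C4 * t\<^sup>2 / c" if s: "s \<in> I01" for s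
    proof -
      define p2 where "p2 = PP [Ax2] \<phi> (?p s)"
      define p3 where "p3 = PP [Ax3] \<phi> (?p s)"
      have K: "?p s \<in> K" "?p' s \<in> K" using yS_in_K N s by auto
      have p3: "c \<le> \<bar>p3\<bar>" using p3_PP[OF N(1) K(1)] by (simp add: p3_def \<phi>_def x_def)
      have p2: "\<bar>p2\<bar> \<le> B" using B[of 0] K by (simp add: bnd_def p2_def \<phi>_def)
      define D where "D = \<bar>?\<Delta>y s\<bar> + \<bar>?\<Delta>z s\<bar>"
      have D: "0 \<le> D" "D \<le> C3 * B * \<bar>t\<bar>" using lip[OF s] by (auto simp: D_def C3_def algebra_simps)
      \<comment> \<open>A first-order mean value theorem is enough: the intermediate point is within
        \<open>D\<close> of \<open>?p s\<close>, and the bound \<open>B\<close> on second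
        derivatives turns this into a quadratic remainder.\<close>
      obtain \<theta> where \<theta>: "0 \<le> \<theta>" "\<theta> \<le> 1" "(s, yS x s + \<theta> * ?\<Delta>y s, zS x s + \<theta> * ?\<Delta>z s) \<in> K"
        "PP [] \<phi> (?p' s) - PP [] \<phi> (?p s) =
          PP ([] @ [Ax2]) \<phi> (s, yS x s + \<theta> * ?\<Delta>y s, zS x s + \<theta> * ?\<Delta>z s) * ?\<Delta>y s
          + PP ([] @ [Ax3]) \<phi> (s, yS x s + \<theta> * ?\<Delta>y s, zS x s + \<theta> * ?\<Delta>z s) * ?\<Delta>z s"
        by (rule PP_fibre_mvt[OF \<phi> K])
      define q where "q = (s, yS x s + \<theta> * ?\<Delta>y s, zS x s + \<theta> * ?\<Delta>z s)"
      have q: "q \<in> K" "PP [] \<phi> (?p' s) - PP [] \<phi> (?p s) = PP [Ax2] \<phi> q * ?\<Delta>y s + PP [Ax3] \<phi> q * ?\<Delta>z s"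
        using \<theta> by (auto simp: q_def)
      have dq: "\<bar>PP [d] \<phi> q - PP [d] \<phi> (?p s)\<bar> \<le> B * D" for d
      proof -
        have "\<bar>PP [d] (snd (e 0)) q - PP [d] (snd (e 0)) (?p s)\<bar> \<le>
            B * (\<bar>yS x s + \<theta> * ?\<Delta>y s - yS x s\<bar> + \<bar>zS x s + \<theta> * ?\<Delta>z s - zS x s\<bar>)"
          unfolding q_def using B[of 0] K(1) \<theta>(3) ok_E[OF e]
          by (intro PP_fibre_lipschitz) (auto simp: numeral_2_eq_2)
        also have "\<dots> \<le> B * D"
          unfolding D_def using \<theta>(1,2) B0 by (intro mult_left_mono add_mono) (auto simp: abs_mult mult_left_le_one_le)
        finally show ?thesis by (simp add: \<phi>_def)
      qed
      have d\<psi>: "\<bar>PP [] \<psi> (?p' s) - PP [] \<psi> (?p s)\<bar> \<le> B * D"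
        unfolding D_def \<psi>_def using K ok_E[OF e] bnd_mono[OF B, of "Suc 0" B k]
        by (intro PP_fibre_lipschitz) auto
      have z1: "PP [] \<phi> (?p s) = 0" using yS_eq[OF N(1) s] \<phi> by (simp add: PP_Nil \<phi>_def x_def)
      have z2: "PP [] \<phi> (?p' s) + t * PP [] \<psi> (?p' s) = 0"
      proof -
        have "PP [] (snd x') (?p' s) = 0" using yS_eq[OF N(2) s] N_snd[OF N(2)] by (simp add: PP_Nil)
        moreover have "snd x' = \<phi> + t *\<^sub>R \<psi>" by (simp add: x'_eq x_def \<phi>_def \<psi>_def)
        ultimately show ?thesis
          using PP_add[OF \<phi> subspace_scale[OF subspace_C_infty_set \<psi>], of "[]"] PP_scale[OF \<psi>, of "[]"] by simp
      qed
      \<comment> \<open>The linearised equation applied to the actual difference of the solutions.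
        Subtracting the two exact equations \<open>z1\<close> and \<open>z2\<close> leaves only
        products of small quantities.\<close>
      define h where "h = p3 * ?\<Delta>z s + p2 * ?\<Delta>y s + t * PP [] \<psi> (?p s)"
      have "h = - ((PP [Ax2] \<phi> q - p2) * ?\<Delta>y s) - (PP [Ax3] \<phi> q - p3) * ?\<Delta>z s
          - t * (PP [] \<psi> (?p' s) - PP [] \<psi> (?p s))"
        using q(2) z1 z2 by (simp add: h_def algebra_simps)
      then have "\<bar>h\<bar> \<le> \<bar>(PP [Ax2] \<phi> q - p2) * ?\<Delta>y s\<bar> + \<bar>(PP [Ax3] \<phi> q - p3) * ?\<Delta>z s\<bar>
          + \<bar>t * (PP [] \<psi> (?p' s) - PP [] \<psi> (?p s))\<bar>" by linarith
      also have "\<dots> \<le> (B * D) * \<bar>?\<Delta>y s\<bar> + (B * D) * \<bar>?\<Delta>z s\<bar> + \<bar>t\<bar> * (B * D)"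
        unfolding abs_mult p2_def p3_def using dq d\<psi> by (intro add_mono mult_right_mono mult_left_mono) auto
      also have "\<dots> = B * (D * D) + \<bar>t\<bar> * B * D" by (simp add: D_def algebra_simps)
      also have "\<dots> \<le> B * ((C3 * B * \<bar>t\<bar>) * (C3 * B * \<bar>t\<bar>)) + \<bar>t\<bar> * B * (C3 * B * \<bar>t\<bar>)"
        using D B0 C3 by (intro add_mono mult_left_mono mult_mono) auto
      also have "\<dots> = C4 * \<bar>t\<bar>\<^sup>2" by (simp add: C4_def power2_eq_square algebra_simps)
      finally have h: "\<bar>h\<bar> \<le> C4 * t\<^sup>2" by simp
      have eqU: "p3 * sem (U' k) e s = - (PP [] \<psi> (?p s) + p2 * sem (U k) e s)"
        using p3_nonzero[OF e s] by (simp add: U'_def p3_def p2_def \<phi>_def \<psi>_def x_def field_simps)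
      have "p3 * w' s = p3 * ?\<Delta>z s - t * (p3 * sem (U' k) e s)"
        by (simp add: w'_def algebra_simps)
      also have "\<dots> = p3 * ?\<Delta>z s + t * (PP [] \<psi> (?p s) + p2 * sem (U k) e s)"
        unfolding eqU by (simp only: mult_minus_right diff_minus_eq_add)
      finally have "p3 * w' s = p3 * ?\<Delta>z s + t * (PP [] \<psi> (?p s) + p2 * sem (U k) e s)" .
      then have "p3 * w' s = h - p2 * w s" by (simp add: w_def h_def algebra_simps)
      then have "\<bar>p3\<bar> * \<bar>w' s\<bar> = \<bar>h - p2 * w s\<bar>" by (simp flip: abs_mult)
      also have "\<dots> \<le> \<bar>h\<bar> + \<bar>p2\<bar> * \<bar>w s\<bar>" by (simp add: order_trans[OF abs_triangle_ineq4] abs_mult)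
      also have "\<dots> \<le> C4 * t\<^sup>2 + B * \<bar>w s\<bar>" using h p2 by (intro add_mono mult_right_mono) auto
      finally have "c * \<bar>w' s\<bar> \<le> C4 * t\<^sup>2 + B * \<bar>w s\<bar>"
        using mult_right_mono[OF p3, of "\<bar>w' s\<bar>"] by simp
      then have "\<bar>w' s\<bar> \<le> (C4 * t\<^sup>2 + B * \<bar>w s\<bar>) / c" using c by (simp add: pos_le_divide_eq mult.commute)
      then show ?thesis by (simp add: a_def add_divide_distrib)
    qed
    have w: "\<bar>w s\<bar> \<le> 2 * exp (2 * a + 1) * (C4 * t\<^sup>2 / c)"
    proof (rule gronwall_I01[of w w'])
      show "(w has_real_derivative w' s) (at s within I01)" if "s \<in> I01" for s
        unfolding w_def w'_def using sem_has_derivative[OF e that, of "U k"] sem_Ds_U[OF e that] that N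
        by (auto intro!: derivative_eq_intros yS_has_derivative)
      show "\<bar>w' s\<bar> \<le> a * \<bar>w s\<bar> + C4 * t\<^sup>2 / c" if "s \<in> I01" for s using est[OF that] .
      have "w 0 = 0" using N by (simp add: w_def yS_0 U_def LinA_def x'_eq x_def)
      then show "\<bar>w 0\<bar> \<le> C4 * t\<^sup>2 / c" using C4 c by simp
    qed (use a s in auto)
    then have 1: "\<bar>w s\<bar> \<le> C5 * t\<^sup>2" by (simp add: C5_def)
    have "\<bar>w' s\<bar> \<le> a * (C5 * t\<^sup>2) + C4 * t\<^sup>2 / c" using est[OF s] mult_left_mono[OF 1 a] by linarith
    then show ?thesis using 1 by (simp add: w_def w'_def x_def x'_def algebra_simps)
  qed
  show ?thesis
  proof (rule exI[of _ "max C5 (a * C5 + C4 / c)"], rule exI[of _ "min \<delta> 1"], intro conjI allI impI)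
    fix t s assume "\<bar>t\<bar> < min \<delta> 1" "s \<in> I01"
    note m = main[OF this]
    have "C5 * t\<^sup>2 \<le> max C5 (a * C5 + C4 / c) * t\<^sup>2" "(a * C5 + C4 / c) * t\<^sup>2 \<le> max C5 (a * C5 + C4 / c) * t\<^sup>2"
      by (intro mult_right_mono; simp)+
    then show "\<bar>yS (shift e k t 0) s - yS (e 0) s - t * sem (U k) e s\<bar> \<le> max C5 (a * C5 + C4 / c) * t\<^sup>2"
      "\<bar>zS (shift e k t 0) s - zS (e 0) s - t * sem (U' k) e s\<bar> \<le> max C5 (a * C5 + C4 / c) * t\<^sup>2"
      using m by linarith+
  qed (use \<delta> in auto)
qed

definition dir_differentiable :: "nat \<Rightarrow> tm \<Rightarrow> bool" where
  "dir_differentiable k a \<longleftrightarrow> (\<forall>e s. ok e \<longrightarrow> s \<in> I01 \<longrightarrow>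
     ((\<lambda>t. sem a (shift e k t) s) has_real_derivative sem (Dk k a) e s) (at 0))"

text \<open>The Lipschitz bound for \<^term>\<open>Dk k a\<close> makes the pointwise derivative uniform in \<open>s\<close>.\<close>

lemma quadratic_approximation:
  assumes a: "dir_differentiable k a" and k: "k \<noteq> 0" and e: "ok e"
  obtains C \<delta> where "\<delta> > 0" "\<And>t. \<bar>t\<bar> < \<delta> \<Longrightarrow> ok (shift e k t)"
    "\<And>t s. \<bar>t\<bar> < \<delta> \<Longrightarrow> s \<in> I01 \<Longrightarrow> \<bar>sem a (shift e k t) s - sem a e s - t * sem (Dk k a) e s\<bar> \<le> C * t\<^sup>2"
proof -
  obtain M where M: "tame M (sem (Dk k a))" using tame_sem by blast
  obtain B where B: "\<And>i. bnd M B (e i)" using bnd_env_exists[OF e] by blast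
  have B0: "0 \<le> B" using bnd_nonneg[OF B] .
  obtain C where C: "C \<ge> 0" "lips M (2 * B) C (sem (Dk k a))"
    using tameD[OF M] by metis
  obtain \<delta> where \<delta>: "\<delta> > 0" "\<And>t. \<bar>t\<bar> < \<delta> \<Longrightarrow> ok (shift e k t)" using ok_shift[OF e] by blast
  \<comment> \<open>A derivative at 0 in the shifted environment is a derivative at u in the
    original one.\<close>
  have der: "((\<lambda>t. sem a (shift e k t) s) has_real_derivative sem (Dk k a) (shift e k u) s) (at u)"
    if "\<bar>u\<bar> < \<delta>" "s \<in> I01" for u s
  proof -
    have "((\<lambda>t. sem a (shift (shift e k u) k t) s) has_real_derivative sem (Dk k a) (shift e k u) s) (at 0)"
      using a \<delta>(2)[OF that(1)] that(2) unfolding dir_differentiable_def by blast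
    then show ?thesis
      using DERIV_shift[of "\<lambda>t. sem a (shift e k t) s" _ 0 u] by (simp add: shift_shift[OF k] add.commute)
  qed
  have "\<bar>sem a (shift e k t) s - sem a e s - t * sem (Dk k a) e s\<bar> \<le> (C * B) * t\<^sup>2"
    if t: "\<bar>t\<bar> < min \<delta> 1" and s: "s \<in> I01" for t s
  proof -
    have "\<bar>sem a (shift e k t) s - sem a (shift e k 0) s - sem (Dk k a) e s * (t - 0)\<bar> \<le> (C * (\<bar>t\<bar> * B)) * \<bar>t - 0\<bar>"
    proof (rule affine_approx_of_deriv_bound[where f' = "\<lambda>u. sem (Dk k a) (shift e k u) s"])
      fix u assume "u \<in> closed_segment t 0"
      then have u: "\<bar>u\<bar> \<le> \<bar>t\<bar>" by (auto simp: closed_segment_eq_real_ivl split: if_splits)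
      then have u': "\<bar>u\<bar> < \<delta>" "\<bar>u\<bar> \<le> 1" using t by auto
      show "((\<lambda>t. sem a (shift e k t) s) has_real_derivative sem (Dk k a) (shift e k u) s) (at u)"
        using der[OF u'(1) s] .
      have "\<bar>sem (Dk k a) (shift e k u) s - sem (Dk k a) e s\<bar> \<le> C * (\<bar>u\<bar> * B)"
        using lipsD[OF C(2) close_shift[OF e \<delta>(2)[OF u'(1)] B u'(2)] s] by blast
      also have "\<dots> \<le> C * (\<bar>t\<bar> * B)" using u C B0 by (intro mult_left_mono mult_right_mono) auto
      finally show "\<bar>sem (Dk k a) (shift e k u) s - sem (Dk k a) e s\<bar> \<le> C * (\<bar>t\<bar> * B)" .
    qed
    also have "(C * (\<bar>t\<bar> * B)) * \<bar>t - 0\<bar> = (C * B) * \<bar>t\<bar>\<^sup>2" by (simp add: power2_eq_square)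
    finally show ?thesis by (simp add: shift_0 mult.commute)
  qed
  then show ?thesis using that[of "min \<delta> 1" "C * B"] \<delta> by auto
qed

text \<open>The quadratic remainder is uniform in s and can simply be integrated, which justifies
  differentiating under the integral sign.\<close>

lemma dir_differentiable_Prim:
  assumes a: "dir_differentiable k a" and k: "k \<noteq> 0"
  shows "dir_differentiable k (Prim a)"
  unfolding dir_differentiable_def
proof (intro allI impI)
  fix e s assume e: "ok e" and s: "s \<in> I01"
  obtain C \<delta> where \<delta>: "\<delta> > 0" "\<And>t. \<bar>t\<bar> < \<delta> \<Longrightarrow> ok (shift e k t)"
    and C: "\<And>t s. \<bar>t\<bar> < \<delta> \<Longrightarrow> s \<in> I01 \<Longrightarrow> \<bar>sem a (shift e k t) s - sem a e s - t * sem (Dk k a) e s\<bar> \<le> C * t\<^sup>2"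
    using quadratic_approximation[OF a k e] by metis
  show "((\<lambda>t. sem (Prim a) (shift e k t) s) has_real_derivative sem (Dk k (Prim a)) e s) (at 0)"
  proof (rule has_real_derivative_of_quadratic_bound[OF \<delta>(1)])
    fix t assume t: "\<bar>t\<bar> < \<delta>"
    have int: "sem a (shift e k t) integrable_on {0..s}" "sem a e integrable_on {0..s}"
      "sem (Dk k a) e integrable_on {0..s}" using sem_integrable \<delta>(2)[OF t] e s by auto
    have "integral {0..s} (\<lambda>r. sem a (shift e k t) r - sem a e r - t * sem (Dk k a) e r) =
        integral {0..s} (sem a (shift e k t)) - integral {0..s} (sem a e) - t * integral {0..s} (sem (Dk k a) e)"
      using integral_diff[OF integrable_diff[OF int(1,2)] integrable_on_mult_right[OF int(3)]]
        integral_diff[OF int(1,2)] by simp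
    moreover have "\<bar>integral {0..s} (\<lambda>r. sem a (shift e k t) r - sem a e r - t * sem (Dk k a) e r)\<bar> \<le> C * t\<^sup>2"
      using C[OF t] s sem_continuous[OF e] sem_continuous[OF \<delta>(2)[OF t]]
      by (intro abs_integral_bound continuous_intros) auto
    ultimately show "\<bar>sem (Prim a) (shift e k t) s - sem (Prim a) (shift e k 0) s - t * sem (Dk k (Prim a)) e s\<bar> \<le> C * t\<^sup>2"
      by (simp add: shift_0)
  qed
qed

lemma
  assumes e: "ok e" and s: "s \<in> I01"
  shows yS_dir_derivative: "((\<lambda>t. yS (shift e k t 0) s) has_real_derivative sem (U k) e s) (at 0)"
    and zS_dir_derivative: "((\<lambda>t. zS (shift e k t 0) s) has_real_derivative sem (U' k) e s) (at 0)"
proof -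
  obtain C \<delta> where "\<delta> > 0" and C: "\<And>t. \<bar>t\<bar> < \<delta> \<Longrightarrow>
    \<bar>yS (shift e k t 0) s - yS (e 0) s - t * sem (U k) e s\<bar> \<le> C * t\<^sup>2 \<and>
    \<bar>zS (shift e k t 0) s - zS (e 0) s - t * sem (U' k) e s\<bar> \<le> C * t\<^sup>2"
    using solution_quadratic_approximation[OF e] s by metis
  then show "((\<lambda>t. yS (shift e k t 0) s) has_real_derivative sem (U k) e s) (at 0)"
    "((\<lambda>t. zS (shift e k t 0) s) has_real_derivative sem (U' k) e s) (at 0)"
    by (auto intro!: has_real_derivative_of_quadratic_bound[where \<delta> = \<delta> and C = C] simp: shift_0)
qed

lemma dir_differentiable_Pd:
  assumes k: "k \<noteq> 0"
  shows "dir_differentiable k (Pd ds i)"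
  unfolding dir_differentiable_def
proof (intro allI impI)
  fix e s assume e: "ok e" and s: "s \<in> I01"
  obtain \<delta> where \<delta>: "\<delta> > 0" "\<And>t. \<bar>t\<bar> < \<delta> \<Longrightarrow> ok (shift e k t)" using ok_shift[OF e] by blast
  let ?p = "\<lambda>t. (s, yS (shift e k t 0) s, zS (shift e k t 0) s)"
  have sub: "?p t \<in> \<Omega>" if "t \<in> ball 0 \<delta>" for t
    using in_Omega[OF ok_N[OF \<delta>(2)] s, of t] that by (simp add: dist_real_def)
  have PPd: "((\<lambda>t. PP ds \<phi> (?p t)) has_real_derivative
      PP (ds @ [Ax2]) \<phi> (?p 0) * sem (U k) e s + PP (ds @ [Ax3]) \<phi> (?p 0) * sem (U' k) e s) (at 0)"
    if \<phi>: "\<phi> \<in> C_infty_set \<Omega>" for \<phi>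
  proof -
    have "((\<lambda>t. PP ds \<phi> (?p t)) has_real_derivative
      PP (ds @ [Ax1]) \<phi> (?p 0) * 0 + PP (ds @ [Ax2]) \<phi> (?p 0) * sem (U k) e s
      + PP (ds @ [Ax3]) \<phi> (?p 0) * sem (U' k) e s) (at 0 within ball 0 \<delta>)"
      by (rule PP_chain[OF \<phi>])
        (use sub \<delta>(1) yS_dir_derivative[OF e s] zS_dir_derivative[OF e s] in \<open>auto intro: has_field_derivative_at_within\<close>)
    then show ?thesis using \<delta>(1) at_within_open[of "0 :: real" "ball 0 \<delta>"] by simp
  qed
  show "((\<lambda>t. sem (Pd ds i) (shift e k t) s) has_real_derivative sem (Dk k (Pd ds i)) e s) (at 0)"
  proof (cases "i = 0")
    case False
    then show ?thesis using PPd[OF ok_snd[OF e], of i] by (simp add: dkP_def shift_0) (simp add: shift_def)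
  next
    case True
    have "PP ds (snd (shift e k t 0)) p = PP ds (snd (e 0)) p + t * PP ds (snd (e k)) p" for t p
      using PP_add[OF ok_snd[OF e] subspace_scale[OF subspace_C_infty_set ok_snd[OF e]]] PP_scale[OF ok_snd[OF e]]
      by (simp add: shift_def)
    moreover have "((\<lambda>t. PP ds (snd (e 0)) (?p t) + t * PP ds (snd (e k)) (?p t)) has_real_derivative
        sem (Dk k (Pd ds 0)) e s) (at 0)"
      by (auto intro!: derivative_eq_intros PPd ok_snd[OF e] simp: dkP_def shift_0)
    ultimately show ?thesis using True by simp
  qed
qed

lemma dir_differentiable:
  assumes k: "k \<noteq> 0"
  shows "dir_differentiable k a"
proof (induction a)
  case (Eta i)
  show ?case
    unfolding dir_differentiable_def by (auto simp: shift_def intro!: derivative_eq_intros)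
next
  case (Pd ds i)
  show ?case by (rule dir_differentiable_Pd[OF k])
next
  case Zt
  show ?case unfolding dir_differentiable_def using zS_dir_derivative by simp
next
  case Inv
  show ?case unfolding dir_differentiable_def
  proof (intro allI impI)
    fix e s assume e: "ok e" and s: "s \<in> I01"
    have "((\<lambda>t. sem (Pd [Ax3] 0) (shift e k t) s) has_real_derivative sem (dkP k [Ax3] 0) e s) (at 0)"
      using dir_differentiable_Pd[OF k, of "[Ax3]" 0] e s by (simp add: dir_differentiable_def)
    from DERIV_inverse'[OF this]
    show "((\<lambda>t. sem Inv (shift e k t) s) has_real_derivative sem (Dk k Inv) e s) (at 0)"
      using p3_nonzero[OF e s] by (simp add: shift_0 algebra_simps)
  qed
next
  case (Add a b)
  then show ?case unfolding dir_differentiable_def by (auto intro!: derivative_eq_intros)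
next
  case (Mul a b)
  then show ?case unfolding dir_differentiable_def by (auto intro!: derivative_eq_intros simp: shift_0)
next
  case (Prim a)
  then show ?case by (rule dir_differentiable_Prim[OF _ k])
next
  case (Expo a)
  then show ?case unfolding dir_differentiable_def by (auto intro!: derivative_eq_intros simp: shift_0)
qed (auto simp: dir_differentiable_def)

lemma dir_derivative:
  "k \<noteq> 0 \<Longrightarrow> ok e \<Longrightarrow> s \<in> I01 \<Longrightarrow>
    ((\<lambda>t. sem a (shift e k t) s) has_real_derivative sem (Dk k a) e s) (at 0)"
  using dir_differentiable unfolding dir_differentiable_def by blast

lemma sem_Prim_Ds: "ok e \<Longrightarrow> s \<in> I01 \<Longrightarrow> sem (Prim (Ds a)) e s = sem a e s - sem a e 0"
proof -
  assume e: "ok e" and s: "s \<in> I01"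
  have "(sem (Ds a) e has_integral sem a e s - sem a e 0) {0..s}"
  proof (rule fundamental_theorem_of_calculus)
    fix x assume "x \<in> {0..s}"
    then have "(sem a e has_real_derivative sem (Ds a) e x) (at x within {0..s})"
      using s by (intro DERIV_subset[OF sem_has_derivative[OF e]]) auto
    then show "(sem a e has_vector_derivative sem (Ds a) e x) (at x within {0..s})"
      by (simp add: has_real_derivative_iff_has_vector_derivative)
  qed (use s in auto)
  then show ?thesis by (simp add: integral_unique)
qed

text \<open>Differentiate \<open>\<integral>\<^sub>0\<^sup>s a' = a(s) - a(0)\<close> in the parameter, and the
  result in \<open>s\<close>.\<close>

lemma sem_Dk_Ds:
  assumes k: "k \<noteq> 0" and e: "ok e" and s: "s \<in> I01"
  shows "sem (Dk k (Ds a)) e s = sem (Ds (Dk k a)) e s"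
proof -
  obtain \<delta> where \<delta>: "\<delta> > 0" "\<And>t. \<bar>t\<bar> < \<delta> \<Longrightarrow> ok (shift e k t)" using ok_shift[OF e] by blast
  have eq: "sem (Prim (Dk k (Ds a))) e s = sem (Dk k a) e s - sem (Dk k a) e 0" if s: "s \<in> I01" for s
  proof -
    have "((\<lambda>t. sem (Prim (Ds a)) (shift e k t) s) has_real_derivative sem (Dk k (Prim (Ds a))) e s) (at 0)"
      by (rule dir_derivative[OF k e s])
    moreover have "((\<lambda>t. sem (Prim (Ds a)) (shift e k t) s) has_real_derivative
        sem (Dk k a) e s - sem (Dk k a) e 0) (at 0)"
      by (rule has_field_derivative_transform_within_open[of "\<lambda>t. sem a (shift e k t) s - sem a (shift e k t) 0" _ _ "ball 0 \<delta>"])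
        (use \<delta> s sem_Prim_Ds in \<open>auto intro!: DERIV_diff dir_derivative[OF k e] simp: dist_real_def\<close>)
    ultimately show ?thesis using DERIV_unique by fastforce
  qed
  have "(sem (Prim (Dk k (Ds a))) e has_real_derivative sem (Dk k (Ds a)) e s) (at s within I01)"
    using sem_has_derivative[OF e s, of "Prim (Dk k (Ds a))"] by simp
  moreover have "(sem (Prim (Dk k (Ds a))) e has_real_derivative sem (Ds (Dk k a)) e s) (at s within I01)"
  proof (rule has_field_derivative_transform_within[OF _ zero_less_one s])
    show "((\<lambda>s. sem (Dk k a) e s - sem (Dk k a) e 0) has_real_derivative sem (Ds (Dk k a)) e s) (at s within I01)"
      using sem_has_derivative[OF e s, of "Dk k a"] by (auto intro!: derivative_eq_intros)
  qed (use eq in auto)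
  ultimately show ?thesis using deriv_I_eqI[OF _ s] by metis
qed

text \<open>\<open>Ds\<close> acts on terms, but its values are derivatives within I, which are
  determined by the function. This carries \<open>sem_Dk_Ds\<close>, an equality of values only,
  through further applications of \<open>Ds\<close>.\<close>

lemma sem_Ds_cong:
  assumes e: "ok e" and eq: "\<And>s. s \<in> I01 \<Longrightarrow> sem a e s = sem b e s" and s: "s \<in> I01"
  shows "sem (Ds a) e s = sem (Ds b) e s"
proof -
  have "(sem a e has_real_derivative sem (Ds b) e s) (at s within I01)"
    by (rule has_field_derivative_transform_within[OF sem_has_derivative[OF e s] zero_less_one s]) (use eq in auto)
  then show ?thesis using sem_has_derivative[OF e s] deriv_I_eqI[OF _ s] by metis
qed

lemma sem_Dk_Ds_funpow:
  assumes k: "k \<noteq> 0" and e: "ok e"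
  shows "s \<in> I01 \<Longrightarrow> sem (Dk k ((Ds ^^ n) a)) e s = sem ((Ds ^^ n) (Dk k a)) e s"
proof (induction n arbitrary: s)
  case (Suc n)
  then show ?case using sem_Dk_Ds[OF k e, of s] sem_Ds_cong[OF e Suc.IH] by simp
qed simp

section \<open>Linearity in the direction slots\<close>

lemma sem_fresh: "fresh k a \<Longrightarrow> k \<noteq> 0 \<Longrightarrow> sem a (e(k := v)) = sem a e"
  by (induction a) auto

lemma sem_lin_add:
  assumes k: "k \<noteq> 0" and ok: "ok (e(k := v))" "ok (e(k := v'))" and E: "v \<in> E" "v' \<in> E"
  shows "lin k a \<Longrightarrow> s \<in> I01 \<Longrightarrow> sem a (e(k := v + v')) s = sem a (e(k := v)) s + sem a (e(k := v')) s"
proof (induction a arbitrary: s)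
  case (Pd ds i)
  then show ?case using k E by (simp add: PP_add E_iff)
next
  case (Mul a b)
  show ?case
  proof (cases "lin k a \<and> fresh k b")
    case True
    show ?thesis
      unfolding sem.simps Mul.IH(1)[OF conjunct1[OF True] Mul.prems(2)] sem_fresh[OF conjunct2[OF True] k]
      by (simp only: algebra_simps)
  next
    case False
    then have *: "fresh k a" "lin k b" using Mul.prems(1) by auto
    show ?thesis
      unfolding sem.simps Mul.IH(2)[OF *(2) Mul.prems(2)] sem_fresh[OF *(1) k]
      by (simp only: algebra_simps)
  qed
next
  case (Prim a)
  have "integral {0..s} (sem a (e(k := v + v'))) = integral {0..s} (\<lambda>r. sem a (e(k := v)) r + sem a (e(k := v')) r)"
    using Prim.prems by (intro integral_cong Prim.IH) auto
  also have "\<dots> = integral {0..s} (sem a (e(k := v))) + integral {0..s} (sem a (e(k := v')))"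
    using sem_integrable[OF ok(1) Prim.prems(2), of a] sem_integrable[OF ok(2) Prim.prems(2), of a] by (rule integral_add)
  finally show ?case by (simp only: sem.simps)
qed auto

lemma sem_lin_scale:
  assumes k: "k \<noteq> 0" and E: "v \<in> E"
  shows "lin k a \<Longrightarrow> s \<in> I01 \<Longrightarrow> sem a (e(k := q *\<^sub>R v)) s = q * sem a (e(k := v)) s"
proof (induction a arbitrary: s)
  case (Pd ds i)
  then show ?case using k E by (simp add: PP_scale E_iff)
next
  case (Add a b)
  then show ?case by (simp add: algebra_simps)
next
  case (Mul a b)
  show ?case
  proof (cases "lin k a \<and> fresh k b")
    case True
    show ?thesis
      unfolding sem.simps Mul.IH(1)[OF conjunct1[OF True] Mul.prems(2)] sem_fresh[OF conjunct2[OF True] k]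
      by (simp only: algebra_simps)
  next
    case False
    then have *: "fresh k a" "lin k b" using Mul.prems(1) by auto
    show ?thesis
      unfolding sem.simps Mul.IH(2)[OF *(2) Mul.prems(2)] sem_fresh[OF *(1) k]
      by (simp only: algebra_simps)
  qed
next
  case (Prim a)
  have "integral {0..s} (sem a (e(k := q *\<^sub>R v))) = integral {0..s} (\<lambda>r. q * sem a (e(k := v)) r)"
    using Prim.prems by (intro integral_cong Prim.IH) auto
  also have "\<dots> = q * integral {0..s} (sem a (e(k := v)))" by (rule integral_mult_right)
  finally show ?case by (simp only: sem.simps)
qed auto

end

section \<open>Smoothness of the solution map\<close>

text \<open>Makes limits unique, so that a directional derivative has at most one value at each
  point.\<close>

lemma Hausdorff_C_I: "Hausdorff_space (C_I i)"
  unfolding Hausdorff_space_def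
proof (intro allI impI)
  fix f g assume "f \<in> topspace (C_I i) \<and> g \<in> topspace (C_I i) \<and> f \<noteq> g"
  then have fg: "f \<in> C_I_set i" "g \<in> C_I_set i" "f \<noteq> g" by (auto simp: C_I_def)
  then obtain s where s: "s \<in> I01" "f s \<noteq> g s" by (auto simp: C_I_set_def fun_eq_iff) metis
  define \<epsilon> where "\<epsilon> = \<bar>f s - g s\<bar> / 2"
  have \<epsilon>: "\<epsilon> > 0" using s by (simp add: \<epsilon>_def)
  let ?A = "{(0::nat, I01)}"
  have A: "finite ?A" "?A \<subseteq> {k. enat k < i + 1} \<times> {I01}" by (auto simp: zero_enat_def[symmetric])
  have "disjnt (C_I.oball i ?A \<epsilon> f) (C_I.oball i ?A \<epsilon> g)"
    unfolding disjnt_iff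
  proof (intro allI notI)
    fix h assume "h \<in> C_I.oball i ?A \<epsilon> f \<and> h \<in> C_I.oball i ?A \<epsilon> g"
    then have "\<bar>h s - f s\<bar> < \<epsilon>" "\<bar>h s - g s\<bar> < \<epsilon>" using s unfolding C_I.oball_def C_I.le_on_def by force+
    then show False using abs_triangle_ineq4[of "h s - g s" "h s - f s"] unfolding \<epsilon>_def by simp
  qed
  then show "\<exists>U V. openin (C_I i) U \<and> openin (C_I i) V \<and> f \<in> U \<and> g \<in> V \<and> disjnt U V"
    using C_I.openin_oball[OF fg(1) A] C_I.openin_oball[OF fg(2) A]
      C_I.oball_centre[OF fg(1) A(2) \<epsilon>] C_I.oball_centre[OF fg(2) A(2) \<epsilon>] by blast
qed

lemma continuous_map_translation:
  assumes "locally_convex T" "x \<in> topspace T"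
  shows "continuous_map T T (\<lambda>v. x + v)"
proof -
  have add: "continuous_map (prod_topology T T) T (\<lambda>(x, y). x + y)"
    using assms(1) by (auto simp: locally_convex_def)
  show ?thesis
    using continuous_map_compose[OF _ add, of T "\<lambda>v. (x, v)"] assms
    by (simp add: continuous_map_paired o_def)
qed

text \<open>Terms have no symbol for y itself; it is recovered from \<eta> and y' by
  integration.\<close>

definition tY :: tm where "tY = Add (Eta 0) (Prim Zt)"

text \<open>Every step differentiates in a slot that is fresh for the preceding term; slot
  \<open>Suc l\<close> will hold the direction \<open>u l\<close>.\<close>

primrec dY :: "nat \<Rightarrow> tm" where
  "dY 0 = tY"
| "dY (Suc l) = Dk (Suc l) (dY l)"

lemma fresh_dY: "l < k \<Longrightarrow> fresh k (dY l)"
  by (induction l) (auto simp: tY_def intro!: fresh_Dk)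

lemma lin_dY: "0 < k \<Longrightarrow> k \<le> l \<Longrightarrow> lin k (dY l)"
proof (induction l)
  case (Suc l)
  then show ?case by (cases "k = Suc l") (auto intro!: lin_Dk lin_Dk_new fresh_dY)
qed simp

text \<open>Members of \<open>C_I_set\<close> vanish off I, whereas \<open>sem\<close> gives values
  everywhere.\<close>

definition restr :: "(real \<Rightarrow> real) \<Rightarrow> real \<Rightarrow> real" where
  "restr g = (\<lambda>s. if s \<in> I01 then g s else 0)"

lemma restr_apply: "restr g s = (if s \<in> I01 then g s else 0)"
  by (simp add: restr_def)

definition mk_env :: "real \<times> (r3 \<Rightarrow> real) \<Rightarrow> nat \<Rightarrow> (nat \<Rightarrow> real \<times> (r3 \<Rightarrow> real)) \<Rightarrow> env" where
  "mk_env x n u = (\<lambda>i. case i of 0 \<Rightarrow> x | Suc j \<Rightarrow> if j < n then u j else 0)"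

lemma mk_env_upd: "i < n \<Longrightarrow> mk_env x n (u(i := v)) = (mk_env x n u)(Suc i := v)"
  by (auto simp: mk_env_def fun_eq_iff split: nat.split)

lemma mk_env_0: "(mk_env x n u)(0 := x') = mk_env x' n u"
  by (auto simp: mk_env_def fun_eq_iff split: nat.split)

section \<open>Terms as smooth functions on I, and their graphs as iterated derivatives of the
  chart\<close>

context solution_chart
begin

lemma ok_mk_env:
  assumes "x \<in> N" "\<And>j. j < n \<Longrightarrow> u j \<in> E"
  shows "ok (mk_env x n u)"
proof -
  have "{i. mk_env x n u i \<noteq> 0} \<subseteq> {..n}"
  proof
    fix i assume "i \<in> {i. mk_env x n u i \<noteq> 0}"
    then show "i \<in> {..n}" by (cases i) (auto simp: mk_env_def split: if_splits)
  qed
  then have "finite {i. mk_env x n u i \<noteq> 0}" using finite_subset by blast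
  moreover have "mk_env x n u i \<in> E" for i
    using assms N_subset subspace_0[OF subspace_E] by (auto simp: mk_env_def split: nat.split)
  ultimately show ?thesis using assms by (simp add: ok_def mk_env_def)
qed

lemma deriv_I_restr_sem:
  assumes e: "ok e"
  shows "deriv_I (restr (sem a e)) = restr (sem (Ds a) e)"
    and "s \<in> I01 \<Longrightarrow> (restr (sem a e) has_real_derivative sem (Ds a) e s) (at s within I01)"
proof -
  show *: "(restr (sem a e) has_real_derivative sem (Ds a) e s) (at s within I01)" if s: "s \<in> I01" for s
    by (rule has_field_derivative_transform_within[OF sem_has_derivative[OF e s] zero_less_one s])
      (simp add: restr_apply)
  show "deriv_I (restr (sem a e)) = restr (sem (Ds a) e)"
  proof
    fix s
    show "deriv_I (restr (sem a e)) s = restr (sem (Ds a) e) s"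
    proof (cases "s \<in> I01")
      case True
      then show ?thesis using deriv_I_eqI[OF *[OF True] True] by (simp add: restr_apply)
    qed (auto simp: restr_apply deriv_I_def)
  qed
qed

lemma deriv_I_funpow_restr_sem: "ok e \<Longrightarrow> (deriv_I ^^ n) (restr (sem a e)) = restr (sem ((Ds ^^ n) a) e)"
  by (induction n) (auto simp: deriv_I_restr_sem)

lemma restr_sem_smooth: "ok e \<Longrightarrow> restr (sem a e) \<in> C_I_set \<infinity>"
proof -
  assume e: "ok e"
  have d: "restr (sem b e) differentiable_on I01" for b
    unfolding differentiable_on_def
    using deriv_I_restr_sem(2)[OF e] real_differentiable_def real_differentiableE by blast
  show ?thesis
    unfolding C_I_set_def
    using d deriv_I_funpow_restr_sem[OF e] differentiable_imp_continuous_on[OF d] by (auto simp: restr_apply)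
qed

lemma yS_eq_restr_sem: "ok e \<Longrightarrow> yS (e 0) = restr (sem tY e)"
proof
  fix s assume e: "ok e"
  note N = ok_N[OF e]
  show "yS (e 0) s = restr (sem tY e) s"
  proof (cases "s \<in> I01")
    case True
    have "(zS (e 0) has_integral yS (e 0) s - yS (e 0) 0) {0..s}"
    proof (rule fundamental_theorem_of_calculus)
      fix x assume "x \<in> {0..s}"
      then have "(yS (e 0) has_real_derivative zS (e 0) x) (at x within {0..s})"
        using True by (intro DERIV_subset[OF yS_has_derivative[OF N]]) auto
      then show "(yS (e 0) has_vector_derivative zS (e 0) x) (at x within {0..s})"
        by (simp add: has_real_derivative_iff_has_vector_derivative)
    qed (use True in auto)
    then show ?thesis using True yS_0[OF N] by (simp add: restr_apply tY_def integral_unique)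
  next
    case False
    then show ?thesis using yS_C_I_1[OF N] by (auto simp: restr_apply C_I_set_def)
  qed
qed

text \<open>The argument overwrites slot 0, so only the directions stored in the environment matter,
  and its own slot 0 may be a placeholder outside \<open>N\<close>.\<close>

definition graph_of :: "tm \<Rightarrow> env \<Rightarrow> ((real \<times> (r3 \<Rightarrow> real)) \<times> (real \<Rightarrow> real)) set" where
  "graph_of a e = {(x, z). x \<in> N \<and> z = restr (sem a (e(0 := x)))}"

lemma app_graph_of: "x \<in> N \<Longrightarrow> app (graph_of a e) x = restr (sem a (e(0 := x)))"
  unfolding app_def graph_of_def by auto

lemma Domain_graph_of: "Domain (graph_of a e) = N"
  by (auto simp: graph_of_def)

text \<open>Differentiating j times in s replaces \<open>a\<close> by \<open>(Ds ^^ j) a\<close>,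
  and this commutes with \<open>Dk k\<close>. Convergence in each seminorm is thus the quadratic
  approximation of another term.\<close>

lemma restr_sem_difference_quotient:
  assumes e: "ok e" and k: "k \<noteq> 0"
  shows "limitin (C_I \<infinity>) (\<lambda>t. (1 / t) *\<^sub>R (restr (sem a (shift e k t)) - restr (sem a e)))
    (restr (sem (Dk k a) e)) (at 0)"
proof (rule C_I.limitin_unif)
  obtain \<delta>\<^sub>0 where \<delta>0: "\<delta>\<^sub>0 > 0" "\<And>t. \<bar>t\<bar> < \<delta>\<^sub>0 \<Longrightarrow> ok (shift e k t)" using ok_shift[OF e] by blast
  have ev_ok: "\<forall>\<^sub>F t in at 0. ok (shift e k t)"
    unfolding eventually_at using \<delta>0 by (intro exI[of _ \<delta>\<^sub>0]) (auto simp: dist_real_def)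
  show "restr (sem (Dk k a) e) \<in> C_I_set \<infinity>" by (rule restr_sem_smooth[OF e])
  show "\<forall>\<^sub>F t in at 0. (1 / t) *\<^sub>R (restr (sem a (shift e k t)) - restr (sem a e)) \<in> C_I_set \<infinity>"
    using ev_ok
    by eventually_elim (intro subspace_scale subspace_diff subspace_C_I_set restr_sem_smooth e)
  fix j :: nat and J :: "real set" and \<epsilon> :: real
  assume j: "j \<in> {k. enat k < \<infinity> + 1}" and J: "J \<in> {I01}" and \<epsilon>: "\<epsilon> > 0"
  obtain C \<delta> where \<delta>: "\<delta> > 0" "\<And>t. \<bar>t\<bar> < \<delta> \<Longrightarrow> ok (shift e k t)"
    and C: "\<And>t s. \<bar>t\<bar> < \<delta> \<Longrightarrow> s \<in> I01 \<Longrightarrow> \<bar>sem ((Ds ^^ j) a) (shift e k t) s - sem ((Ds ^^ j) a) e s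
      - t * sem (Dk k ((Ds ^^ j) a)) e s\<bar> \<le> C * t\<^sup>2"
    using quadratic_approximation[OF dir_differentiable[OF k] k e] by metis
  \<comment> \<open>The error is at most \<open>C * \<bar>t\<bar>\<close>; the constant may be zero
    or negative, hence \<open>\<bar>C\<bar> + 1\<close> in the denominator.\<close>
  have "\<forall>\<^sub>F t in at 0. \<bar>t\<bar> < min \<delta> (\<epsilon> / (\<bar>C\<bar> + 1)) \<and> t \<noteq> 0"
    unfolding eventually_at using \<delta> \<epsilon> by (intro exI[of _ "min \<delta> (\<epsilon> / (\<bar>C\<bar> + 1))"]) (auto simp: dist_real_def)
  then show "\<forall>\<^sub>F t in at 0. \<forall>s\<in>J. \<bar>(deriv_I ^^ j) ((1 / t) *\<^sub>R (restr (sem a (shift e k t)) - restr (sem a e))) s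
      - (deriv_I ^^ j) (restr (sem (Dk k a) e)) s\<bar> \<le> \<epsilon>"
  proof (eventually_elim, intro ballI)
    fix t s assume t: "\<bar>t\<bar> < min \<delta> (\<epsilon> / (\<bar>C\<bar> + 1)) \<and> t \<noteq> 0" and "s \<in> J"
    then have s: "s \<in> I01" using J by auto
    have ok': "ok (shift e k t)" using \<delta> t by auto
    let ?q = "sem ((Ds ^^ j) a) (shift e k t) s - sem ((Ds ^^ j) a) e s"
    have "(deriv_I ^^ j) ((1 / t) *\<^sub>R (restr (sem a (shift e k t)) - restr (sem a e))) s = (1 / t) * ?q"
      using restr_sem_smooth[OF ok', of a] restr_sem_smooth[OF e, of a] j s
        C_I.D_scale[of j \<infinity> I01 s "restr (sem a (shift e k t)) - restr (sem a e)" "1 / t"]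
        C_I.D_diff[of j \<infinity> I01 s "restr (sem a (shift e k t))" "restr (sem a e)"]
        subspace_diff[OF subspace_C_I_set]
      by (simp add: deriv_I_funpow_restr_sem[OF e] deriv_I_funpow_restr_sem[OF ok'] restr_apply)
    moreover have "(deriv_I ^^ j) (restr (sem (Dk k a) e)) s = sem (Dk k ((Ds ^^ j) a)) e s"
      using s sem_Dk_Ds_funpow[OF k e s] by (simp add: deriv_I_funpow_restr_sem[OF e] restr_apply)
    moreover have "\<bar>(1 / t) * ?q - sem (Dk k ((Ds ^^ j) a)) e s\<bar> = \<bar>?q - t * sem (Dk k ((Ds ^^ j) a)) e s\<bar> / \<bar>t\<bar>"
      using t by (simp add: field_simps flip: abs_divide)
    moreover have "\<bar>?q - t * sem (Dk k ((Ds ^^ j) a)) e s\<bar> / \<bar>t\<bar> \<le> C * t\<^sup>2 / \<bar>t\<bar>"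
      using C[of t s] t s by (intro divide_right_mono) auto
    moreover have "C * t\<^sup>2 / \<bar>t\<bar> = C * \<bar>t\<bar>" using t by (auto simp: power2_eq_square abs_if)
    moreover have "C * \<bar>t\<bar> \<le> (\<bar>C\<bar> + 1) * \<bar>t\<bar>" by (intro mult_right_mono) auto
    moreover have "(\<bar>C\<bar> + 1) * \<bar>t\<bar> \<le> \<epsilon>" using t by (simp add: field_simps)
    ultimately show "\<bar>(deriv_I ^^ j) ((1 / t) *\<^sub>R (restr (sem a (shift e k t)) - restr (sem a e))) s
      - (deriv_I ^^ j) (restr (sem (Dk k a) e)) s\<bar> \<le> \<epsilon>" by linarith
  qed
qed

lemma dir_deriv_graph_of:
  assumes ok: "\<And>x. x \<in> N \<Longrightarrow> ok (e(0 := x))" and k: "k \<noteq> 0"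
  shows "dir_deriv (C_I \<infinity>) (e k) (graph_of a e) = graph_of (Dk k a) e"
proof -
  have shift: "shift (e(0 := x)) k t = e(0 := x + t *\<^sub>R e k)" for x t
    using k by (auto simp: shift_def)
  have lim: "limitin (C_I \<infinity>) (\<lambda>t. (1 / t) *\<^sub>R (app (graph_of a e) (x + t *\<^sub>R e k) - app (graph_of a e) x))
      (restr (sem (Dk k a) (e(0 := x)))) (at 0) \<and> (\<forall>\<^sub>F t in at 0. x + t *\<^sub>R e k \<in> N)"
    if x: "x \<in> N" for x
  proof -
    obtain \<delta> where \<delta>: "\<delta> > 0" "\<And>t. \<bar>t\<bar> < \<delta> \<Longrightarrow> x + t *\<^sub>R e k \<in> N"
      using N_line[OF x, of "e k"] ok_E[OF ok[OF x], of k] k by auto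
    have ev: "\<forall>\<^sub>F t in at 0. x + t *\<^sub>R e k \<in> N"
      unfolding eventually_at using \<delta> by (intro exI[of _ \<delta>]) (auto simp: dist_real_def)
    then have "\<forall>\<^sub>F t in at 0. (1 / t) *\<^sub>R (restr (sem a (shift (e(0 := x)) k t)) - restr (sem a (e(0 := x)))) =
        (1 / t) *\<^sub>R (app (graph_of a e) (x + t *\<^sub>R e k) - app (graph_of a e) x)"
      by eventually_elim (simp only: app_graph_of x shift)
    from limitin_transform_eventually[OF this restr_sem_difference_quotient[OF ok[OF x] k, of a]] ev
    show ?thesis by simp
  qed
  have "(x, z) \<in> dir_deriv (C_I \<infinity>) (e k) (graph_of a e) \<longleftrightarrow> (x, z) \<in> graph_of (Dk k a) e" for x z
  proof
    assume "(x, z) \<in> dir_deriv (C_I \<infinity>) (e k) (graph_of a e)"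
    then have x: "x \<in> N" and z: "limitin (C_I \<infinity>)
        (\<lambda>t. (1 / t) *\<^sub>R (app (graph_of a e) (x + t *\<^sub>R e k) - app (graph_of a e) x)) z (at 0)"
      by (auto simp: dir_deriv_def Domain_graph_of)
    have "z = restr (sem (Dk k a) (e(0 := x)))"
      using limitin_Hausdorff_unique[OF z conjunct1[OF lim[OF x]] _ Hausdorff_C_I] by simp
    then show "(x, z) \<in> graph_of (Dk k a) e" using x by (simp add: graph_of_def)
  next
    assume "(x, z) \<in> graph_of (Dk k a) e"
    then show "(x, z) \<in> dir_deriv (C_I \<infinity>) (e k) (graph_of a e)"
      using lim[of x] by (auto simp: dir_deriv_def Domain_graph_of graph_of_def)
  qed
  then show ?thesis by (auto simp only: set_eq_iff split_paired_all)
qed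

lemma chart_eq_graph_of: "(\<And>x. x \<in> N \<Longrightarrow> ok (e(0 := x))) \<Longrightarrow> chart = graph_of tY e"
  using chart_iff yS_eq_restr_sem[of "e(0 := _)"] by (fastforce simp: graph_of_def)

text \<open>All n directions are stored from the start and only \<open>l\<close> grows, so the
  environment stays the same throughout the induction.\<close>

lemma iter_dir_deriv_chart:
  assumes u: "\<And>j. j < n \<Longrightarrow> u j \<in> E"
  shows "l \<le> n \<Longrightarrow> iter_dir_deriv (C_I \<infinity>) l u chart = graph_of (dY l) (mk_env 0 n u)"
proof (induction l)
  case 0
  have "chart = graph_of tY (mk_env 0 n u)"
    by (rule chart_eq_graph_of) (simp only: mk_env_0 ok_mk_env[OF _ u])
  then show ?case by (simp add: iter_dir_deriv_def)
next
  case (Suc l)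
  have "iter_dir_deriv (C_I \<infinity>) (Suc l) u chart = dir_deriv (C_I \<infinity>) (u l) (iter_dir_deriv (C_I \<infinity>) l u chart)"
    by (simp add: iter_dir_deriv_def)
  also have "\<dots> = dir_deriv (C_I \<infinity>) (mk_env 0 n u (Suc l)) (graph_of (dY l) (mk_env 0 n u))"
    using Suc by (simp add: mk_env_def)
  also have "\<dots> = graph_of (Dk (Suc l) (dY l)) (mk_env 0 n u)"
    by (rule dir_deriv_graph_of) (simp_all only: mk_env_0 ok_mk_env[OF _ u] nat.simps not_False_eq_True)
  finally show ?case by simp
qed

section \<open>Multilinearity, continuity and uniformity of the higher derivatives\<close>

abbreviation "dchart \<equiv> higher_deriv (C_I \<infinity>) chart"

lemma higher_deriv_chart:
  assumes "\<And>j. j < l \<Longrightarrow> u j \<in> E" "x \<in> N"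
  shows "dchart l x u = restr (sem (dY l) (mk_env x l u))"
proof -
  have "iter_dir_deriv (C_I \<infinity>) l u chart = graph_of (dY l) (mk_env 0 l u)"
    using iter_dir_deriv_chart[of l u l] assms(1) by blast
  then show ?thesis by (simp only: higher_deriv_def app_graph_of[OF assms(2)] mk_env_0)
qed

lemma multilinear_chart:
  assumes x: "x \<in> N"
  shows "multilinear_on E l (dchart l x)"
  unfolding multilinear_on_def
proof (intro ballI allI impI conjI)
  fix u i a b q assume u: "u \<in> {..<l} \<rightarrow>\<^sub>E E" and i: "i < l" and a: "a \<in> E" and b: "b \<in> E"
  have uE: "(u(i := v)) j \<in> E" if "j < l" "v \<in> E" for v j using u that by auto
  have h: "dchart l x (u(i := v)) = restr (sem (dY l) ((mk_env x l u)(Suc i := v)))"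
    if "v \<in> E" for v
    using higher_deriv_chart[of l "u(i := v)" x] uE x that mk_env_upd[OF i, of x u v] by simp
  have ok: "ok ((mk_env x l u)(Suc i := v))" if "v \<in> E" for v
    using ok_mk_env[of x l "u(i := v)"] uE x that mk_env_upd[OF i, of x u v] by simp
  have lin: "lin (Suc i) (dY l)" using i by (intro lin_dY) auto
  show "dchart l x (u(i := a + b)) =
      dchart l x (u(i := a)) + dchart l x (u(i := b))"
    unfolding h[OF a] h[OF b] h[OF subspace_add[OF subspace_E a b]]
    using sem_lin_add[OF _ ok[OF a] ok[OF b] a b lin] by (auto simp only: fun_eq_iff restr_apply plus_fun_apply) simp
  show "dchart l x (u(i := q *\<^sub>R a)) = q *\<^sub>R dchart l x (u(i := a))"
    unfolding h[OF a] h[OF subspace_scale[OF subspace_E a]]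
    using sem_lin_scale[OF _ a lin] by (auto simp only: fun_eq_iff restr_apply scaleR_fun_apply) simp
qed

text \<open>A neighbourhood in \<open>C_I \<infinity>\<close> involves finitely many orders, so one
  \<open>M\<close> and, for each \<open>B\<close>, one constant can be shared among them. As in
  \<open>tame\<close>, \<open>M\<close> is found before \<open>B\<close> is known.\<close>

lemma sem_uniform_lipschitz:
  assumes "finite J"
  shows "\<exists>M. \<forall>B. \<exists>C\<ge>0. \<forall>j\<in>J. lips M B C (sem ((Ds ^^ j) a))"
  using assms
proof (induction J)
  case (insert j J)
  then obtain M where M: "\<And>B. \<exists>C\<ge>0. \<forall>j\<in>J. lips M B C (sem ((Ds ^^ j) a))" by blast
  obtain M' where M': "tame M' (sem ((Ds ^^ j) a))" using tame_sem by blast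
  show ?case
  proof (intro exI[of _ "max M M'"] allI)
    fix B
    obtain C where C: "C \<ge> 0" "\<And>i. i \<in> J \<Longrightarrow> lips M B C (sem ((Ds ^^ i) a))" using M[of B] by blast
    obtain C' where C': "C' \<ge> 0" "lips M' B C' (sem ((Ds ^^ j) a))" using tameD[OF M'] by metis
    show "\<exists>C\<ge>0. \<forall>i\<in>insert j J. lips (max M M') B C (sem ((Ds ^^ i) a))"
      using C(1) lips_mono[OF C(2)] lips_mono[OF C'(2)] by (intro exI[of _ "max C C'"]) auto
  qed
qed (auto intro: exI[of _ 0])

lemma le_on_restr_sem:
  assumes S: "S \<subseteq> {k. enat k < \<infinity> + 1} \<times> {I01}" and e: "ok e" "ok e'"
    and le: "\<And>j s. j \<in> fst ` S \<Longrightarrow> s \<in> I01 \<Longrightarrow> \<bar>sem ((Ds ^^ j) a) e s - sem ((Ds ^^ j) a) e' s\<bar> \<le> D"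
  shows "C_I.le_on S D (restr (sem a e) - restr (sem a e'))"
  unfolding C_I.le_on_def
proof clarify
  fix j :: nat and J s assume j: "(j, J) \<in> S" and s: "s \<in> J"
  have J: "J = I01" using S j by auto
  have "(deriv_I ^^ j) (restr (sem a e) - restr (sem a e')) s = sem ((Ds ^^ j) a) e s - sem ((Ds ^^ j) a) e' s"
    using C_I.D_diff[of j \<infinity> I01 s "restr (sem a e)" "restr (sem a e')"] restr_sem_smooth[OF e(1)]
      restr_sem_smooth[OF e(2)] s J
    by (simp add: deriv_I_funpow_restr_sem[OF e(1)] deriv_I_funpow_restr_sem[OF e(2)] restr_apply)
  moreover have "j \<in> fst ` S" using j by force
  ultimately show "\<bar>(deriv_I ^^ j) (restr (sem a e) - restr (sem a e')) s\<bar> \<le> D"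
    using le[of j s] s J by simp
qed

lemma continuous_higher_deriv_chart:
  assumes x: "x \<in> N"
  shows "continuous_map (product_topology (\<lambda>_. param_space \<Omega>) {..<l}) (C_I \<infinity>) (dchart l x)"
    (is "continuous_map ?P _ ?h")
  unfolding continuous_map_def
proof (intro conjI allI impI)
  have h: "?h u = restr (sem (dY l) (mk_env x l u))" "ok (mk_env x l u)" if "u \<in> topspace ?P" for u
    using that x by (auto intro!: higher_deriv_chart ok_mk_env simp: PiE_iff)
  show "?h \<in> topspace ?P \<rightarrow> topspace (C_I \<infinity>)"
    using h restr_sem_smooth by (auto simp: C_I_def)
  fix V assume V: "openin (C_I \<infinity>) V"
  show "openin ?P {u \<in> topspace ?P. ?h u \<in> V}"
    unfolding openin_subopen[of ?P "{u \<in> topspace ?P. ?h u \<in> V}"]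
  proof (intro ballI)
    fix u assume "u \<in> {u \<in> topspace ?P. ?h u \<in> V}"
    then have u: "u \<in> topspace ?P" "?h u \<in> V" by auto
    then have uE: "u i \<in> E" if "i < l" for i using that by (auto simp: PiE_iff)
    obtain A \<epsilon> where A: "finite A" "A \<subseteq> {k. enat k < \<infinity> + 1} \<times> {I01}" "\<epsilon> > 0" "C_I.oball \<infinity> A \<epsilon> (?h u) \<subseteq> V"
      using C_I.openin_obtain_oball[OF V u(2)] by metis
    obtain M where M: "\<And>B. \<exists>C\<ge>0. \<forall>j\<in>fst ` A. lips M B C (sem ((Ds ^^ j) (dY l)))"
      using sem_uniform_lipschitz[of "fst ` A"] A(1) by blast
    obtain B where B: "\<And>i. bnd M B (mk_env x l u i)" using bnd_env_exists[OF h(2)[OF u(1)]] by blast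
    obtain C where C: "C \<ge> 0" "\<And>j. j \<in> fst ` A \<Longrightarrow> lips M (B + 1) C (sem ((Ds ^^ j) (dY l)))" using M[of "B + 1"] by blast
    \<comment> \<open>\<open>d \<le> 1\<close> keeps the perturbed directions within the bound
      \<open>B + 1\<close>, and \<open>C + 1\<close> avoids dividing by zero.\<close>
    define d where "d = min 1 (\<epsilon> / (2 * (C + 1)))"
    have d: "0 < d" "d \<le> 1" "C * d < \<epsilon>"
    proof -
      show "0 < d" "d \<le> 1" using A(3) C(1) by (auto simp: d_def)
      have "C * d \<le> (C + 1) * (\<epsilon> / (2 * (C + 1)))"
        using C(1) \<open>0 < d\<close> by (intro mult_mono) (auto simp: d_def)
      also have "\<dots> = \<epsilon> / 2" using C(1) by (simp add: field_simps)
      also have "\<dots> < \<epsilon>" using A(3) by simp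
      finally show "C * d < \<epsilon>" .
    qed
    define G where "G = (\<Pi>\<^sub>E i\<in>{..<l}. {w \<in> E. \<exists>d'<d. bnd M d' (w - u i)})"
    have "openin ?P G" unfolding G_def by (subst openin_PiE) (auto intro!: openin_bnd_ball uE)
    moreover have "u \<in> G"
      using u(1) d bnd_zero[of 0 M] by (auto simp: G_def PiE_iff intro!: exI[of _ 0])
    moreover have "G \<subseteq> {u \<in> topspace ?P. ?h u \<in> V}"
    proof
      fix u' assume u': "u' \<in> G"
      then have u'P: "u' \<in> topspace ?P" by (auto simp: G_def PiE_iff)
      have bd: "bnd M d (u' i - u i)" if "i < l" for i
      proof -
        have "u' i \<in> {w \<in> E. \<exists>d'<d. bnd M d' (w - u i)}"
          by (rule PiE_mem[OF u'[unfolded G_def]]) (use that in simp)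
        then obtain d' where "d' < d" "bnd M d' (u' i - u i)" by blast
        then show ?thesis by (auto elim: bnd_mono)
      qed
      have bd': "bnd M d (mk_env x l u' i - mk_env x l u i)" for i
        using bd bnd_zero[of d M] d by (auto simp: mk_env_def split: nat.split)
      have ok: "ok (mk_env x l u)" "ok (mk_env x l u')" using h(2) u(1) u'P by auto
      have "close M (B + 1) d (mk_env x l u') (mk_env x l u)"
        unfolding close_def
      proof (intro conjI allI ok bd')
        fix i
        show "bnd M (B + 1) (mk_env x l u i)" using B by (rule bnd_mono) auto
        have "bnd M (B + d) (mk_env x l u i + (mk_env x l u' i - mk_env x l u i))"
          using B bd' ok_E ok subspace_diff[OF subspace_E] by (intro bnd_add) auto
        then show "bnd M (B + 1) (mk_env x l u' i)" using d by (auto elim: bnd_mono)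
      qed
      then have "C_I.le_on A (C * d) (restr (sem (dY l) (mk_env x l u')) - restr (sem (dY l) (mk_env x l u)))"
        using lipsD[OF C(2)] by (intro le_on_restr_sem A ok) blast
      then have "?h u' \<in> C_I.oball \<infinity> A \<epsilon> (?h u)"
        unfolding C_I.oball_def h(1)[OF u(1)] h(1)[OF u'P] using d restr_sem_smooth[OF ok(2)] by blast
      then show "u' \<in> {u \<in> topspace ?P. ?h u \<in> V}" using A(4) u'P by blast
    qed
    ultimately show "\<exists>T. openin ?P T \<and> u \<in> T \<and> T \<subseteq> {u \<in> topspace ?P. ?h u \<in> V}" by blast
  qed
qed

lemma uniform_continuity_higher_deriv_chart:
  assumes x: "x \<in> N" and W: "zero_nbhd (C_I \<infinity>) W"
  shows "\<exists>U. zero_nbhd (param_space \<Omega>) U \<and> (\<forall>\<epsilon>>0. \<exists>V. zero_nbhd (param_space \<Omega>) V \<and>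
    (\<forall>v\<in>V. x + v \<in> N \<and> (\<forall>u \<in> {..<l} \<rightarrow>\<^sub>E U.
      dchart l (x + v) u - dchart l x u \<in> (\<lambda>z. \<epsilon> *\<^sub>R z) ` W)))"
proof -
  obtain A \<epsilon>\<^sub>0 where A: "finite A" "A \<subseteq> {k. enat k < \<infinity> + 1} \<times> {I01}" "\<epsilon>\<^sub>0 > 0" "C_I.oball \<infinity> A \<epsilon>\<^sub>0 0 \<subseteq> W"
    using C_I.zero_nbhd_obtain_oball[OF W] by metis
  obtain M where M: "\<And>B. \<exists>C\<ge>0. \<forall>j\<in>fst ` A. lips M B C (sem ((Ds ^^ j) (dY l)))"
    using sem_uniform_lipschitz[of "fst ` A"] A(1) by blast
  have xE: "x \<in> E" using x N_subset by blast
  obtain B where B: "bnd M B x" using bnd_exists[OF xE] by blast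
  have B0: "0 \<le> B" using bnd_nonneg[OF B] .
  obtain C where C: "C \<ge> 0" "\<And>j. j \<in> fst ` A \<Longrightarrow> lips M (B + 1) C (sem ((Ds ^^ j) (dY l)))" using M[of "B + 1"] by blast
  \<comment> \<open>The unit ball of the seminorm of order \<open>M\<close>. It depends on W and l
    but not on \<epsilon>, and its elements satisfy the bound \<open>B + 1\<close> for which
    \<open>C\<close> was chosen.\<close>
  define U where "U = {w \<in> E. \<exists>d'<1. bnd M d' (w - 0)}"
  have nbhd: "zero_nbhd (param_space \<Omega>) {w \<in> E. \<exists>d'<d. bnd M d' (w - 0)}" if "d > 0" for d
    unfolding zero_nbhd_def
    using openin_bnd_ball[OF subspace_0[OF subspace_E]] subspace_0[OF subspace_E] bnd_zero[of 0 M] that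
    by (intro conjI exI[of _ "{w \<in> E. \<exists>d'<d. bnd M d' (w - 0)}"]) auto
  show ?thesis
  proof (rule exI[of _ U], intro conjI allI impI)
    show "zero_nbhd (param_space \<Omega>) U" unfolding U_def by (rule nbhd) simp
    fix \<epsilon> :: real assume \<epsilon>: "\<epsilon> > 0"
    \<comment> \<open>Chosen so that the Lipschitz bound \<open>C * d\<close>, divided by
      \<epsilon>, is at most \<open>\<epsilon>\<^sub>0 / 2\<close>; the rescaled difference then
      lies in the ball contained in W.\<close>
    define d where "d = min 1 (\<epsilon> * \<epsilon>\<^sub>0 / (2 * (C + 1)))"
    have d: "0 < d" "d \<le> 1" "C * d \<le> \<epsilon> * (\<epsilon>\<^sub>0 / 2)"
    proof -
      show "0 < d" "d \<le> 1" using A(3) C(1) \<epsilon> by (auto simp: d_def)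
      have "C * d \<le> (C + 1) * (\<epsilon> * \<epsilon>\<^sub>0 / (2 * (C + 1)))"
        using C(1) \<open>0 < d\<close> by (intro mult_mono) (auto simp: d_def)
      also have "\<dots> = \<epsilon> * (\<epsilon>\<^sub>0 / 2)" using C(1) by (simp add: field_simps)
      finally show "C * d \<le> \<epsilon> * (\<epsilon>\<^sub>0 / 2)" .
    qed
    define V where "V = {w \<in> E. \<exists>d'<d. bnd M d' (w - 0)} \<inter> {v \<in> E. x + v \<in> N}"
    have "openin (param_space \<Omega>) {v \<in> E. x + v \<in> N}"
      using openin_continuous_map_preimage[OF continuous_map_translation[OF locally_convex_param_space xE] openin_N] .
    then have "openin (param_space \<Omega>) V"
      unfolding V_def by (intro openin_Int openin_bnd_ball subspace_0[OF subspace_E])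
    moreover have "0 \<in> V"
      unfolding V_def using subspace_0[OF subspace_E] bnd_zero[of 0 M] d x by auto
    moreover have "V \<subseteq> E" unfolding V_def by blast
    ultimately have V: "zero_nbhd (param_space \<Omega>) V" unfolding zero_nbhd_def by blast
    have main: "dchart l (x + v) u - dchart l x u \<in> (\<lambda>z. \<epsilon> *\<^sub>R z) ` W"
      if v: "v \<in> V" and u: "u \<in> {..<l} \<rightarrow>\<^sub>E U" for u v
    proof -
      have vN: "x + v \<in> N" and vE: "v \<in> E" using v by (auto simp: V_def)
      have bv: "bnd M d v" using v by (auto simp: V_def elim: bnd_mono)
      have uU: "u j \<in> U" if "j < l" for j using u that by (auto simp: PiE_iff)
      have uE: "u j \<in> E" and bu: "bnd M 1 (u j)" if "j < l" for j
        using uU[OF that] by (auto simp: U_def elim: bnd_mono)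
      let ?e = "mk_env x l u" and ?e' = "mk_env (x + v) l u"
      have ok: "ok ?e" "ok ?e'" using x vN uE by (auto intro!: ok_mk_env)
      have be: "bnd M (B + 1) (?e i)" for i
        using bnd_mono[OF B] bnd_mono[OF bu, of _ M "B + 1"] bnd_zero[of "B + 1" M] B0
        by (auto simp: mk_env_def split: nat.split)
      have "bnd M (B + d) (x + v)" using B bv xE vE by (rule bnd_add)
      then have "bnd M (B + 1) (x + v)" using d by (auto elim: bnd_mono)
      then have be': "bnd M (B + 1) (?e' i)" for i
        using be[of i] by (auto simp: mk_env_def split: nat.splits)
      have "bnd M d (?e' i - ?e i)" for i
        using bv bnd_zero[of d M] d by (auto simp: mk_env_def split: nat.split)
      then have "close M (B + 1) d ?e' ?e" unfolding close_def using ok be be' by blast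
      then have le: "C_I.le_on A (C * d) (restr (sem (dY l) ?e') - restr (sem (dY l) ?e))"
        using lipsD[OF C(2)] by (intro le_on_restr_sem A ok) blast
      define D where "D = restr (sem (dY l) ?e') - restr (sem (dY l) ?e)"
      have D: "D \<in> C_I_set \<infinity>" unfolding D_def by (intro subspace_diff subspace_C_I_set restr_sem_smooth ok)
      have "\<bar>1 / \<epsilon>\<bar> * (C * d) \<le> \<epsilon>\<^sub>0 / 2" using d(3) \<epsilon> by (simp add: field_simps)
      then have "C_I.le_on A (\<epsilon>\<^sub>0 / 2) ((1 / \<epsilon>) *\<^sub>R D)"
        using le D A(2) unfolding D_def by (intro C_I.le_on_scale)
      then have "(1 / \<epsilon>) *\<^sub>R D \<in> C_I.oball \<infinity> A \<epsilon>\<^sub>0 0"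
        unfolding C_I.oball_def using A(3) subspace_scale[OF subspace_C_I_set D]
        by (auto intro!: exI[of _ "\<epsilon>\<^sub>0 / 2"] simp del: scaleR_fun_apply)
      then have "(1 / \<epsilon>) *\<^sub>R D \<in> W" using A(4) by blast
      moreover have "D = \<epsilon> *\<^sub>R ((1 / \<epsilon>) *\<^sub>R D)" using \<epsilon> unfolding scaleR_scaleR by simp
      ultimately have "D \<in> (\<lambda>z. \<epsilon> *\<^sub>R z) ` W" by blast
      moreover have "dchart l (x + v) u - dchart l x u = D"
        using higher_deriv_chart[of l u] uE x vN by (simp only: D_def)
      ultimately show ?thesis by (simp only:)
    qed
    show "\<exists>V. zero_nbhd (param_space \<Omega>) V \<and> (\<forall>v\<in>V. x + v \<in> N \<and> (\<forall>u \<in> {..<l} \<rightarrow>\<^sub>E U.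
      dchart l (x + v) u - dchart l x u \<in> (\<lambda>z. \<epsilon> *\<^sub>R z) ` W))"
      using V main by (intro exI[of _ V]) (auto simp: V_def)
  qed
qed

lemma chart_in_C_infty_pi: "(param_space \<Omega>, C_I \<infinity>, chart) \<in> C_infty_pi"
  unfolding C_infty_pi_def mem_Collect_eq prod.case
proof (intro conjI allI ballI impI)
  have dom: "Domain chart = N" using chart_iff by blast
  show "locally_convex (param_space \<Omega>)" by (rule locally_convex_param_space)
  show "locally_convex (C_I \<infinity>)" by (rule C_I.locally_convex_unif)
  show "single_valued chart" using chart_unique by (auto simp: single_valued_def)
  show "openin (param_space \<Omega>) (Domain chart)" using dom openin_N by simp
  show "Range chart \<subseteq> topspace (C_I \<infinity>)"
  proof
    fix y assume "y \<in> Range chart"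
    then obtain x where x: "x \<in> N" "y = yS x" using chart_iff by blast
    have "ok (mk_env x 0 (\<lambda>_. 0))" using x by (intro ok_mk_env) auto
    from yS_eq_restr_sem[OF this] restr_sem_smooth[OF this]
    show "y \<in> topspace (C_I \<infinity>)" using x by (simp add: C_I_def mk_env_def)
  qed
  fix l x assume "x \<in> Domain chart"
  then have x: "x \<in> N" using dom by simp
  show "\<exists>!z. (x, z) \<in> iter_dir_deriv (C_I \<infinity>) l u chart" if "u \<in> {..<l} \<rightarrow>\<^sub>E E" for u
  proof -
    have "u j \<in> E" if "j < l" for j using \<open>u \<in> _\<close> that by (auto simp: PiE_iff)
    then show ?thesis using x by (subst iter_dir_deriv_chart[of l u l]) (auto simp: graph_of_def)
  qed
  show "multilinear_on E l (dchart l x)" by (rule multilinear_chart[OF x])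
  show "continuous_map (product_topology (\<lambda>_. param_space \<Omega>) {..<l}) (C_I \<infinity>) (dchart l x)"
    by (rule continuous_higher_deriv_chart[OF x])
  show "\<exists>U. zero_nbhd (param_space \<Omega>) U \<and> (\<forall>\<epsilon>>0. \<exists>V. zero_nbhd (param_space \<Omega>) V \<and>
      (\<forall>v\<in>V. x + v \<in> Domain chart \<and> (\<forall>u \<in> {..<l} \<rightarrow>\<^sub>E U.
        dchart l (x + v) u - dchart l x u \<in> (\<lambda>z. \<epsilon> *\<^sub>R z) ` W)))"
    if "zero_nbhd (C_I \<infinity>) W" for W
    unfolding dom by (rule uniform_continuity_higher_deriv_chart[OF x that])
qed

end

section \<open>Charts at regular solutions\<close>

lemma restr_C_I_1:
  assumes der: "\<And>s. s \<in> I01 \<Longrightarrow> (y has_real_derivative z s) (at s within I01)" and z: "continuous_on I01 z"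
  shows "restr y \<in> C_I_set 1" and "s \<in> I01 \<Longrightarrow> deriv_I (restr y) s = z s"
proof -
  have der': "(restr y has_real_derivative z s) (at s within I01)" if s: "s \<in> I01" for s
    by (rule has_field_derivative_transform_within[OF der[OF s] zero_less_one s]) (simp add: restr_apply)
  show eq: "deriv_I (restr y) s = z s" if "s \<in> I01" for s using deriv_I_eqI[OF der'[OF that] that] .
  have d: "restr y differentiable_on I01"
    unfolding differentiable_on_def using der' real_differentiable_def by blast
  have "continuous_on I01 (deriv_I (restr y))" by (rule continuous_on_eq[OF z]) (simp add: eq)
  moreover have "k = 0 \<or> k = 1" if "enat k < 1 + 1" for k
    using that by (cases k) (auto simp: one_enat_def)
  ultimately have "continuous_on I01 ((deriv_I ^^ k) (restr y))" if "enat k < 1 + 1" for k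
    using differentiable_imp_continuous_on[OF d] that by fastforce
  moreover have "(deriv_I ^^ k) (restr y) differentiable_on I01" if "enat k < 1" for k
    using d that by (simp add: one_enat_def)
  ultimately show "restr y \<in> C_I_set 1" unfolding C_I_set_def by (auto simp: restr_apply)
qed

context tube
begin

text \<open>Near a solution with nonvanishing \<open>p\<^sub>3\<close>, \<open>\<Psi> s a b = \<mu> p\<^sub>3(s) \<phi>(s, a, b)\<close> with small \<open>\<mu> > 0\<close> satisfies
  the contraction hypothesis of the Picard iteration: the sign of \<open>p\<^sub>3(s)\<close> agrees with that of
  \<open>\<partial>\<^sub>3\<phi>\<close> throughout the tube.\<close>

lemma solution_chart_exists:
  assumes x0: "(x\<^sub>0, y\<^sub>0) \<in> solutions \<Omega>" and m: "m > 0"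
    and p3: "\<And>s a b. (s, a, b) \<in> K \<Longrightarrow>
      m < PP [Ax3] (snd x\<^sub>0) (s, y\<^sub>0 s, deriv_I y\<^sub>0 s) * PP [Ax3] (snd x\<^sub>0) (s, a, b)"
  shows "\<exists>N A c. x\<^sub>0 \<in> N \<and> solution_chart \<Omega> y\<^sub>0 r N A c"
proof -
  define p where "p s = PP [Ax3] (snd x\<^sub>0) (s, y\<^sub>0 s, deriv_I y\<^sub>0 s)" for s
  have x0E: "x\<^sub>0 \<in> E" and sol0: "y\<^sub>0 0 = fst x\<^sub>0" "\<And>s. s \<in> I01 \<Longrightarrow> snd x\<^sub>0 (s, y\<^sub>0 s, deriv_I y\<^sub>0 s) = 0"
    using x0 E_iff[of x\<^sub>0] by (auto simp: solutions_def)
  have \<phi>0: "snd x\<^sub>0 \<in> C_infty_set \<Omega>" using x0E E_iff by blast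
  have curve: "(s, y\<^sub>0 s, deriv_I y\<^sub>0 s) \<in> K" if "s \<in> I01" for s using that r by (simp add: K_def)
  obtain H\<^sub>0 where H0: "bnd 2 H\<^sub>0 x\<^sub>0" using bnd_exists[OF x0E] by blast
  define H where "H = max 1 H\<^sub>0"
  have H: "H \<ge> 1" "bnd 2 H x\<^sub>0" using bnd_mono[OF H0, of 2 H] by (auto simp: H_def)
  have p_le: "\<bar>p s\<bar> \<le> H" if "s \<in> I01" for s using H(2) curve[OF that] by (simp add: bnd_def p_def)
  \<comment> \<open>On \<open>N\<close> the first partial derivatives are at most
    \<open>2 * H\<close> and \<open>p\<close> is at most \<open>H\<close>, so after multiplication
    by \<mu> their products with \<open>p\<close> are at most 1.\<close>
  define \<mu> where "\<mu> = 1 / (2 * H\<^sup>2)"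
  have H2: "H * H \<ge> 1" using H mult_mono[of 1 H 1 H] by simp
  have \<mu>: "\<mu> > 0" "\<mu> * (2 * H * H) = 1" using H H2 by (auto simp: \<mu>_def power2_eq_square)
  \<comment> \<open>The derivative \<beta> of \<open>\<Psi>\<close> in the third variable lies
    between \<open>\<mu> * (m / 2)\<close> and 1, so \<open>1 - \<beta>\<close> lies between 0 and
    \<kappa>. The derivative in the second variable is at most 1, which is \<Lambda> here.\<close>
  define \<kappa> where "\<kappa> = 1 - \<mu> * (m / 2)"
  define L where "L = 4 * 1 / (1 - \<kappa>) + 1"
  define \<tau> where "\<tau> = (1 - \<kappa>) / 2 * (r / (4 * exp L))"
  have \<kappa>1: "\<kappa> < 1" using \<mu> m by (simp add: \<kappa>_def)
  have \<tau>: "\<tau> > 0" using \<kappa>1 r by (simp add: \<tau>_def)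
  \<comment> \<open>The entries serve, in this order, the bound \<open>2 * H\<close> on
    \<open>N\<close>, the lower bound \<open>m / 2\<close> in \<open>pp\<close>, the initial value,
    and the smallness of the first residual.\<close>
  define \<delta> where "\<delta> = Min {1, m / (2 * H), r / 4, \<tau> / 2}"
  have \<delta>: "\<delta> > 0" "\<delta> \<le> 1" "\<delta> \<le> m / (2 * H)" "\<delta> \<le> r / 4" "\<delta> \<le> \<tau> / 2"
    using m H r \<tau> by (auto simp: \<delta>_def)
  have \<delta>H: "H * \<delta> \<le> m / 2" using \<delta>(3) H by (simp add: field_simps)
  define N where "N = {x \<in> E. \<exists>d<\<delta>. bnd 2 d (x - x\<^sub>0)}"
  \<comment> \<open>\<open>A\<close> results from solving the contraction inequality for
    \<open>\<bar>b - b'\<bar>\<close>. Likewise \<open>c\<close> comes from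
    \<open>m / 2 \<le> \<bar>p s\<bar> * \<bar>PP [Ax3] (snd x) q\<bar>\<close> with
    \<open>\<bar>p s\<bar> \<le> H\<close>.\<close>
  define A where "A = 1 / (1 - \<kappa>)"
  define c where "c = m / (2 * H)"
  have N: "x \<in> E" "bnd 2 \<delta> (x - x\<^sub>0)" "bnd 2 (2 * H) x" if "x \<in> N" for x
  proof -
    show x: "x \<in> E" "bnd 2 \<delta> (x - x\<^sub>0)" using that by (auto simp: N_def elim: bnd_mono)
    have "bnd 2 (\<delta> + H) ((x - x\<^sub>0) + x\<^sub>0)"
      using x H(2) x0E subspace_diff[OF subspace_E] by (intro bnd_add) auto
    then show "bnd 2 (2 * H) x" using \<delta>(2) H(1) by (auto elim: bnd_mono)
  qed
  have close: "\<bar>PP ds (snd x) q - PP ds (snd x\<^sub>0) q\<bar> \<le> \<delta>" if "x \<in> N" "q \<in> K" "length ds \<le> 2" for x q ds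
  proof -
    have "\<bar>PP ds (snd (x - x\<^sub>0)) q\<bar> \<le> \<delta>" using N(2)[OF that(1)] that by (simp add: bnd_def)
    moreover have "snd x \<in> C_infty_set \<Omega>" using N(1)[OF that(1)] E_iff by blast
    ultimately show ?thesis using \<phi>0 by (simp add: PP_diff)
  qed
  have pp: "m / 2 \<le> p s * PP [Ax3] (snd x) (s, a, b)" if x: "x \<in> N" and q: "(s, a, b) \<in> K" for x s a b
  proof -
    have s: "s \<in> I01" using q by (simp add: K_def)
    have "\<bar>p s * (PP [Ax3] (snd x) (s, a, b) - PP [Ax3] (snd x\<^sub>0) (s, a, b))\<bar> \<le> H * \<delta>"
      unfolding abs_mult using p_le[OF s] close[OF x q] by (intro mult_mono) auto
    then show ?thesis using p3[OF q] \<delta>H unfolding p_def right_diff_distrib by linarith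
  qed
  have p_PP: "\<bar>p s * PP [d] (snd x) (s, a, b)\<bar> \<le> 2 * H * H"
    if x: "x \<in> N" and q: "(s, a, b) \<in> K" for x s a b d
  proof -
    have "\<bar>PP [d] (snd x) (s, a, b)\<bar> \<le> 2 * H" using N(3)[OF x] q by (simp add: bnd_def)
    then have "\<bar>p s\<bar> * \<bar>PP [d] (snd x) (s, a, b)\<bar> \<le> H * (2 * H)"
      using p_le[of s] q H by (intro mult_mono) (auto simp: K_def)
    then show ?thesis by (simp add: abs_mult)
  qed
  have "\<mu> * (m / 2) \<le> 1"
  proof -
    have "m / 2 \<le> \<bar>p 0 * PP [Ax3] (snd x\<^sub>0) (0, y\<^sub>0 0, deriv_I y\<^sub>0 0)\<bar>"
      using p3[OF curve[of 0]] m by (simp add: p_def)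
    also have "\<dots> \<le> 2 * H * H"
      using \<delta>(1) x0E bnd_zero[of 0 2] by (intro p_PP curve) (auto simp: N_def intro!: exI[of _ 0])
    finally show ?thesis using mult_left_mono[of "m / 2" "2 * H * H" \<mu>] \<mu> by simp
  qed
  then have \<kappa>0: "0 \<le> \<kappa>" by (simp add: \<kappa>_def)
  have contr: "\<bar>(b - b') - (\<mu> * p s * snd x (s, a, b) - \<mu> * p s * snd x (s, a', b'))\<bar> \<le> \<kappa> * \<bar>b - b'\<bar> + 1 * \<bar>a - a'\<bar>"
    if x: "x \<in> N" and q: "(s, a, b) \<in> K" "(s, a', b') \<in> K" for x s a b a' b'
  proof -
    have \<phi>: "snd x \<in> C_infty_set \<Omega>" using N(1)[OF x] E_iff by blast
    obtain u v where uv: "(s, u, v) \<in> K" "PP [] (snd x) (s, a, b) - PP [] (snd x) (s, a', b') =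
        PP ([] @ [Ax2]) (snd x) (s, u, v) * (a - a') + PP ([] @ [Ax3]) (snd x) (s, u, v) * (b - b')"
      using PP_fibre_mvt[OF \<phi> q(2,1)] by metis
    define \<alpha> where "\<alpha> = \<mu> * (p s * PP [Ax2] (snd x) (s, u, v))"
    define \<beta> where "\<beta> = \<mu> * (p s * PP [Ax3] (snd x) (s, u, v))"
    have \<alpha>: "\<bar>\<alpha>\<bar> \<le> 1"
      using mult_left_mono[OF p_PP[OF x uv(1), of Ax2], of \<mu>] \<mu> by (simp add: \<alpha>_def abs_mult)
    have \<beta>: "\<mu> * (m / 2) \<le> \<beta>" "\<beta> \<le> 1"
      using mult_left_mono[OF pp[OF x uv(1)], of \<mu>]
        mult_left_mono[OF order_trans[OF abs_ge_self p_PP[OF x uv(1), of Ax3]], of \<mu>] \<mu> by (simp_all add: \<beta>_def)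
    have D: "snd x (s, a, b) - snd x (s, a', b') =
        PP [Ax2] (snd x) (s, u, v) * (a - a') + PP [Ax3] (snd x) (s, u, v) * (b - b')"
      using uv(2) \<phi> by (simp add: PP_Nil)
    have "\<mu> * p s * snd x (s, a, b) - \<mu> * p s * snd x (s, a', b') = \<alpha> * (a - a') + \<beta> * (b - b')"
      unfolding right_diff_distrib[symmetric] D by (simp add: \<alpha>_def \<beta>_def algebra_simps)
    then have "(b - b') - (\<mu> * p s * snd x (s, a, b) - \<mu> * p s * snd x (s, a', b')) = (1 - \<beta>) * (b - b') - \<alpha> * (a - a')"
      by (simp add: algebra_simps)
    also have "\<bar>\<dots>\<bar> \<le> \<bar>1 - \<beta>\<bar> * \<bar>b - b'\<bar> + \<bar>\<alpha>\<bar> * \<bar>a - a'\<bar>"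
      unfolding abs_mult[symmetric] by (rule abs_triangle_ineq4)
    also have "\<dots> \<le> \<kappa> * \<bar>b - b'\<bar> + 1 * \<bar>a - a'\<bar>"
      using \<alpha> \<beta> by (intro add_mono mult_right_mono) (auto simp: \<kappa>_def)
    finally show ?thesis .
  qed
  have \<mu>p: "\<bar>\<mu> * p s\<bar> \<le> \<mu> * H" "\<mu> * H \<le> 1" if "s \<in> I01" for s
  proof -
    show "\<bar>\<mu> * p s\<bar> \<le> \<mu> * H" using p_le[OF that] \<mu> by (simp add: abs_mult)
    have "\<mu> * H * 1 \<le> \<mu> * H * (2 * H)" using \<mu>(1) H(1) by (intro mult_left_mono) auto
    then show "\<mu> * H \<le> 1" using \<mu>(2) by (simp add: mult_ac)
  qed
  have "solution_chart \<Omega> y\<^sub>0 r N A c"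
  proof
    show "openin (param_space \<Omega>) N" unfolding N_def by (rule openin_bnd_ball[OF x0E])
    show "0 \<le> A" "0 < c" using \<kappa>1 m H by (auto simp: A_def c_def)
    fix x assume x: "x \<in> N"
    show "\<bar>b - b'\<bar> \<le> A * (\<bar>a - a'\<bar> + \<bar>snd x (s, a, b) - snd x (s, a', b')\<bar>)"
      if q: "(s, a, b) \<in> K" "(s, a', b') \<in> K" for s a b a' b'
    proof -
      have s: "s \<in> I01" using q by (simp add: K_def)
      let ?D = "\<bar>snd x (s, a, b) - snd x (s, a', b')\<bar>"
      have "\<bar>\<mu> * p s * snd x (s, a, b) - \<mu> * p s * snd x (s, a', b')\<bar> \<le> 1 * ?D"
        unfolding right_diff_distrib[symmetric] abs_mult[of "\<mu> * p s"]
        using \<mu>p[OF s] by (intro mult_right_mono) auto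
      moreover have "\<bar>b - b'\<bar> \<le> \<bar>d\<bar> + \<bar>(b - b') - d\<bar>" for d
        by (rule order_trans[OF _ abs_triangle_ineq]) simp
      ultimately have "\<bar>b - b'\<bar> \<le> \<kappa> * \<bar>b - b'\<bar> + \<bar>a - a'\<bar> + ?D"
        using contr[OF x q] by (smt (verit))
      then have "\<bar>b - b'\<bar> * (1 - \<kappa>) \<le> \<bar>a - a'\<bar> + ?D" by (simp add: algebra_simps)
      then have "\<bar>b - b'\<bar> \<le> (\<bar>a - a'\<bar> + ?D) / (1 - \<kappa>)" using \<kappa>1 by (simp add: pos_le_divide_eq)
      then show ?thesis by (simp add: A_def)
    qed
    show "c \<le> \<bar>PP [Ax3] (snd x) q\<bar>" if "q \<in> K" for q
    proof -
      obtain s a b where q: "q = (s, a, b)" by (metis prod.collapse)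
      have s: "s \<in> I01" using that by (simp add: q K_def)
      have "m / 2 \<le> \<bar>p s * PP [Ax3] (snd x) q\<bar>" using pp[OF x] that q by force
      also have "\<dots> \<le> H * \<bar>PP [Ax3] (snd x) q\<bar>" unfolding abs_mult using p_le[OF s] by (intro mult_right_mono) auto
      finally show ?thesis using H by (simp add: c_def field_simps)
    qed
    have \<phi>: "snd x \<in> C_infty_set \<Omega>" using N(1)[OF x] E_iff by blast
    have \<eta>: "\<bar>fst x - y\<^sub>0 0\<bar> \<le> \<delta>" using N(2)[OF x] by (simp add: bnd_def sol0)
    have tube: "(s, a, b) \<in> K \<longleftrightarrow> s \<in> I01 \<and> \<bar>a - y\<^sub>0 s\<bar> \<le> r \<and> \<bar>b - deriv_I y\<^sub>0 s\<bar> \<le> r" for s a b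
      by (simp add: K_def)
    have cont: "continuous_on {(s, a, b). (s, a, b) \<in> K} (\<lambda>(s, a, b). \<mu> * p s * snd x (s, a, b))"
    proof -
      have "continuous_on I01 p"
        unfolding p_def
        by (rule continuous_on_compose2[OF continuous_on_PP[OF \<phi>0]])
          (use curve K_subset C_I_1_continuous[OF y0] in \<open>auto intro!: continuous_intros\<close>)
      then have "continuous_on K (\<lambda>q. p (fst q))"
        by (rule continuous_on_compose2) (auto simp: K_def intro!: continuous_intros)
      moreover have "continuous_on K (snd x)"
        using \<phi> K_subset by (auto simp: C_infty_set_def intro: continuous_on_subset)
      ultimately have "continuous_on K (\<lambda>q. \<mu> * p (fst q) * snd x q)" by (intro continuous_intros)
      moreover have "{(s, a, b). (s, a, b) \<in> K} = K" by auto
      ultimately show ?thesis by (simp add: case_prod_unfold)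
    qed
    \<comment> \<open>The residual has two sources: moving the initial value contributes at most
      \<open>2 * H * \<delta>\<close>, and changing the function at most
      \<open>\<delta> \<le> H * \<delta>\<close>. The factor \<open>\<mu> * H\<close> then leaves
      \<open>3 / 2 * \<delta>\<close>.\<close>
    have small: "\<bar>\<mu> * p s * snd x (s, y\<^sub>0 s + (fst x - y\<^sub>0 0), deriv_I y\<^sub>0 s)\<bar> \<le> (1 - \<kappa>) / 2 * (r / (4 * exp L))"
      if s: "s \<in> I01" for s
    proof -
      have q: "(s, y\<^sub>0 s + (fst x - y\<^sub>0 0), deriv_I y\<^sub>0 s) \<in> K" using s \<eta> \<delta>(4) r by (simp add: K_def)
      have "bnd (Suc (length ([] :: axis list))) (2 * H) x" using N(3)[OF x] by (rule bnd_mono) auto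
      from PP_fibre_lipschitz[OF N(1)[OF x] this curve[OF s] q]
      have 1: "\<bar>snd x (s, y\<^sub>0 s + (fst x - y\<^sub>0 0), deriv_I y\<^sub>0 s) - snd x (s, y\<^sub>0 s, deriv_I y\<^sub>0 s)\<bar>
          \<le> 2 * H * \<bar>fst x - y\<^sub>0 0\<bar>" using \<phi> by (simp add: PP_Nil)
      have 2: "\<bar>snd x (s, y\<^sub>0 s, deriv_I y\<^sub>0 s)\<bar> \<le> \<delta>"
        using close[OF x curve[OF s], of "[]"] sol0(2)[OF s] \<phi> \<phi>0 by (simp add: PP_Nil)
      have "2 * H * \<bar>fst x - y\<^sub>0 0\<bar> \<le> 2 * H * \<delta>" using \<eta> H by (intro mult_left_mono) auto
      moreover have "1 * \<delta> \<le> H * \<delta>" using H \<delta>(1) by (intro mult_right_mono) auto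
      ultimately have "\<bar>snd x (s, y\<^sub>0 s + (fst x - y\<^sub>0 0), deriv_I y\<^sub>0 s)\<bar> \<le> 3 * H * \<delta>" using 1 2 by linarith
      then have "\<bar>\<mu> * p s * snd x (s, y\<^sub>0 s + (fst x - y\<^sub>0 0), deriv_I y\<^sub>0 s)\<bar> \<le> \<mu> * H * (3 * H * \<delta>)"
        unfolding abs_mult[of "\<mu> * p s"] using \<mu>p[OF s] \<mu>(1) H by (intro mult_mono) auto
      also have "\<mu> * H * (3 * H * \<delta>) = (\<mu> * (2 * H * H)) * (3 / 2 * \<delta>)" by simp
      also have "\<dots> = 3 / 2 * \<delta>" unfolding \<mu>(2) by simp
      also have "\<dots> \<le> \<tau>" using \<delta>(1,5) by simp
      finally show ?thesis by (simp add: \<tau>_def)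
    qed
    obtain y z where yz: "continuous_on I01 z" "y 0 = fst x"
      "\<And>s. s \<in> I01 \<Longrightarrow> (y has_real_derivative z s) (at s within I01)"
      "\<And>s. s \<in> I01 \<Longrightarrow> \<bar>y s - y\<^sub>0 s\<bar> \<le> r / 2" "\<And>s. s \<in> I01 \<Longrightarrow> \<bar>z s - deriv_I y\<^sub>0 s\<bar> \<le> r / 2"
      "\<And>s. s \<in> I01 \<Longrightarrow> \<mu> * p s * snd x (s, y s, z s) = 0"
      by (rule implicit_ode_solution[OF C_I_1_continuous(2)[OF y0] C_I_1_has_derivative[OF y0] r \<kappa>0 \<kappa>1
            zero_le_one L_def tube cont contr[OF x] order_trans[OF \<eta> \<delta>(4)] small])
        (assumption+, rule that, assumption+)
    note y = restr_C_I_1[OF yz(3,1)]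
    have nr: "near (restr y)"
      unfolding near_def using r yz(4,5) y(2) by (intro exI[of _ "r / 2"]) (auto simp: restr_apply)
    moreover have "snd x (s, y s, z s) = 0" if s: "s \<in> I01" for s
    proof -
      have "p s \<noteq> 0" using p3[OF curve[OF s]] m by (auto simp: p_def)
      then show ?thesis using yz(6)[OF s] \<mu>(1) by simp
    qed
    moreover have "(s, restr y s, deriv_I (restr y) s) \<in> \<Omega>" if "s \<in> I01" for s
      using near_in_K[OF nr that] K_subset by blast
    ultimately have "near (restr y) \<and> ((fst x, snd x), restr y) \<in> solutions \<Omega>"
      using y \<phi> yz(2) unfolding solutions_def by (auto simp: restr_apply)
    then show "\<exists>y. near y \<and> (x, y) \<in> solutions \<Omega>" by auto
  qed
  moreover have "x\<^sub>0 \<in> N" using x0E \<delta>(1) bnd_zero[of 0 2] by (auto simp: N_def intro!: exI[of _ 0])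
  ultimately show ?thesis by blast
qed

end

text \<open>Turns closeness within the tube into membership in an open set of the C^1 topology, from
  which \<open>W\<close> is formed.\<close>

lemma near_eq_oball:
  assumes "tube \<Omega> y\<^sub>0 r" "y \<in> C_I_set 1"
  shows "tube.near y\<^sub>0 r y \<longleftrightarrow> y \<in> C_I.oball 1 {(0, I01), (1, I01)} r y\<^sub>0"
proof -
  interpret tube \<Omega> y\<^sub>0 r by fact
  have "(deriv_I ^^ 1) (y - y\<^sub>0) s = deriv_I y s - deriv_I y\<^sub>0 s" if "s \<in> I01" for s
    using C_I.D_diff[of 1 1 I01 s y y\<^sub>0] assms y0 that by (simp add: one_enat_def)
  then show ?thesis
    using assms(2) unfolding near_def C_I.oball_def C_I.le_on_def by auto
qed

theorem theorem5p2:
  fixes \<Omega> :: "(real \<times> real \<times> real) set"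
    and w :: "(real \<times> (real \<times> real \<times> real \<Rightarrow> real)) \<times> (real \<Rightarrow> real)"
  assumes "openin (top_of_set (I01 \<times> UNIV \<times> UNIV)) \<Omega>"
    and "w \<in> regular_solutions \<Omega>"
  shows "\<exists>W. openin (prod_topology (param_space \<Omega>) (C_I 1)) W \<and> w \<in> W \<and>
             (param_space \<Omega>, C_I \<infinity>, solutions \<Omega> \<inter> W) \<in> C_infty_pi"
proof -
  interpret rel_open \<Omega> by standard (rule assms(1))
  obtain x\<^sub>0 y\<^sub>0 where w: "w = (x\<^sub>0, y\<^sub>0)" by (cases w)
  define z\<^sub>0 where "z\<^sub>0 = deriv_I y\<^sub>0"
  define \<phi> where "\<phi> = snd x\<^sub>0"
  have sol: "(x\<^sub>0, y\<^sub>0) \<in> solutions \<Omega>" and reg: "regular \<Omega> (x\<^sub>0, y\<^sub>0)"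
    using assms(2) by (auto simp: regular_solutions_def w)
  have \<phi>: "\<phi> \<in> C_infty_set \<Omega>" and y0: "y\<^sub>0 \<in> C_I_set 1" and curve: "\<And>s. s \<in> I01 \<Longrightarrow> (s, y\<^sub>0 s, z\<^sub>0 s) \<in> \<Omega>"
    using sol by (auto simp: solutions_def \<phi>_def z\<^sub>0_def)
  define p where "p s = PP [Ax3] \<phi> (s, y\<^sub>0 s, z\<^sub>0 s)" for s
  have p_nz: "p s \<noteq> 0" if "s \<in> I01" for s
    using reg that by (cases x\<^sub>0) (auto simp: regular_def Let_def p_def PP_def \<phi>_def z\<^sub>0_def)
  note cy = C_I_1_continuous[OF y0, folded z\<^sub>0_def]
  have cp: "continuous_on I01 p"
    unfolding p_def
    by (rule continuous_on_compose2[OF continuous_on_PP[OF \<phi>]]) (use curve cy in \<open>auto intro!: continuous_intros\<close>)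
  \<comment> \<open>Minimising the square treats both signs of p at once.\<close>
  then have "\<exists>s\<in>I01. \<forall>s'\<in>I01. (p s)\<^sup>2 \<le> (p s')\<^sup>2"
    by (intro continuous_attains_inf continuous_intros) auto
  then obtain s\<^sub>0 where s0: "s\<^sub>0 \<in> I01" "\<And>s. s \<in> I01 \<Longrightarrow> (p s\<^sub>0)\<^sup>2 \<le> (p s)\<^sup>2" by blast
  \<comment> \<open>Half the minimum, so that on the curve itself, where the product below equals
    the square of \<open>p s\<close>, the strict bound by \<open>m\<close> holds with room to
    spare.\<close>
  define m where "m = (p s\<^sub>0)\<^sup>2 / 2"
  have m: "m > 0" using p_nz[OF s0(1)] by (simp add: m_def)
  \<comment> \<open>The region where \<open>PP [Ax3] \<phi>\<close> has the sign of \<open>p\<close>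
    on the same fibre, quantitatively. It is relatively open and contains the compact curve, hence
    also a tube of positive radius around it.\<close>
  define \<Omega>' where "\<Omega>' = \<Omega> \<inter> (\<lambda>q. p (fst q) * PP [Ax3] \<phi> q) -` {m<..}"
  have "continuous_on \<Omega> (\<lambda>q. p (fst q))"
    by (rule continuous_on_compose2[OF cp]) (use \<Omega>_strip in \<open>auto intro!: continuous_intros\<close>)
  then have "continuous_on \<Omega> (\<lambda>q. p (fst q) * PP [Ax3] \<phi> q)"
    by (intro continuous_intros continuous_on_PP \<phi>)
  then have "openin (top_of_set \<Omega>) \<Omega>'" unfolding \<Omega>'_def by (intro continuous_openin_preimage_gen) auto
  then have "openin (top_of_set (I01 \<times> UNIV \<times> UNIV)) \<Omega>'" using rel_open by (rule openin_trans)
  then obtain G where G: "open G" "\<Omega>' = (I01 \<times> UNIV \<times> UNIV) \<inter> G" unfolding openin_open by auto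
  have curve': "(s, y\<^sub>0 s, z\<^sub>0 s) \<in> G" if "s \<in> I01" for s
  proof -
    have "m < (p s)\<^sup>2" using s0(2)[OF that] m unfolding m_def by linarith
    then have "(s, y\<^sub>0 s, z\<^sub>0 s) \<in> \<Omega>'" using curve[OF that] by (simp add: \<Omega>'_def p_def power2_eq_square)
    then show ?thesis using G by blast
  qed
  have cpt: "compact ((\<lambda>s. (s, y\<^sub>0 s, z\<^sub>0 s)) ` I01)"
    using cy by (intro compact_continuous_image continuous_intros) auto
  have sub: "(\<lambda>s. (s, y\<^sub>0 s, z\<^sub>0 s)) ` I01 \<subseteq> G" using curve' by (rule image_subsetI)
  obtain e where e: "e > 0" "(\<Union>q\<in>(\<lambda>s. (s, y\<^sub>0 s, z\<^sub>0 s)) ` I01. ball q e) \<subseteq> G"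
    by (rule compact_subset_open_imp_ball_epsilon_subset[OF cpt G(1) sub])
  \<comment> \<open>Two coordinates deviate by at most \<open>r\<close> each, so the distance is at
    most \<open>2 * r < e\<close>.\<close>
  define r where "r = e / 3"
  have in_\<Omega>': "(s, a, b) \<in> \<Omega>'" if s: "s \<in> I01" and ab: "\<bar>a - y\<^sub>0 s\<bar> \<le> r" "\<bar>b - z\<^sub>0 s\<bar> \<le> r" for s a b
  proof -
    have "dist (s, y\<^sub>0 s, z\<^sub>0 s) (s, a, b) \<le> \<bar>a - y\<^sub>0 s\<bar> + \<bar>b - z\<^sub>0 s\<bar>"
      using norm_Pair_le[of "y\<^sub>0 s - a" "z\<^sub>0 s - b"] norm_Pair_le[of "s - s" "(y\<^sub>0 s - a, z\<^sub>0 s - b)"]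
      by (simp add: dist_norm abs_minus_commute)
    then have "(s, a, b) \<in> ball (s, y\<^sub>0 s, z\<^sub>0 s) e" using ab e(1) by (simp add: r_def)
    then have "(s, a, b) \<in> G" using e(2) s by blast
    then show ?thesis using G(2) s by simp
  qed
  have tb: "tube \<Omega> y\<^sub>0 r"
  proof
    show "r > 0" using e by (simp add: r_def)
    show "{(s, a, b). s \<in> I01 \<and> \<bar>a - y\<^sub>0 s\<bar> \<le> r \<and> \<bar>b - deriv_I y\<^sub>0 s\<bar> \<le> r} \<subseteq> \<Omega>"
      using in_\<Omega>' by (auto simp: \<Omega>'_def z\<^sub>0_def)
  qed (rule y0)
  interpret tube \<Omega> y\<^sub>0 r by (rule tb)
  have "m < PP [Ax3] (snd x\<^sub>0) (s, y\<^sub>0 s, deriv_I y\<^sub>0 s) * PP [Ax3] (snd x\<^sub>0) (s, a, b)" if "(s, a, b) \<in> K" for s a b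
    using in_\<Omega>'[of s a b] that by (auto simp: K_def \<Omega>'_def p_def \<phi>_def z\<^sub>0_def)
  then obtain N A c where x0N: "x\<^sub>0 \<in> N" and chart: "solution_chart \<Omega> y\<^sub>0 r N A c"
    using solution_chart_exists[OF sol m] by blast
  interpret solution_chart \<Omega> y\<^sub>0 r N A c by (rule chart)
  let ?O = "C_I.oball 1 {(0, I01), (1, I01)} r y\<^sub>0"
  have O: "finite {(0::nat, I01), (1, I01)}" "{(0, I01), (1, I01)} \<subseteq> {k. enat k < 1 + 1} \<times> {I01}"
    by (auto simp: one_enat_def zero_enat_def)
  have "openin (C_I 1) ?O" by (rule C_I.openin_oball[OF y0 O])
  then have "openin (prod_topology (param_space \<Omega>) (C_I 1)) (N \<times> ?O)"
    using openin_N by (simp add: openin_prod_Times_iff)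
  moreover have "w \<in> N \<times> ?O" using x0N C_I.oball_centre[OF y0 O(2)] r by (simp add: w)
  \<comment> \<open>The solutions over \<open>N\<close> inside the open C^1 ball form exactly the
    chart, whose smoothness into \<open>C_I \<infinity>\<close> is established; \<open>W\<close>
    itself is open only with respect to C^1.\<close>
  moreover have "solutions \<Omega> \<inter> (N \<times> ?O) = chart"
  proof -
    have "(x, y) \<in> solutions \<Omega> \<Longrightarrow> y \<in> C_I_set 1" for x y by (cases x) (auto simp: solutions_def)
    then have "(x, y) \<in> solutions \<Omega> \<inter> (N \<times> ?O) \<longleftrightarrow> (x, y) \<in> chart" for x y
      using near_eq_oball[OF tb, of y] unfolding chart_def by blast
    then show ?thesis by (intro equalityI subrelI) blast+
  qed
  ultimately show ?thesis using chart_in_C_infty_pi by (intro exI[of _ "N \<times> ?O"]) simp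
qed

end
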